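(* Let $z_1,z_2\in\mathbb{C}\setminus(-\infty,1]$ and $\nu,\mu\in\mathbb{C}^\ast$, such that $\Re(\nu-\mu)>-1$. Then $$Q_\nu^\mu(z_1)Q_\nu^\mu(z_2)=\frac{e^{i\pi\mu}\sqrt{\tfrac{\pi}{2}}\,\Gamma(\nu+\mu+1)}{\Gamma(\mu+\frac12)\Gamma(\nu-\mu+1)}\,\frac{(z_1z_2)^{\mu-\frac12}}{(z_1^2-1)^{\frac12\mu}(z_2^2-1)^{\frac12\mu}}\int_{z_1z_2+\sqrt{(z_1^2-1)(z_2^2-1)}}^\infty Q_\nu^\mu(z_3)\,\frac{\left(\frac{z_1^2+z_2^2+z_3^2-1}{2z_1z_2}-z_3\right)^{\mu-\frac12}}{(z_3^2-1)^{\frac12\mu}}\,dz_3 .$$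
   Context: $\mathbb{C}^\ast=\mathbb{C}\setminus\{0\}$. The associated Legendre function of the second kind on $\mathbb{C}\setminus(-\infty,1]$ is $Q_\nu^\mu(z)=\frac{\sqrt\pi\,e^{i\pi\mu}\Gamma(\nu+\mu+1)(z^2-1)^{\mu/2}}{2^{\nu+1}z^{\nu+\mu+1}}\mathbf{F}\big(\frac{\nu+\mu+1}{2},\frac{\nu+\mu+2}{2};\nu+\frac32;\frac1{z^2}\big)$ for $|z|>1$, and elsewhere by analytic continuation, where $\mathbf{F}(a,b;c;z)=\sum_{n\ge0}\frac{(a)_n(b)_n}{\Gamma(c+n)}\frac{z^n}{n!}$ is the regularized Gauss hypergeometric function.
   Formalization: Re μ > −1/2 is added, since otherwise the integral diverges at its lower limit (e.g. z1=z2=2, ν=1, μ=−1); where the lower limit falls on or beyond the cut (−∞,1], the factors in z3 are continued analytically along the path. *)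

theory Defs
  imports "HOL-Complex_Analysis.Complex_Analysis"
begin

definition slit_plane :: "complex set" where
  "slit_plane = UNIV - complex_of_real ` {..1}"

text \<open>
  The factor \<open>rGamma\<close> is \<open>1 / \<Gamma>\<close>, extended by \<open>0\<close> at the poles of \<open>\<Gamma>\<close>. The series is only used for
  \<open>norm z < 1\<close>.
\<close>

definition hyp2F1_reg :: "complex \<Rightarrow> complex \<Rightarrow> complex \<Rightarrow> complex \<Rightarrow> complex" where
  "hyp2F1_reg a b c z =
     (\<Sum>n. pochhammer a n * pochhammer b n * rGamma (c + of_nat n) * (z ^ n / fact n))"

text \<open>
  The branch of \<open>(z\<^sup>2 - 1)\<^sup>\<alpha>\<close> that is holomorphic on the slit plane and positive for \<open>z > 1\<close>, \<open>\<alpha>\<close> real.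
  The principal power of \<open>z\<^sup>2 - 1\<close> differs from it for \<open>Re z < 0\<close> and jumps on the imaginary axis.
\<close>

definition sqm1_powr :: "complex \<Rightarrow> complex \<Rightarrow> complex" where
  "sqm1_powr z \<alpha> = (z - 1) powr \<alpha> * (z + 1) powr \<alpha>"

definition legendre_Q_series :: "complex \<Rightarrow> complex \<Rightarrow> complex \<Rightarrow> complex" where
  "legendre_Q_series \<nu> \<mu> z =
     of_real (sqrt pi) * exp (\<i> * of_real pi * \<mu>) * Gamma (\<nu> + \<mu> + 1) * sqm1_powr z (\<mu> / 2)
       / (2 powr (\<nu> + 1) * z powr (\<nu> + \<mu> + 1))
       * hyp2F1_reg ((\<nu> + \<mu> + 1) / 2) ((\<nu> + \<mu> + 2) / 2) (\<nu> + 3 / 2) (1 / z\<^sup>2)"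

text \<open>
  The choice is only applied on the connected slit plane, where the continuation is unique.
\<close>

definition legendre_Q :: "complex \<Rightarrow> complex \<Rightarrow> complex \<Rightarrow> complex" where
  "legendre_Q \<nu> \<mu> =
     (SOME f. f holomorphic_on slit_plane \<and>
        (\<forall>z\<in>slit_plane. norm z > 1 \<longrightarrow> f z = legendre_Q_series \<nu> \<mu> z))"

text \<open>
  The map \<open>cosh\<close> sends the half strip \<open>Re c > 0\<close>, \<open>\<bar>Im c\<bar> < \<pi>\<close> bijectively onto the slit plane, with
  inverse \<open>arcosh_slit\<close>. (The library function \<open>arcosh\<close> uses the principal power of \<open>z\<^sup>2 - 1\<close> and is
  not this inverse for \<open>Re z < 0\<close>.)
\<close>

definition arcosh_slit :: "complex \<Rightarrow> complex" where
  "arcosh_slit z = Ln (z + sqm1_powr z (1 / 2))"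

text \<open>
  For complex \<open>z\<^sub>1\<close>, \<open>z\<^sub>2\<close> in the slit plane the point \<open>z\<^sub>1 z\<^sub>2 + sqrt ((z\<^sub>1\<^sup>2 - 1) (z\<^sub>2\<^sup>2 - 1))\<close> may lie on the cut
  or, followed continuously from \<open>z\<^sub>1, z\<^sub>2 > 1\<close>, beyond it. Functions of the integration variable \<open>z\<^sub>3\<close> are
  therefore continued analytically across the cut: with \<open>z\<^sub>3 = cosh c\<close>, a function \<open>f\<close> on the slit plane
  becomes a function of \<open>c\<close> on the half plane \<open>Re c > 0\<close>. For \<open>\<bar>Im c\<bar> < \<pi>\<close> its value is just \<open>f z\<^sub>3\<close>.
\<close>

definition cosh_continuation :: "(complex \<Rightarrow> complex) \<Rightarrow> complex \<Rightarrow> complex" where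
  "cosh_continuation f =
     (SOME g. g holomorphic_on {c. Re c > 0} \<and>
        (\<forall>c. Re c > 0 \<and> \<bar>Im c\<bar> < pi \<longrightarrow> g c = f (cosh c)))"

definition lower_limit :: "complex \<Rightarrow> complex \<Rightarrow> complex" where
  "lower_limit z1 z2 = arcosh_slit z1 + arcosh_slit z2"

lemma sqm1_powr_half_squared: "(sqm1_powr z (1 / 2))\<^sup>2 = z\<^sup>2 - 1"
proof -
  have h: "(w powr (1 / 2))\<^sup>2 = w" for w :: complex
    by (metis csqrt_conv_powr power2_csqrt powr_0 csqrt_0)
  show ?thesis
    unfolding sqm1_powr_def power_mult_distrib h by (simp add: algebra_simps power2_eq_square)
qed

lemma exp_arcosh_slit:
  "exp (arcosh_slit z) = z + sqm1_powr z (1 / 2)"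
  "exp (- arcosh_slit z) = z - sqm1_powr z (1 / 2)"
proof -
  have p: "(z + sqm1_powr z (1 / 2)) * (z - sqm1_powr z (1 / 2)) = 1"
    using sqm1_powr_half_squared[of z] by (simp add: algebra_simps power2_eq_square)
  hence nz: "z + sqm1_powr z (1 / 2) \<noteq> 0" by auto
  thus e: "exp (arcosh_slit z) = z + sqm1_powr z (1 / 2)"
    by (simp add: arcosh_slit_def)
  show "exp (- arcosh_slit z) = z - sqm1_powr z (1 / 2)"
    using p nz by (simp add: exp_minus e inverse_eq_divide divide_eq_eq mult.commute)
qed

lemma cosh_arcosh_slit: "cosh (arcosh_slit z) = z"
  and sinh_arcosh_slit: "sinh (arcosh_slit z) = sqm1_powr z (1 / 2)"
  by (simp_all add: cosh_def sinh_def exp_arcosh_slit scaleR_conv_of_real)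

lemma cosh_lower_limit:
  "cosh (lower_limit z1 z2) = z1 * z2 + sqm1_powr z1 (1 / 2) * sqm1_powr z2 (1 / 2)"
  by (simp add: lower_limit_def cosh_add cosh_arcosh_slit sinh_arcosh_slit)

definition kernel_base :: "complex \<Rightarrow> complex \<Rightarrow> complex \<Rightarrow> complex" where
  "kernel_base z1 z2 z3 = (z1\<^sup>2 + z2\<^sup>2 + z3\<^sup>2 - 1) / (2 * z1 * z2) - z3"

text \<open>
  The base vanishes only for \<open>z\<^sub>3 = cosh (a \<plusminus> b)\<close>, \<open>a = arcosh_slit z\<^sub>1\<close>, \<open>b = arcosh_slit z\<^sub>2\<close>, hence has a
  holomorphic logarithm in \<open>c\<close> on \<open>Re c > Re (a + b)\<close>. As \<open>z\<^sub>3 \<rightarrow> +\<infinity>\<close> along the reals the base is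
  asymptotic to \<open>z\<^sub>3\<^sup>2 / (2 z\<^sub>1 z\<^sub>2)\<close>; the logarithm is fixed by asking that it be asymptotic to
  \<open>2 ln z\<^sub>3 - ln 2 - Ln (z\<^sub>1 z\<^sub>2)\<close>. Unless \<open>z\<^sub>1 z\<^sub>2\<close> is a negative real this is the principal logarithm for
  large real \<open>z\<^sub>3\<close>. In any case the product \<open>(z\<^sub>1 z\<^sub>2)\<^sup>\<alpha> kernel_base\<^sup>\<alpha>\<close> is then the analytic continuation in
  \<open>z\<^sub>1\<close>, \<open>z\<^sub>2\<close> of the product of positive powers at \<open>z\<^sub>1, z\<^sub>2 > 1\<close>, \<open>\<alpha>\<close> real.
\<close>

definition kernel_log :: "complex \<Rightarrow> complex \<Rightarrow> complex \<Rightarrow> complex" where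
  "kernel_log z1 z2 =
     (SOME L. L holomorphic_on {c. Re c > Re (lower_limit z1 z2)} \<and>
        (\<forall>c. Re c > Re (lower_limit z1 z2) \<longrightarrow> exp (L c) = kernel_base z1 z2 (cosh c)) \<and>
        ((\<lambda>x. L (of_real x) - (of_real (2 * ln (cosh x) - ln 2) - Ln (z1 * z2))) \<longlongrightarrow> 0) at_top)"

definition kernel_powr :: "complex \<Rightarrow> complex \<Rightarrow> complex \<Rightarrow> complex \<Rightarrow> complex" where
  "kernel_powr z1 z2 \<alpha> c = exp (\<alpha> * kernel_log z1 z2 c)"

text \<open>
  The contour from the lower limit to infinity is \<open>z\<^sub>3 = cosh (c\<^sub>0 + t)\<close>, \<open>t > 0\<close>, with
  \<open>c\<^sub>0 = lower_limit z\<^sub>1 z\<^sub>2\<close> and \<open>dz\<^sub>3 = sinh (c\<^sub>0 + t) dt\<close>. It is an arc of a (possibly degenerate) hyperbola with foci \<open>-1\<close>, \<open>1\<close>;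
  for \<open>z\<^sub>1, z\<^sub>2 > 1\<close> it is the real half line. It runs in the slit plane if \<open>\<bar>Im c\<^sub>0\<bar> < \<pi>\<close>, and it avoids
  the second zero \<open>cosh (a - b)\<close> of the base.
\<close>

definition cosh_contour_integrable :: "complex \<Rightarrow> (complex \<Rightarrow> complex) \<Rightarrow> bool" where
  "cosh_contour_integrable c0 g \<longleftrightarrow>
     set_integrable lborel {0<..} (\<lambda>t. g (c0 + of_real t) * sinh (c0 + of_real t))"

definition cosh_contour_integral :: "complex \<Rightarrow> (complex \<Rightarrow> complex) \<Rightarrow> complex" where
  "cosh_contour_integral c0 g =
     (LBINT t:{0<..}. g (c0 + of_real t) * sinh (c0 + of_real t))"

definition product_integrand ::
    "complex \<Rightarrow> complex \<Rightarrow> complex \<Rightarrow> complex \<Rightarrow> complex \<Rightarrow> complex" where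
  "product_integrand \<nu> \<mu> z1 z2 c =
     cosh_continuation (legendre_Q \<nu> \<mu>) c * kernel_powr z1 z2 (\<mu> - 1 / 2) c
       / cosh_continuation (\<lambda>z3. sqm1_powr z3 (\<mu> / 2)) c"

end

theory Submission
  imports Defs
begin

text \<open>
  Write \<open>z\<^sub>1 = cosh x\<close>, \<open>z\<^sub>2 = cosh y\<close>, \<open>z\<^sub>3 = cosh (x + y + t)\<close> and \<open>X = exp (- 2 x)\<close>, \<open>Y = exp (- 2 y)\<close>,
  \<open>T = exp (- t)\<close>, \<open>a = \<mu> + 1 / 2\<close>, \<open>b = \<nu> + \<mu> + 1\<close>. A quadratic transformation expresses \<open>Q(cosh x)\<close> through
  \<open>f(X) = F(a, b; b - a + 1; X)\<close>, and the base of the kernel factors into four hyperbolic sines. All powers of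
  exponentials cancel and the theorem becomes an identity between holomorphic functions of \<open>X\<close> and \<open>Y\<close> in the
  unit disc:
  \<open>(1-X)\<^bsup>2a-1\<^esup> f(X) (1-Y)\<^bsup>2a-1\<^esup> f(Y)\<close> is, up to the factor \<open>B(b-2a+1, a)\<close>, the integral over \<open>0 < T < 1\<close> of
  \<open>T\<^bsup>b-2a\<^esup> (1-T)\<^bsup>a-1\<^esup> (1-XYT\<^sup>2) ((1-XT)(1-YT)(1-XYT))\<^bsup>a-1\<^esup> f(XYT\<^sup>2)\<close>.

  The hypergeometric operator in \<open>X\<close> with parameters \<open>1-a\<close>, \<open>b-2a+1\<close>, \<open>b-a+1\<close>, applied to this integrand, is an
  exact derivative in \<open>t\<close> of a function that vanishes at both ends. Hence the integral solves the same
  equation in \<open>X\<close> as \<open>(1-X)\<^bsup>2a-1\<^esup> f(X)\<close>. Both are holomorphic at \<open>0\<close>, so they are proportional; by symmetry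
  the same holds in \<open>Y\<close>, and the remaining constant at \<open>X = Y = 0\<close> is a beta integral.
\<close>

subsection \<open>The hypergeometric differential equation\<close>

text \<open>The contour may leave the slit plane, where the integrand is no longer a function of z_3
  itself, and a power of a product need not be the product of the powers. In the exponential
  variables both obstacles vanish: for X, Y in the unit disc and 0 < T < 1 every factor such as 1 -
  X T has positive real part, so principal logarithms can be added and no branch has to be followed.

  The operator in X is the one that Euler's transformation dictates: with c = b - a + 1 its
  parameters are c - b and c - a, and c - a - b = 1 - 2a explains the power of 1 - X.

  Holomorphy at 0 singles out one solution up to a factor only if c is not in {0, -1, -2, ...}. Here
  c = \<nu> + 3/2, and the two convergence conditions, Re a > 0 at t = 0 and Re (b - 2a) > -1 at
  infinity, already force Re c > 0. The same two conditions make the boundary terms of the exact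
  derivative vanish.\<close>

definition hyp_fps :: "complex \<Rightarrow> complex \<Rightarrow> complex \<Rightarrow> complex fps" where
  "hyp_fps a b c = Abs_fps (\<lambda>n. pochhammer a n * pochhammer b n * rGamma (c + of_nat n) / fact n)"

lemma hyp2F1_reg_conv_eval_fps: "hyp2F1_reg a b c = eval_fps (hyp_fps a b c)"
  by (rule ext) (simp add: hyp2F1_reg_def eval_fps_def hyp_fps_def)

lemma hyp2F1_reg_0 [simp]: "hyp2F1_reg a b c 0 = rGamma c"
  by (simp add: hyp2F1_reg_conv_eval_fps eval_fps_at_0 hyp_fps_def)

text \<open>The functional equation of \<open>rGamma\<close> has no exceptions, so in this form,
  cleared of denominators, the recurrence survives \<open>c + of_nat n = 0\<close>.\<close>

lemma hyp_fps_rec: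
  "of_nat (Suc n) * (c + of_nat n) * fps_nth (hyp_fps a b c) (Suc n) =
     (a + of_nat n) * (b + of_nat n) * fps_nth (hyp_fps a b c) n"
proof -
  have "rGamma (c + of_nat n) = (c + of_nat n) * rGamma (c + of_nat (Suc n))"
    using rGamma_plus1[of "c + of_nat n"] by (simp add: add_ac)
  thus ?thesis
    by (simp add: hyp_fps_def pochhammer_Suc field_simps del: of_nat_Suc)
qed

lemma conv_radius_hyp_fps: "fps_conv_radius (hyp_fps a b c) \<ge> 1"
  unfolding fps_conv_radius_def
proof (rule conv_radius_geI_ex')
  fix r :: real assume r: "0 < r" "ereal r < 1"
  define q where "q n = norm ((a + of_nat n) * (b + of_nat n) / (of_nat (Suc n) * (c + of_nat n))) * r" for n
  have "(\<lambda>n. ((a + of_nat n) * (b + of_nat n) / (of_nat (Suc n) * (c + of_nat n)))) \<longlonglongrightarrow> 1"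
  proof (rule Lim_transform_eventually)
    show "(\<lambda>n. (a * (1 / of_nat n) + 1) * (b * (1 / of_nat n) + 1) / ((1 + 1 / of_nat n) * (c * (1 / of_nat n) + 1)) :: complex)
             \<longlonglongrightarrow> 1"
      using lim_1_over_n[where 'a = complex] by (auto intro!: tendsto_eq_intros)
    show "\<forall>\<^sub>F n in sequentially. (a * (1 / of_nat n) + 1) * (b * (1 / of_nat n) + 1) / ((1 + 1 / of_nat n) * (c * (1 / of_nat n) + 1))
            = ((a + of_nat n) * (b + of_nat n) / (of_nat (Suc n) * (c + of_nat n)))"
      using eventually_gt_at_top[of 0]
    proof eventually_elim
      case (elim n)
      define N :: complex where "N = of_nat n"
      have N: "N \<noteq> 0" using elim by (simp add: N_def)
      have "(a + N) * (b + N) = N^2 * ((a * (1 / N) + 1) * (b * (1 / N) + 1))"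
        using N by (simp add: field_simps power2_eq_square)
      moreover have "(1 + N) * (c + N) = N^2 * ((1 + 1 / N) * (c * (1 / N) + 1))"
        using N by (simp add: field_simps power2_eq_square)
      ultimately show ?case using N
        by (simp add: N_def)
    qed
  qed
  hence "q \<longlonglongrightarrow> norm (1 :: complex) * r"
    unfolding q_def by (intro tendsto_intros)
  moreover have "norm (1 :: complex) * r < (1 + r) / 2" using r by simp
  ultimately have "\<forall>\<^sub>F n in sequentially. q n < (1 + r) / 2"
    by (rule order_tendstoD)
  \<comment> \<open>Beyond \<open>norm c\<close> the factor \<open>c + of_nat n\<close> is nonzero,
    so the recurrence can be solved for the next coefficient.\<close>
  moreover have "\<forall>\<^sub>F n in sequentially. norm c < real n"
    by real_asymp
  ultimately have ev: "\<forall>\<^sub>F n in sequentially. q n < (1 + r) / 2 \<and> norm c < real n"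
    by eventually_elim auto
  then obtain N where N: "\<And>n. n \<ge> N \<Longrightarrow> q n < (1 + r) / 2 \<and> norm c < real n"
    by (auto simp: eventually_sequentially)
  show "summable (\<lambda>n. fps_nth (hyp_fps a b c) n * of_real r ^ n)"
  proof (rule summable_ratio_test)
    show "(1 + r) / 2 < 1" using r by simp
    fix n assume n: "n \<ge> N"
    have "c + of_nat n \<noteq> 0"
    proof
      assume "c + of_nat n = 0"
      hence "c = - of_nat n" by (simp add: eq_neg_iff_add_eq_0)
      thus False using N[OF n] by simp
    qed
    hence "fps_nth (hyp_fps a b c) (Suc n) = ((a + of_nat n) * (b + of_nat n) / (of_nat (Suc n) * (c + of_nat n))) * fps_nth (hyp_fps a b c) n"
      using hyp_fps_rec[of n c a b] by (simp add: divide_simps mult_ac del: of_nat_Suc)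
    hence "norm (fps_nth (hyp_fps a b c) (Suc n) * of_real r ^ Suc n) = q n * norm (fps_nth (hyp_fps a b c) n * of_real r ^ n)"
      using r by (simp add: q_def norm_mult norm_divide norm_power del: of_nat_Suc)
    also have "\<dots> \<le> (1 + r) / 2 * norm (fps_nth (hyp_fps a b c) n * of_real r ^ n)"
      using N[OF n] by (intro mult_right_mono) auto
    finally show "norm (fps_nth (hyp_fps a b c) (Suc n) * of_real r ^ Suc n)
                \<le> (1 + r) / 2 * norm (fps_nth (hyp_fps a b c) n * of_real r ^ n)" .
  qed
qed

lemma holomorphic_hyp2F1_reg: "hyp2F1_reg a b c holomorphic_on ball 0 1"
proof -
  have "ball 0 1 \<subseteq> eball (0::complex) (fps_conv_radius (hyp_fps a b c))"
  proof
    fix x :: complex assume "x \<in> ball 0 1"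
    hence "ereal (norm x) < 1" by simp
    also note conv_radius_hyp_fps[of a b c]
    finally show "x \<in> eball 0 (fps_conv_radius (hyp_fps a b c))" by (simp add: in_eball_iff)
  qed
  thus ?thesis unfolding hyp2F1_reg_conv_eval_fps by (rule holomorphic_on_eval_fps)
qed

lemma has_fps_expansion_hyp2F1_reg: "hyp2F1_reg a b c has_fps_expansion hyp_fps a b c"
  using conv_radius_hyp_fps[of a b c] unfolding hyp2F1_reg_conv_eval_fps
  by (intro eval_fps_has_fps_expansion) (auto intro: less_le_trans[of _ 1])

text \<open>
  The hypergeometric differential operator at \<open>x\<close>, applied to a function with value \<open>g0\<close> and
  derivatives \<open>g1\<close>, \<open>g2\<close> there.
\<close>

definition hyp_op :: "complex \<Rightarrow> complex \<Rightarrow> complex \<Rightarrow> complex \<Rightarrow> complex \<Rightarrow> complex \<Rightarrow> complex \<Rightarrow> complex" where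
  "hyp_op a b c x g0 g1 g2 = x * (1 - x) * g2 + (c - (a + b + 1) * x) * g1 - a * b * g0"

definition hyp_op_fps :: "complex \<Rightarrow> complex \<Rightarrow> complex \<Rightarrow> complex fps \<Rightarrow> complex fps" where
  "hyp_op_fps a b c G = fps_X * (1 - fps_X) * fps_deriv (fps_deriv G) +
     (fps_const c - fps_const (a + b + 1) * fps_X) * fps_deriv G - fps_const (a * b) * G"

text \<open>A power series is annihilated by the operator exactly if its coefficients satisfy the
  recurrence of \<open>hyp_fps_rec\<close>; both existence and uniqueness of solutions are read off
  from this.\<close>

lemma fps_nth_hyp_op_fps:
  "fps_nth (hyp_op_fps a b c G) n =
     of_nat (Suc n) * (c + of_nat n) * fps_nth G (Suc n) - (a + of_nat n) * (b + of_nat n) * fps_nth G n"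
proof -
  have eq: "hyp_op_fps a b c G = fps_X * fps_deriv (fps_deriv G) - fps_X * (fps_X * fps_deriv (fps_deriv G)) +
     (fps_const c * fps_deriv G - fps_const (a + b + 1) * (fps_X * fps_deriv G)) - fps_const (a * b) * G"
    by (simp add: hyp_op_fps_def algebra_simps)
  show ?thesis
  proof (cases n)
    case 0
    thus ?thesis by (simp add: eq)
  next
    case (Suc m)
    show ?thesis
      by (cases m) (simp_all add: eq Suc algebra_simps)
  qed
qed

lemma has_fps_expansion_hyp_op:
  assumes "g has_fps_expansion G"
  shows "(\<lambda>x. hyp_op a b c x (g x) (deriv g x) (deriv (deriv g) x)) has_fps_expansion hyp_op_fps a b c G"
  unfolding hyp_op_def hyp_op_fps_def
  by (intro fps_expansion_intros has_fps_expansion_const has_fps_expansion_1 assms has_fps_expansion_fps_X)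

lemma hyp2F1_reg_ode:
  assumes "norm x < 1"
  shows "hyp_op a b c x (hyp2F1_reg a b c x) (deriv (hyp2F1_reg a b c) x) (deriv (deriv (hyp2F1_reg a b c)) x) = 0"
proof -
  let ?f = "hyp2F1_reg a b c"
  have "hyp_op_fps a b c (hyp_fps a b c) = 0"
    by (rule fps_ext) (simp add: fps_nth_hyp_op_fps hyp_fps_rec del: of_nat_Suc)
  hence e: "(\<lambda>x. hyp_op a b c x (?f x) (deriv ?f x) (deriv (deriv ?f) x)) has_fps_expansion 0"
    using has_fps_expansion_hyp_op[OF has_fps_expansion_hyp2F1_reg[of a b c], of a b c] by simp
  show ?thesis
  proof (rule has_fps_expansion_0_analytic_continuation[OF e])
    show "(\<lambda>x. hyp_op a b c x (?f x) (deriv ?f x) (deriv (deriv ?f) x)) holomorphic_on ball 0 1"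
      unfolding hyp_op_def by (intro holomorphic_intros holomorphic_hyp2F1_reg) auto
  qed (use assms in auto)
qed

text \<open>
  The other exponent at \<open>0\<close> is \<open>1 - c\<close>; excluding \<open>c \<in> \<int>\<^sub>\<le>\<^sub>0\<close> makes the recurrence of the coefficients solvable
  at every step, so a solution that is holomorphic at \<open>0\<close> is determined by its value there.
\<close>

lemma hyp_ode_unique:
  assumes g: "g holomorphic_on ball 0 r" and r: "0 < r" "r \<le> 1"
    and ode: "\<And>x. norm x < r \<Longrightarrow> hyp_op a b c x (g x) (deriv g x) (deriv (deriv g) x) = 0"
    and c: "c \<notin> \<int>\<^sub>\<le>\<^sub>0"
    and x: "norm x < r"
  shows "g x * rGamma c = g 0 * hyp2F1_reg a b c x"
proof -
  define G where "G = fps_expansion g 0"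
  have "g analytic_on {0}"
    using g r by (auto simp: analytic_at intro!: exI[of _ "ball 0 r"])
  hence G: "g has_fps_expansion G"
    unfolding G_def by (rule analytic_at_imp_has_fps_expansion_0)
  have "eventually (\<lambda>x::complex. x \<in> ball 0 r) (nhds 0)"
    using r by (intro eventually_nhds_in_open) auto
  hence ev: "eventually (\<lambda>x. 0 = hyp_op a b c x (g x) (deriv g x) (deriv (deriv g) x)) (nhds 0)"
    by eventually_elim (use ode in auto)
  have "(\<lambda>x. 0) has_fps_expansion hyp_op_fps a b c G"
    by (rule has_fps_expansion_cong[OF ev refl, THEN iffD2]) (rule has_fps_expansion_hyp_op[OF G])
  hence "hyp_op_fps a b c G = 0"
    using fps_expansion_unique_complex has_fps_expansion_0 by blast
  hence rec: "of_nat (Suc n) * (c + of_nat n) * fps_nth G (Suc n) = (a + of_nat n) * (b + of_nat n) * fps_nth G n" for n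
    using fps_nth_hyp_op_fps[of a b c G n] by simp
  have nz: "of_nat (Suc n) * (c + of_nat n) \<noteq> 0" for n
  proof -
    have "c + of_nat n \<noteq> 0"
      using c by (metis add_eq_0_iff2 minus_of_nat_in_nonpos_Ints)
    thus ?thesis by (simp del: of_nat_Suc)
  qed
  have G0: "fps_nth G 0 = g 0"
    using fps_nth_fps_expansion[OF G, of 0] by simp
  have coeff: "fps_nth G n * rGamma c = g 0 * fps_nth (hyp_fps a b c) n" for n
  proof (induction n)
    case 0
    show ?case using G0 by (simp add: hyp_fps_def)
  next
    case (Suc n)
    have "of_nat (Suc n) * (c + of_nat n) * (fps_nth G (Suc n) * rGamma c) =
            (a + of_nat n) * (b + of_nat n) * (fps_nth G n * rGamma c)"
      using rec[of n] by (simp only: mult.assoc [symmetric])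
    also have "\<dots> = g 0 * ((a + of_nat n) * (b + of_nat n) * fps_nth (hyp_fps a b c) n)"
      by (simp add: Suc)
    also have "\<dots> = of_nat (Suc n) * (c + of_nat n) * (g 0 * fps_nth (hyp_fps a b c) (Suc n))"
      by (simp add: hyp_fps_rec [symmetric] del: of_nat_Suc)
    finally show ?case using nz[of n] mult_left_cancel by blast
  qed
  have "(\<lambda>x. g x * rGamma c - g 0 * hyp2F1_reg a b c x) has_fps_expansion
          (G * fps_const (rGamma c) - fps_const (g 0) * hyp_fps a b c)"
    by (intro fps_expansion_intros G has_fps_expansion_hyp2F1_reg has_fps_expansion_const)
  also have "G * fps_const (rGamma c) - fps_const (g 0) * hyp_fps a b c = 0"
    by (rule fps_ext) (simp add: coeff)
  finally have e: "(\<lambda>x. g x * rGamma c - g 0 * hyp2F1_reg a b c x) has_fps_expansion 0" .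
  have "g x * rGamma c - g 0 * hyp2F1_reg a b c x = 0"
  proof (rule has_fps_expansion_0_analytic_continuation[OF e])
    show "(\<lambda>x. g x * rGamma c - g 0 * hyp2F1_reg a b c x) holomorphic_on ball 0 r"
      using r by (intro holomorphic_intros g holomorphic_on_subset[OF holomorphic_hyp2F1_reg]) auto
  qed (use x r in auto)
  thus ?thesis by simp
qed

subsection \<open>Holomorphic parameter integrals\<close>

text \<open>Only the function itself has to be dominated, not its derivatives in the parameter:
  Cauchy's inequality supplies those bounds. The notion is therefore stable under differentiation,
  and one may differentiate under the integral twice.\<close>

definition locally_dominated :: "'a measure \<Rightarrow> complex set \<Rightarrow> (complex \<Rightarrow> 'a \<Rightarrow> complex) \<Rightarrow> bool" where
  "locally_dominated M S f \<longleftrightarrow>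
     (\<forall>x\<in>S. f x \<in> borel_measurable M) \<and>
     (\<forall>t\<in>space M. (\<lambda>x. f x t) holomorphic_on S) \<and>
     (\<forall>x\<in>S. \<exists>r>0. \<exists>g. cball x r \<subseteq> S \<and> integrable M (g :: 'a \<Rightarrow> real) \<and>
        (\<forall>y\<in>cball x r. \<forall>t\<in>space M. norm (f y t) \<le> g t))"

lemma locally_dominatedE:
  assumes "locally_dominated M S f" "x \<in> S"
  obtains r g where "r > 0" "cball x r \<subseteq> S" "integrable M (g :: 'a \<Rightarrow> real)"
    "\<And>y t. y \<in> cball x r \<Longrightarrow> t \<in> space M \<Longrightarrow> norm (f y t) \<le> g t"
  using assms unfolding locally_dominated_def by metis

lemma locally_dominated_integrable:
  assumes "locally_dominated M S f" "x \<in> S"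
  shows "integrable M (f x)"
proof -
  from locally_dominatedE[OF assms] obtain r g where *: "r > 0" "cball x r \<subseteq> S" "integrable M (g :: _ \<Rightarrow> real)"
    "\<And>y t. y \<in> cball x r \<Longrightarrow> t \<in> space M \<Longrightarrow> norm (f y t) \<le> g t" by metis
  show ?thesis
  proof (rule Bochner_Integration.integrable_bound[OF *(3)])
    show "f x \<in> borel_measurable M" using assms by (simp add: locally_dominated_def)
    show "AE t in M. norm (f x t) \<le> norm (g t)"
      using *(4)[of x] \<open>r > 0\<close> by (intro AE_I2) (force intro: order_trans)
  qed
qed

text \<open>Cauchy's inequality on circles of radius \<open>r / 2\<close> about the points of the
  disc of radius \<open>r / 2\<close>; these circles stay inside the disc on which \<open>f\<close>
  is dominated.\<close>

lemma locally_dominated_deriv_bound: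
  assumes "locally_dominated M S f" "x \<in> S"
  obtains r g where "r > 0" "cball x r \<subseteq> S" "integrable M (g :: 'a \<Rightarrow> real)"
    "\<And>y t. y \<in> cball x r \<Longrightarrow> t \<in> space M \<Longrightarrow> norm (deriv (\<lambda>x. f x t) y) \<le> g t"
proof -
  from locally_dominatedE[OF assms] obtain r g where *: "r > 0" "cball x r \<subseteq> S" "integrable M (g :: _ \<Rightarrow> real)"
    "\<And>y t. y \<in> cball x r \<Longrightarrow> t \<in> space M \<Longrightarrow> norm (f y t) \<le> g t" by metis
  show ?thesis
  proof (rule that[of "r / 2" "\<lambda>t. g t / (r / 2)"])
    show "cball x (r / 2) \<subseteq> S" using * by auto
    fix y t assume y: "y \<in> cball x (r / 2)" and t: "t \<in> space M"
    have sub: "cball y (r / 2) \<subseteq> cball x r"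
    proof
      fix z assume "z \<in> cball y (r / 2)"
      thus "z \<in> cball x r" using y dist_triangle[of x z y] by auto
    qed
    have "(\<lambda>x. f x t) holomorphic_on S"
      using assms(1) t by (simp add: locally_dominated_def)
    hence hol: "(\<lambda>x. f x t) holomorphic_on cball y (r / 2)"
      using sub *(2) by (elim holomorphic_on_subset) blast
    have "norm ((deriv ^^ 1) (\<lambda>x. f x t) y) \<le> fact 1 * g t / (r / 2) ^ 1"
    proof (rule Cauchy_inequality)
      show "(\<lambda>x. f x t) holomorphic_on ball y (r / 2)"
        by (rule holomorphic_on_subset[OF hol]) auto
      show "continuous_on (cball y (r / 2)) (\<lambda>x. f x t)"
        using hol by (rule holomorphic_on_imp_continuous_on)
      fix z assume "norm (y - z) = r / 2"
      hence "z \<in> cball x r" using sub by (auto simp: dist_norm)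
      thus "norm (f z t) \<le> g t" using *(4) t by auto
    qed (use * in auto)
    thus "norm (deriv (\<lambda>x. f x t) y) \<le> g t / (r / 2)" by simp
  qed (use * in auto)
qed

lemma locally_dominated_has_field_derivative:
  assumes "locally_dominated M S f" "open S" "t \<in> space M" "x \<in> S"
  shows "((\<lambda>x. f x t) has_field_derivative deriv (\<lambda>x. f x t) x) (at x)"
  using assms unfolding locally_dominated_def
  by (auto intro!: holomorphic_derivI[of _ S])

lemma locally_dominated_deriv:
  assumes ld: "locally_dominated M S f" and "open S"
  shows "locally_dominated M S (\<lambda>x t. deriv (\<lambda>x. f x t) x)"
  unfolding locally_dominated_def
proof (intro conjI ballI)
  fix x assume x: "x \<in> S"
  from locally_dominatedE[OF ld x] obtain r where r: "r > 0" "cball x r \<subseteq> S" by metis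
  \<comment> \<open>Nonzero increments of size at most \<open>r\<close>: the shifted points stay in
    \<open>S\<close>, and the derivative is a limit of a sequence of measurable difference
    quotients.\<close>
  define h where "h n = complex_of_real (r / real (Suc n))" for n
  have hx: "x + h n \<in> S" for n
  proof -
    have "norm (h n) \<le> r" using r by (simp add: h_def norm_divide field_simps del: of_nat_Suc)
    thus ?thesis using r by (auto simp: dist_norm)
  qed
  have h: "h \<longlonglongrightarrow> 0"
    unfolding h_def using LIMSEQ_Suc[OF lim_const_over_n[of r]] by (metis tendsto_of_real of_real_0)
  show "(\<lambda>t. deriv (\<lambda>x. f x t) x) \<in> borel_measurable M"
  proof (rule borel_measurable_LIMSEQ_metric)
    show "(\<lambda>t. (f (x + h n) t - f x t) / h n) \<in> borel_measurable M" for n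
    proof -
      have "f (x + h n) \<in> borel_measurable M" "f x \<in> borel_measurable M"
        using ld hx[of n] x by (auto simp: locally_dominated_def)
      thus ?thesis by measurable
    qed
    fix t assume t: "t \<in> space M"
    have "((\<lambda>h. (f (x + h) t - f x t) / h) \<longlongrightarrow> deriv (\<lambda>x. f x t) x) (at 0)"
      using locally_dominated_has_field_derivative[OF ld \<open>open S\<close> t x] by (simp add: DERIV_def)
    moreover have "filterlim h (at 0) sequentially"
      using h r by (auto simp: filterlim_at h_def simp del: of_nat_Suc)
    ultimately show "(\<lambda>n. (f (x + h n) t - f x t) / h n) \<longlonglongrightarrow> deriv (\<lambda>x. f x t) x"
      by (rule filterlim_compose)
  qed
  show "\<exists>r>0. \<exists>g. cball x r \<subseteq> S \<and> integrable M (g :: 'a \<Rightarrow> real) \<and>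
     (\<forall>y\<in>cball x r. \<forall>t\<in>space M. norm (deriv (\<lambda>x. f x t) y) \<le> g t)"
    using locally_dominated_deriv_bound[OF ld x] by metis
next
  fix t assume "t \<in> space M"
  thus "deriv (\<lambda>x. f x t) holomorphic_on S"
    using ld \<open>open S\<close> by (intro holomorphic_deriv) (auto simp: locally_dominated_def)
qed

lemma has_field_derivative_integral:
  assumes ld: "locally_dominated M S f" and S: "open S" and x: "x \<in> S"
  shows "((\<lambda>x. integral\<^sup>L M (f x)) has_field_derivative integral\<^sup>L M (\<lambda>t. deriv (\<lambda>x. f x t) x)) (at x)"
  unfolding DERIV_def tendsto_at_iff_sequentially comp_def
proof (intro allI impI)
  fix h :: "nat \<Rightarrow> complex" assume h: "\<forall>i. h i \<in> UNIV - {0}" "h \<longlonglongrightarrow> 0"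
  from locally_dominated_deriv_bound[OF ld x] obtain r g where *: "r > 0" "cball x r \<subseteq> S" "integrable M (g :: _ \<Rightarrow> real)"
    "\<And>y t. y \<in> cball x r \<Longrightarrow> t \<in> space M \<Longrightarrow> norm (deriv (\<lambda>x. f x t) y) \<le> g t" by metis
  have "\<forall>\<^sub>F n in sequentially. norm (h n) < r"
    using h(2) \<open>r > 0\<close> by (metis order_tendstoD(2) tendsto_norm_zero)
  then obtain N where N: "\<And>n. n \<ge> N \<Longrightarrow> norm (h n) < r"
    by (auto simp: eventually_sequentially)
  \<comment> \<open>Only a tail of the given sequence is sure to keep \<open>x + h n\<close> in the
    disc; the shift is undone at the end.\<close>
  define k where "k n = h (n + N)" for n
  have k: "norm (k n) < r" "k n \<noteq> 0" for n using N[of "n + N"] h(1) by (auto simp: k_def)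
  have k0: "k \<longlonglongrightarrow> 0" unfolding k_def using h(2) by (rule LIMSEQ_ignore_initial_segment)
  have xk: "x + k n \<in> cball x r" for n using k(1)[of n] by (auto simp: dist_norm)
  have int: "integrable M (f (x + k n))" "integrable M (f x)" for n
    using locally_dominated_integrable[OF ld] x xk *(2) by blast+
  have "(\<lambda>n. integral\<^sup>L M (\<lambda>t. (f (x + k n) t - f x t) / k n)) \<longlonglongrightarrow> integral\<^sup>L M (\<lambda>t. deriv (\<lambda>x. f x t) x)"
  proof (rule integral_dominated_convergence[where w = g])
    show "integrable M g" by fact
    show "(\<lambda>t. deriv (\<lambda>x. f x t) x) \<in> borel_measurable M"
      using locally_dominated_deriv[OF ld S] x by (simp add: locally_dominated_def)
    show "(\<lambda>t. (f (x + k n) t - f x t) / k n) \<in> borel_measurable M" for n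
      using int(1)[of n] int(2) by auto
    show "AE t in M. (\<lambda>n. (f (x + k n) t - f x t) / k n) \<longlonglongrightarrow> deriv (\<lambda>x. f x t) x"
    proof (intro AE_I2)
      fix t assume t: "t \<in> space M"
      have "((\<lambda>h. (f (x + h) t - f x t) / h) \<longlongrightarrow> deriv (\<lambda>x. f x t) x) (at 0)"
        using locally_dominated_has_field_derivative[OF ld S t x] by (simp add: DERIV_def)
      moreover have "filterlim k (at 0) sequentially"
        using k0 k by (auto simp: filterlim_at)
      ultimately show "(\<lambda>n. (f (x + k n) t - f x t) / k n) \<longlonglongrightarrow> deriv (\<lambda>x. f x t) x"
        by (rule filterlim_compose)
    qed
    show "AE t in M. norm ((f (x + k n) t - f x t) / k n) \<le> g t" for n
    proof (intro AE_I2)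
      fix t assume t: "t \<in> space M"
      \<comment> \<open>The mean value inequality on the convex disc turns the bound on the
        derivative into the dominating function for the difference quotients.\<close>
      have "norm (f (x + k n) t - f x t) \<le> g t * norm ((x + k n) - x)"
      proof (rule field_differentiable_bound[of "cball x r"])
        fix z assume z: "z \<in> cball x r"
        show "((\<lambda>x. f x t) has_field_derivative deriv (\<lambda>x. f x t) z) (at z within cball x r)"
          using locally_dominated_has_field_derivative[OF ld S t] z *(2)
          by (blast intro: has_field_derivative_at_within)
        show "norm (deriv (\<lambda>x. f x t) z) \<le> g t" using *(4) z t by blast
      qed (use xk * in auto)
      thus "norm ((f (x + k n) t - f x t) / k n) \<le> g t"
        using k(2)[of n] by (simp add: norm_divide divide_le_eq)
    qed
  qed
  hence "(\<lambda>n. (integral\<^sup>L M (f (x + k n)) - integral\<^sup>L M (f x)) / k n) \<longlonglongrightarrow> integral\<^sup>L M (\<lambda>t. deriv (\<lambda>x. f x t) x)"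
    using int by simp
  thus "(\<lambda>n. (integral\<^sup>L M (f (x + h n)) - integral\<^sup>L M (f x)) / h n) \<longlonglongrightarrow> integral\<^sup>L M (\<lambda>t. deriv (\<lambda>x. f x t) x)"
    unfolding k_def by (rule LIMSEQ_offset)
qed

lemma holomorphic_on_integral:
  assumes "locally_dominated M S f" "open S"
  shows "(\<lambda>x. integral\<^sup>L M (f x)) holomorphic_on S"
  using has_field_derivative_integral[OF assms] assms(2) by (auto simp: holomorphic_on_open)

lemma deriv_integral:
  assumes "locally_dominated M S f" "open S" "x \<in> S"
  shows "deriv (\<lambda>x. integral\<^sup>L M (f x)) x = integral\<^sup>L M (\<lambda>t. deriv (\<lambda>x. f x t) x)"
  by (rule DERIV_imp_deriv[OF has_field_derivative_integral[OF assms]])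

lemma deriv_deriv_integral:
  assumes "locally_dominated M S f" "open S" "x \<in> S"
  shows "deriv (deriv (\<lambda>x. integral\<^sup>L M (f x))) x = integral\<^sup>L M (\<lambda>t. deriv (deriv (\<lambda>x. f x t)) x)"
proof -
  have "deriv (deriv (\<lambda>x. integral\<^sup>L M (f x))) x = deriv (\<lambda>x. integral\<^sup>L M (\<lambda>t. deriv (\<lambda>x. f x t) x)) x"
    using assms deriv_integral[OF assms(1,2)]
    by (intro deriv_cong_ev eventually_mono[OF eventually_nhds_in_open[OF assms(2,3)]]) auto
  also have "\<dots> = integral\<^sup>L M (\<lambda>t. deriv (deriv (\<lambda>x. f x t)) x)"
    by (rule deriv_integral[OF locally_dominated_deriv[OF assms(1,2)] assms(2,3)])
  finally show ?thesis .
qed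

subsection \<open>Euler and quadratic transformations\<close>

lemma deriv_deriv_eqI:
  assumes "open S" "x \<in> S"
    and "\<And>x. x \<in> S \<Longrightarrow> (g has_field_derivative g1 x) (at x)"
    and "(g1 has_field_derivative g2) (at x)"
  shows "deriv g x = g1 x" "deriv (deriv g) x = g2"
proof -
  show "deriv g x = g1 x" using assms by (intro DERIV_imp_deriv) auto
  have "deriv (deriv g) x = deriv g1 x"
    using assms by (intro deriv_cong_ev eventually_mono[OF eventually_nhds_in_open[OF assms(1,2)]])
                   (auto intro: DERIV_imp_deriv)
  thus "deriv (deriv g) x = g2" using assms(4) by (simp add: DERIV_imp_deriv)
qed

lemma has_field_derivative_hyp2F1_reg:
  assumes "norm x < 1"
  shows "(hyp2F1_reg a b c has_field_derivative deriv (hyp2F1_reg a b c) x) (at x)"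
    "(deriv (hyp2F1_reg a b c) has_field_derivative deriv (deriv (hyp2F1_reg a b c)) x) (at x)"
  using assms by (auto intro!: holomorphic_derivI[of _ "ball 0 1"] holomorphic_hyp2F1_reg holomorphic_deriv)

lemma Re_one_minus_pos: "norm (z :: complex) < 1 \<Longrightarrow> Re (1 - z) > 0"
  using complex_Re_le_cmod[of z] by simp

lemma Re_one_plus_pos: "norm (z :: complex) < 1 \<Longrightarrow> Re (1 + z) > 0"
  using abs_Re_le_cmod[of z] by simp

lemma Re_pos_not_nonpos_Reals: "Re z > 0 \<Longrightarrow> z \<notin> \<real>\<^sub>\<le>\<^sub>0"
  by (auto simp: complex_nonpos_Reals_iff)

lemma Re_pos_not_nonpos_Ints: "Re z > 0 \<Longrightarrow> z \<notin> \<int>\<^sub>\<le>\<^sub>0"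
  by (auto elim!: nonpos_Ints_cases)

text \<open>
  In this and the following identities a variable with an assumption like \<open>i * (1 - x) = 1\<close> stands for an
  inverse, so that they are polynomial identities.
\<close>

lemma hyp_op_euler:
  fixes i x E f0 f1 f2 :: complex
  assumes i: "i * (1 - x) = 1" and c: "c = b - a + 1"
  shows "hyp_op (1 - a) (b - 2 * a + 1) c x (E * f0) (E * f1 - (2 * a - 1) * i * E * f0)
     ((2 * a - 1) * (2 * a - 2) * i^2 * E * f0 - 2 * (2 * a - 1) * i * E * f1 + E * f2) =
     E * hyp_op a b c x f0 f1 f2"
  using i unfolding hyp_op_def c by algebra

text \<open>The new parameters are \<open>c - b\<close> and \<open>c - a\<close>, so this is Euler's
  transformation at the level of the equation; the identity of functions follows later from
  uniqueness.\<close>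

theorem hyp2F1_reg_euler_ode:
  assumes x: "norm x < 1" and c: "c = b - a + 1"
  defines "g \<equiv> \<lambda>x. (1 - x) powr (2 * a - 1) * hyp2F1_reg a b c x"
  shows "hyp_op (1 - a) (b - 2 * a + 1) c x (g x) (deriv g x) (deriv (deriv g) x) = 0"
proof -
  let ?f = "hyp2F1_reg a b c"
  define E where "E x = (1 - x) powr (2 * a - 1)" for x
  define g1 where "g1 x = E x * deriv ?f x - (2 * a - 1) * inverse (1 - x) * E x * ?f x" for x
  define g2 where "g2 x = (2 * a - 1) * (2 * a - 2) * (inverse (1 - x))^2 * E x * ?f x
       - 2 * (2 * a - 1) * inverse (1 - x) * E x * deriv ?f x + E x * deriv (deriv ?f) x" for x
  have E: "(E has_field_derivative - (2 * a - 1) * inverse (1 - x) * E x) (at x)" if "norm x < 1" for x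
  proof -
    have "(E has_field_derivative (2 * a - 1) * (1 - x) powr (2 * a - 1 - 1) * - 1) (at x)"
      unfolding E_def using Re_one_minus_pos[OF that]
      by (auto intro!: derivative_eq_intros Re_pos_not_nonpos_Reals)
    moreover have "(1 - x) powr (2 * a - 1 - 1) = inverse (1 - x) * E x"
      using that by (subst powr_diff) (auto simp: E_def field_simps)
    ultimately show ?thesis by (simp add: algebra_simps)
  qed
  have nz: "1 - x \<noteq> 0" if "norm x < 1" for x :: complex using that by auto
  have I: "((\<lambda>x. inverse (1 - x)) has_field_derivative (inverse (1 - x))^2) (at x)" if "norm x < 1" for x :: complex
    using nz[OF that] by (auto intro!: derivative_eq_intros simp: power2_eq_square)
  have d1: "(g has_field_derivative g1 x) (at x)" if "x \<in> ball 0 1" for x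
    unfolding g_def g1_def E_def[symmetric] using that
    by (auto intro!: derivative_eq_intros E has_field_derivative_hyp2F1_reg simp: algebra_simps)
  have d2: "(g1 has_field_derivative g2 x) (at x)"
    unfolding g1_def g2_def using x
    by (auto intro!: derivative_eq_intros E I has_field_derivative_hyp2F1_reg simp: algebra_simps power2_eq_square)
  have "inverse (1 - x) * (1 - x) = 1" using nz[OF x] by simp
  note eq = hyp_op_euler[OF this c, of "E x" "?f x" "deriv ?f x" "deriv (deriv ?f) x"]
  have "deriv g x = g1 x" "deriv (deriv g) x = g2 x"
    using deriv_deriv_eqI[where S = "ball 0 1", OF _ _ d1 d2] x by simp_all
  thus ?thesis
    using eq hyp2F1_reg_ode[OF x, of a b c] by (simp only: g1_def g2_def) (simp add: g_def E_def)
qed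

text \<open>The chain rule for \<open>E * f w\<close> with \<open>w = 4 * x / (1 + x)^2\<close>:
  here \<open>E\<close> stands for \<open>(1 + x) powr (- b)\<close>, whose logarithmic derivative
  is \<open>- b * i\<close>, while \<open>4 * (1 - x) * i^3\<close> and
  \<open>(8 * x - 16) * i^4\<close> are the first two derivatives of \<open>w\<close>.\<close>

lemma hyp_op_quadratic:
  fixes i x E f0 f1 f2 :: complex
  assumes i: "i * (1 + x) = 1" and c: "c = b - a + 1"
  shows "hyp_op a b c x (E * f0) (E * (4 * (1 - x) * i^3) * f1 - b * i * E * f0)
     (b * (b + 1) * i^2 * E * f0 - 2 * b * i * E * (4 * (1 - x) * i^3) * f1
        + E * ((8 * x - 16) * i^4) * f1 + E * (4 * (1 - x) * i^3)^2 * f2) =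
     4 * (1 - x) * i^2 * E * hyp_op (b / 2) ((b + 1) / 2) c (4 * x * i^2) f0 f1 f2"
proof -
  have h: "b / 2 + (b + 1) / 2 + 1 = b + 3 / 2" "b / 2 * ((b + 1) / 2) = b * (b + 1) / 4"
    by (simp_all add: field_simps)
  \<comment> \<open>All fractions are written through \<open>q\<close> with
    \<open>4 * q = 1\<close>, which leaves a polynomial identity.\<close>
  define q :: complex where "q = 1 / 4"
  have q: "4 * q = 1" "b * (b + 1) / 4 = b * (b + 1) * q" "3 / 2 = 6 * q" by (simp_all add: q_def)
  show ?thesis using i q(1) unfolding hyp_op_def c h q(2,3) by algebra
qed

text \<open>Both sides solve the same equation, are holomorphic at 0 and have the value
  \<open>rGamma c\<close> there. The radius is a convenience: it gives
  \<open>norm (1 + x) >= 9 / 10\<close>, which keeps the argument \<open>4 * x / (1 + x)^2\<close>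
  in the unit disc. A small disc is enough because the Legendre function is then reached by
  continuation.\<close>

theorem hyp2F1_reg_quadratic:
  assumes x: "norm x < 1 / 10" and c: "c = b - a + 1" and c': "c \<notin> \<int>\<^sub>\<le>\<^sub>0"
  shows "(1 + x) powr (- b) * hyp2F1_reg (b / 2) ((b + 1) / 2) c (4 * x / (1 + x)^2) = hyp2F1_reg a b c x"
proof -
  define f where "f = hyp2F1_reg (b / 2) ((b + 1) / 2) c"
  define E where "E x = (1 + x) powr (- b)" for x
  define I where "I x = inverse (1 + x)" for x :: complex
  define w where "w x = 4 * x * (I x)^2" for x
  define g where "g x = E x * f (w x)" for x
  define g1 where "g1 x = E x * (4 * (1 - x) * (I x)^3) * deriv f (w x) - b * I x * E x * f (w x)" for x
  define g2 where "g2 x = b * (b + 1) * (I x)^2 * E x * f (w x) - 2 * b * I x * E x * (4 * (1 - x) * (I x)^3) * deriv f (w x)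
        + E x * ((8 * x - 16) * (I x)^4) * deriv f (w x) + E x * (4 * (1 - x) * (I x)^3)^2 * deriv (deriv f) (w x)" for x
  have nz: "1 + x \<noteq> 0" if "norm x < 1 / 10" for x :: complex
    using that Re_one_plus_pos[of x] by fastforce
  have II: "I x * (1 + x) = 1" if "norm x < 1 / 10" for x using nz[OF that] by (simp add: I_def)
  have wn: "norm (w x) < 1" if "norm x < 1 / 10" for x
  proof -
    have "norm (1 + x) \<ge> 9 / 10" using norm_triangle_ineq2[of 1 "-x"] that by simp
    hence "norm (I x) \<le> 10 / 9" unfolding I_def norm_inverse
      using le_imp_inverse_le[of "9 / 10" "norm (1 + x)"] by simp
    hence "norm (I x)^2 \<le> (10 / 9)^2" by (rule power_mono) auto
    hence "norm (w x) \<le> 4 * norm x * (10 / 9)^2"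
      unfolding w_def norm_mult norm_power by (intro mult_mono) auto
    also have "\<dots> < 1" using that by (simp add: power2_eq_square)
    finally show ?thesis .
  qed
  have E: "(E has_field_derivative - b * I x * E x) (at x)" if "norm x < 1 / 10" for x
    unfolding E_def I_def using Re_one_plus_pos[of x] that nz[of x]
    by (auto intro!: derivative_eq_intros Re_pos_not_nonpos_Reals simp: powr_diff field_simps)
  have I: "(I has_field_derivative - ((I x)^2)) (at x)" if "norm x < 1 / 10" for x
    unfolding I_def using nz[OF that] by (auto intro!: derivative_eq_intros simp: power2_eq_square)
  have W: "(w has_field_derivative 4 * (1 - x) * (I x)^3) (at x)" if "norm x < 1 / 10" for x
  proof -
    have "(w has_field_derivative 4 * (I x)^2 + 4 * x * (2 * I x * (- ((I x)^2)))) (at x)"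
      unfolding w_def by (auto intro!: derivative_eq_intros I that)
    also have "4 * (I x)^2 + 4 * x * (2 * I x * (- ((I x)^2))) = 4 * (1 - x) * (I x)^3"
      using II[OF that] by algebra
    finally show ?thesis .
  qed
  have V: "((\<lambda>x. 4 * (1 - x) * (I x)^3) has_field_derivative (8 * x - 16) * (I x)^4) (at x)" if "norm x < 1 / 10" for x
  proof -
    have "((\<lambda>x. 4 * (1 - x) * (I x)^3) has_field_derivative - 4 * (I x)^3 + 4 * (1 - x) * (3 * (I x)^2 * (- ((I x)^2)))) (at x)"
      by (auto intro!: derivative_eq_intros I that simp: algebra_simps)
    also have "- 4 * (I x)^3 + 4 * (1 - x) * (3 * (I x)^2 * (- ((I x)^2))) = (8 * x - 16) * (I x)^4"
      using II[OF that] by algebra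
    finally show ?thesis .
  qed
  have F: "((\<lambda>x. f (w x)) has_field_derivative deriv f (w x) * (4 * (1 - x) * (I x)^3)) (at x)"
    "((\<lambda>x. deriv f (w x)) has_field_derivative deriv (deriv f) (w x) * (4 * (1 - x) * (I x)^3)) (at x)"
    if "norm x < 1 / 10" for x
    using has_field_derivative_hyp2F1_reg[OF wn[OF that]] W[OF that] unfolding f_def by (metis DERIV_chain2)+
  have d1: "(g has_field_derivative g1 x) (at x)" if "x \<in> ball 0 (1 / 10)" for x
    unfolding g_def g1_def using that
    by (auto intro!: derivative_eq_intros E F simp: algebra_simps)
  have d2: "(g1 has_field_derivative g2 x) (at x)" if x: "norm x < 1 / 10" for x
  proof -
    have "(g1 has_field_derivative
       (E x * (4 * (1 - x) * (I x)^3) * (deriv (deriv f) (w x) * (4 * (1 - x) * (I x)^3))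
         + (E x * ((8 * x - 16) * (I x)^4) + (- b * I x * E x) * (4 * (1 - x) * (I x)^3)) * deriv f (w x))
       - (b * I x * E x * (deriv f (w x) * (4 * (1 - x) * (I x)^3)) + (b * I x * (- b * I x * E x) + b * (- ((I x)^2)) * E x) * f (w x))) (at x)"
      unfolding g1_def
      by (rule derivative_eq_intros E[OF x] I[OF x] F[OF x] V[OF x] refl)+ (simp add: algebra_simps)
    also have "(E x * (4 * (1 - x) * (I x)^3) * (deriv (deriv f) (w x) * (4 * (1 - x) * (I x)^3))
         + (E x * ((8 * x - 16) * (I x)^4) + (- b * I x * E x) * (4 * (1 - x) * (I x)^3)) * deriv f (w x))
       - (b * I x * E x * (deriv f (w x) * (4 * (1 - x) * (I x)^3)) + (b * I x * (- b * I x * E x) + b * (- ((I x)^2)) * E x) * f (w x)) = g2 x"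
      unfolding g2_def by algebra
    finally show ?thesis .
  qed
  have ode: "hyp_op a b c x (g x) (deriv g x) (deriv (deriv g) x) = 0" if x: "norm x < 1 / 10" for x
  proof -
    have "deriv g x = g1 x" "deriv (deriv g) x = g2 x"
      using deriv_deriv_eqI[where S = "ball 0 (1 / 10)", OF _ _ d1 d2[OF x]] x by simp_all
    thus ?thesis
      using hyp_op_quadratic[OF II[OF x] c, of "E x" "f (w x)" "deriv f (w x)" "deriv (deriv f) (w x)"]
        hyp2F1_reg_ode[OF wn[OF x], of "b / 2" "(b + 1) / 2" c]
      by (simp only: g1_def g2_def g_def f_def flip: w_def) simp
  qed
  have "g x * rGamma c = g 0 * hyp2F1_reg a b c x"
  proof (rule hyp_ode_unique[where r = "1 / 10"])
    show "g holomorphic_on ball 0 (1 / 10)"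
      unfolding holomorphic_on_open[OF open_ball] using d1 by blast
  qed (use ode c' x in auto)
  moreover have "g 0 = rGamma c" by (simp add: g_def E_def w_def f_def)
  moreover have "rGamma c \<noteq> 0" using c' by (simp add: rGamma_eq_zero_iff)
  ultimately have "g x = hyp2F1_reg a b c x" by simp
  moreover have "w x = 4 * x / (1 + x)^2" by (simp add: w_def I_def field_simps)
  ultimately show ?thesis by (simp add: g_def E_def f_def)
qed

subsection \<open>The beta integral in exponential form\<close>

definition half_line :: "real measure" where
  "half_line = restrict_space lborel {0<..}"

lemma space_half_line [simp]: "space half_line = {0<..}"
  by (simp add: half_line_def space_restrict_space)

lemma integrable_half_line_iff:
  "integrable half_line (f :: real \<Rightarrow> 'a :: {banach, second_countable_topology}) \<longleftrightarrow> set_integrable lborel {0<..} f"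
  unfolding half_line_def set_integrable_def by (subst integrable_restrict_space) auto

lemma integral_half_line:
  "integral\<^sup>L half_line (f :: real \<Rightarrow> 'a :: {banach, second_countable_topology}) = (LBINT t:{0<..}. f t)"
  unfolding half_line_def set_lebesgue_integral_def by (subst integral_restrict_space) auto

lemma measurable_half_line:
  assumes "continuous_on {0<..} (f :: real \<Rightarrow> complex)"
  shows "f \<in> borel_measurable half_line"
proof -
  have "f \<in> borel_measurable (restrict_space borel {0<..})"
    using assms by (rule borel_measurable_continuous_on_restrict)
  thus ?thesis unfolding half_line_def
    by (simp cong: measurable_cong_sets add: sets_restrict_space)
qed

lemma one_minus_exp_pos: "t > 0 \<Longrightarrow> 1 - exp (- t :: real) > 0"
  by simp

lemma Beta_exp_integral_real:
  fixes s r :: real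
  assumes "s > 0" "r > 0"
  shows "integrable half_line (\<lambda>t. exp (- s * t) * (1 - exp (- t)) powr (r - 1))" (is ?th1)
    and "integral\<^sup>L half_line (\<lambda>t. exp (- s * t) * (1 - exp (- t)) powr (r - 1)) = Beta r s" (is ?th2)
proof -
  let ?f = "\<lambda>t. exp (- s * t) * (1 - exp (- t)) powr (r - 1)"
  \<comment> \<open>The substitution is \<open>x = 1 - exp (- t)\<close> rather than
    \<open>x = exp (- t)\<close>, so that it is increasing; this is why the parameters appear as
    \<open>Beta r s\<close>.\<close>
  let ?g = "\<lambda>x. - ln (1 - x :: real)"
  have eq: "?f (?g x) * (1 / (1 - x)) = x powr (r - 1) * (1 - x) powr (s - 1)" if "0 < x" "x < 1" for x
    using that by (simp add: powr_def exp_diff field_simps)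
  have int: "set_integrable lborel {0<..<1} (\<lambda>t. t powr (r - 1) * (1 - t) powr (s - 1))"
    by (rule set_integrable_subset[OF integrable_Beta]) (use assms in auto)
  have eins: "einterval 0 1 = {0<..<1}" "einterval 0 \<infinity> = {0<..}"
    by (auto simp: einterval_def zero_ereal_def one_ereal_def)
  have int': "set_integrable lborel (einterval 0 1) (\<lambda>x. ?f (?g x) * (1 / (1 - x)))"
    using int unfolding eins by (subst set_integrable_cong[OF refl refl eq]) auto
  have *: "set_integrable lborel (einterval 0 \<infinity>) ?f"
     "(LBINT x=0..\<infinity>. ?f x) = (LBINT x=0..1. ?f (?g x) * (1 / (1 - x)))"
  proof (rule_tac [!] interval_integral_substitution_nonneg[where g = ?g and g' = "\<lambda>x. 1 / (1 - x)"])
    show "((ereal \<circ> ?g \<circ> real_of_ereal) \<longlongrightarrow> 0) (at_right 0)"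
      unfolding zero_ereal_def ereal_tendsto_simps by (auto intro!: tendsto_eq_intros)
    show "((ereal \<circ> ?g \<circ> real_of_ereal) \<longlongrightarrow> \<infinity>) (at_left 1)"
      unfolding one_ereal_def ereal_tendsto_simps by real_asymp
    show "((ereal \<circ> ?g \<circ> real_of_ereal) \<longlongrightarrow> 0) (at_right 0)"
      unfolding zero_ereal_def ereal_tendsto_simps by (auto intro!: tendsto_eq_intros)
    show "((ereal \<circ> ?g \<circ> real_of_ereal) \<longlongrightarrow> \<infinity>) (at_left 1)"
      unfolding one_ereal_def ereal_tendsto_simps by real_asymp
  qed (use int' in \<open>auto simp: zero_ereal_def one_ereal_def intro!: derivative_eq_intros continuous_intros\<close>)
  show ?th1 using *(1) by (simp add: integrable_half_line_iff eins)
  have "integral\<^sup>L half_line ?f = (LBINT x=0..\<infinity>. ?f x)"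
    by (simp add: integral_half_line interval_lebesgue_integral_def eins)
  also have "\<dots> = (LBINT x:{0<..<1}. ?f (?g x) * (1 / (1 - x)))"
    by (subst *(2)) (simp add: interval_lebesgue_integral_def eins)
  also have "\<dots> = (LBINT x:{0<..<1}. x powr (r - 1) * (1 - x) powr (s - 1))"
  proof (rule set_lebesgue_integral_cong)
    show "\<forall>x. x \<in> {0<..<1} \<longrightarrow> ?f (?g x) * (1 / (1 - x)) = x powr (r - 1) * (1 - x) powr (s - 1)"
      by (intro allI impI eq) auto
  qed simp
  also have "\<dots> = integral {0<..<1} (\<lambda>t. t powr (r - 1) * (1 - t) powr (s - 1))"
    using int by (rule set_borel_integral_eq_integral)
  also have "\<dots> = Beta r s"
    using has_integral_Beta_real[of r s] assms by (simp add: has_integral_Icc_iff_Ioo integral_unique)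
  finally show ?th2 .
qed

text \<open>
  The integrand \<open>T\<^bsup>s-1\<^esup> (1 - T)\<^bsup>r-1\<^esup> dT\<close> of the beta integral after the substitution \<open>T = exp (- t)\<close>.
\<close>

definition beta_weight :: "complex \<Rightarrow> complex \<Rightarrow> real \<Rightarrow> complex" where
  "beta_weight s r t = exp (- s * of_real t + (r - 1) * of_real (ln (1 - exp (- t))))"

lemma norm_beta_weight:
  assumes "t > 0"
  shows "norm (beta_weight s r t) = exp (- Re s * t) * (1 - exp (- t)) powr (Re r - 1)"
  using assms by (simp add: beta_weight_def norm_exp_eq_Re mult_exp_exp powr_def)

lemma beta_weight_of_real:
  assumes "t > 0"
  shows "beta_weight (of_real s) (of_real r) t = of_real (exp (- s * t) * (1 - exp (- t)) powr (r - 1))"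
proof -
  have "beta_weight (of_real s) (of_real r) t = exp (of_real (- s * t + (r - 1) * ln (1 - exp (- t))))"
    by (simp add: beta_weight_def)
  also have "\<dots> = of_real (exp (- s * t + (r - 1) * ln (1 - exp (- t))))"
    by (rule exp_of_real)
  finally show ?thesis using assms by (simp add: mult_exp_exp powr_def)
qed

lemma continuous_on_beta_weight: "continuous_on {0<..} (beta_weight s r)"
  unfolding beta_weight_def by (intro continuous_intros) auto

lemma Re_cball_bound:
  assumes "y \<in> cball x (Re x / 2)"
  shows "Re y \<ge> Re x / 2"
  using assms abs_Re_le_cmod[of "x - y"] by (auto simp: dist_norm)

text \<open>On the disc of radius \<open>Re s / 2\<close> real parts stay at least
  \<open>Re s / 2\<close>, so the real beta integrand with that exponent dominates. The other
  parameter is treated in the same way, as \<open>1 - exp (- t)\<close> lies between 0 and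
  1.\<close>

lemma locally_dominated_beta_weight_left:
  assumes "Re r > 0"
  shows "locally_dominated half_line {s. Re s > 0} (\<lambda>s. beta_weight s r)"
  unfolding locally_dominated_def
proof (intro conjI ballI)
  fix s :: complex assume s: "s \<in> {s. Re s > 0}"
  show "\<exists>d>0. \<exists>g. cball s d \<subseteq> {s. 0 < Re s} \<and> integrable half_line g \<and>
          (\<forall>y\<in>cball s d. \<forall>t\<in>space half_line. norm (beta_weight y r t) \<le> (g t :: real))"
  proof (intro exI conjI ballI)
    show "integrable half_line (\<lambda>t. exp (- (Re s / 2) * t) * (1 - exp (- t)) powr (Re r - 1))"
      using s assms by (intro Beta_exp_integral_real) auto
    fix y t assume *: "y \<in> cball s (Re s / 2)" "t \<in> space half_line"
    hence "Re s / 2 * t \<le> Re y * t" using Re_cball_bound[of y s] by (intro mult_right_mono) auto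
    thus "norm (beta_weight y r t) \<le> exp (- (Re s / 2) * t) * (1 - exp (- t)) powr (Re r - 1)"
      using * by (simp add: norm_beta_weight)
  qed (use s Re_cball_bound[of _ s] in force)+
qed (auto simp: beta_weight_def intro!: holomorphic_intros measurable_half_line continuous_intros)

lemma locally_dominated_beta_weight_right:
  assumes "Re s > 0"
  shows "locally_dominated half_line {r. Re r > 0} (beta_weight s)"
  unfolding locally_dominated_def
proof (intro conjI ballI)
  fix r :: complex assume r: "r \<in> {r. Re r > 0}"
  show "\<exists>d>0. \<exists>g. cball r d \<subseteq> {r. 0 < Re r} \<and> integrable half_line g \<and>
          (\<forall>y\<in>cball r d. \<forall>t\<in>space half_line. norm (beta_weight s y t) \<le> (g t :: real))"
  proof (intro exI conjI ballI)
    show "integrable half_line (\<lambda>t. exp (- Re s * t) * (1 - exp (- t)) powr (Re r / 2 - 1))"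
      using r assms by (intro Beta_exp_integral_real) auto
    fix y t assume *: "y \<in> cball r (Re r / 2)" "t \<in> space half_line"
    hence "(1 - exp (- t)) powr (Re y - 1) \<le> (1 - exp (- t)) powr (Re r / 2 - 1)"
      using Re_cball_bound[of y r] by (intro powr_mono') auto
    thus "norm (beta_weight s y t) \<le> exp (- Re s * t) * (1 - exp (- t)) powr (Re r / 2 - 1)"
      using * by (simp add: norm_beta_weight)
  qed (use r Re_cball_bound[of _ r] in force)+
qed (auto simp: beta_weight_def intro!: holomorphic_intros measurable_half_line continuous_intros)

lemma eq_on_half_plane:
  assumes "f holomorphic_on {z. Re z > 0}" "g holomorphic_on {z. Re z > 0}"
    and "\<And>x :: real. x > 0 \<Longrightarrow> f (of_real x) = g (of_real x)" and "Re z > 0"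
  shows "f z = g z"
proof -
  have "(1::complex) islimpt of_real ` {0<..}"
    unfolding islimpt_approachable
  proof (intro allI impI)
    fix e :: real assume "e > 0"
    thus "\<exists>x'\<in>of_real ` {0<..}. x' \<noteq> (1::complex) \<and> dist x' 1 < e"
      by (intro bexI[OF _ imageI[of "1 + e / 2"]]) (auto simp: dist_norm norm_divide)
  qed
  have "f z - g z = 0"
  proof (rule analytic_continuation[of "\<lambda>z. f z - g z" "{z. Re z > 0}" "of_real ` {0<..}" 1])
    show "(\<lambda>z. f z - g z) holomorphic_on {z. Re z > 0}"
      by (intro holomorphic_intros assms)
    show "open {z. Re z > 0}" by (rule open_halfspace_Re_gt)
    show "connected {z. Re z > 0}" by (intro convex_connected convex_halfspace_Re_gt)
    show "1 islimpt complex_of_real ` {0<..}" by fact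
  qed (use assms(3,4) in auto)
  thus ?thesis by simp
qed

text \<open>Continuation from positive parameters, one variable at a time: first in \<open>s\<close>
  with \<open>r\<close> still real, then in \<open>r\<close>.\<close>

theorem Beta_exp_integral:
  assumes "Re s > 0" "Re r > 0"
  shows "integral\<^sup>L half_line (beta_weight s r) = Gamma s * Gamma r * rGamma (s + r)"
proof -
  have real: "integral\<^sup>L half_line (beta_weight (of_real s) (of_real r)) = Gamma (of_real s) * Gamma (of_real r) * rGamma (of_real s + of_real r)"
    if "s > 0" "r > 0" for s r :: real
  proof -
    have "integral\<^sup>L half_line (beta_weight (of_real s) (of_real r)) =
            integral\<^sup>L half_line (\<lambda>t. complex_of_real (exp (- s * t) * (1 - exp (- t)) powr (r - 1)))"
      by (intro Bochner_Integration.integral_cong) (auto simp: beta_weight_of_real)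
    also have "\<dots> = of_real (Beta r s)"
      by (subst integral_complex_of_real, subst Beta_exp_integral_real) (use that in auto)
    also have "\<dots> = of_real (Gamma s * Gamma r * rGamma (s + r))"
      by (simp add: Beta_altdef add_ac mult_ac)
    finally show ?thesis
      by (simp add: Gamma_complex_of_real rGamma_complex_of_real flip: of_real_add)
  qed
  have 1: "integral\<^sup>L half_line (beta_weight s (of_real r)) = Gamma s * Gamma (of_real r) * rGamma (s + of_real r)"
    if "r > 0" "Re s > 0" for s r
  proof (rule eq_on_half_plane[where f = "\<lambda>s. integral\<^sup>L half_line (beta_weight s (of_real r))"])
    show "(\<lambda>s. integral\<^sup>L half_line (beta_weight s (of_real r))) holomorphic_on {z. Re z > 0}"
      by (intro holomorphic_on_integral locally_dominated_beta_weight_left open_halfspace_Re_gt) (use that in auto)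
    show "(\<lambda>s. Gamma s * Gamma (of_real r) * rGamma (s + of_real r)) holomorphic_on {z. Re z > 0}"
      using Re_pos_not_nonpos_Ints by (intro holomorphic_intros) auto
  qed (use that real in auto)
  show ?thesis
  proof (rule eq_on_half_plane[where f = "\<lambda>r. integral\<^sup>L half_line (beta_weight s r)"])
    show "(\<lambda>r. integral\<^sup>L half_line (beta_weight s r)) holomorphic_on {z. Re z > 0}"
      by (intro holomorphic_on_integral locally_dominated_beta_weight_right open_halfspace_Re_gt assms)
    show "(\<lambda>r. Gamma s * Gamma r * rGamma (s + r)) holomorphic_on {z. Re z > 0}"
      using Re_pos_not_nonpos_Ints by (intro holomorphic_intros) auto
  qed (use assms 1 in auto)
qed

subsection \<open>The product formula\<close>

text \<open>The logarithms are added before exponentiating because each factor has positive real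
  part, whereas the product of the three may cross the branch cut of a principal power.\<close>

definition product_kernel :: "complex \<Rightarrow> complex \<Rightarrow> complex \<Rightarrow> complex \<Rightarrow> complex \<Rightarrow> complex" where
  "product_kernel a b Y X T = (1 - X * Y * T^2)
     * exp ((a - 1) * (Ln (1 - X * T) + Ln (1 - Y * T) + Ln (1 - X * Y * T)))
     * hyp2F1_reg a b (b - a + 1) (X * Y * T^2)"

lemma norm_mult_less_1:
  assumes "norm (x :: complex) < 1" "norm t \<le> 1"
  shows "norm (x * t) < 1"
proof -
  have "norm (x * t) \<le> norm x * 1" unfolding norm_mult using assms by (intro mult_left_mono) auto
  thus ?thesis using assms by simp
qed

lemma product_kernel_args:
  assumes "norm (X :: complex) < 1" "norm Y < 1" "norm T \<le> 1"
  shows "norm (X * T) < 1" "norm (Y * T) < 1" "norm (X * Y * T) < 1" "norm (X * Y * T^2) < 1"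
proof -
  show "norm (X * T) < 1" "norm (Y * T) < 1" using assms norm_mult_less_1 by blast+
  have "norm (X * Y) < 1" using assms by (intro norm_mult_less_1) auto
  thus "norm (X * Y * T) < 1" "norm (X * Y * T^2) < 1"
    using assms by (auto intro!: norm_mult_less_1[of "X * Y"] simp: norm_power power_le_one)
qed

lemma one_minus_not_nonpos_Reals: "norm (z :: complex) < 1 \<Longrightarrow> 1 - z \<notin> \<real>\<^sub>\<le>\<^sub>0"
  by (intro Re_pos_not_nonpos_Reals Re_one_minus_pos)

lemma one_minus_nonzero: "norm (z :: complex) < 1 \<Longrightarrow> 1 - z \<noteq> 0"
  by auto

lemma continuous_on_product_kernel:
  assumes "norm Y < 1"
  shows "continuous_on (ball 0 1 \<times> cball 0 1) (\<lambda>(X, T). product_kernel a b Y X T)"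
proof -
  have "continuous_on (ball 0 1) (hyp2F1_reg a b (b - a + 1))"
    by (intro holomorphic_on_imp_continuous_on holomorphic_hyp2F1_reg)
  hence "continuous_on (ball 0 1 \<times> cball 0 1) (\<lambda>p. hyp2F1_reg a b (b - a + 1) (fst p * Y * (snd p)^2))"
    by (rule continuous_on_compose2) (use assms product_kernel_args in \<open>auto intro!: continuous_intros\<close>)
  thus ?thesis unfolding product_kernel_def case_prod_unfold
    by (intro continuous_intros) (use assms product_kernel_args one_minus_not_nonpos_Reals in auto)
qed

text \<open>The kernel is continuous up to \<open>T = 0\<close> and \<open>T = 1\<close>, which
  correspond to the two ends of the half line, so compactness applies. All singular behaviour is
  left to the beta weight.\<close>

lemma product_kernel_bounded:
  assumes "norm Y < 1" "r < 1"
  obtains M where "M > 0" "\<And>X T. norm X \<le> r \<Longrightarrow> norm T \<le> 1 \<Longrightarrow> norm (product_kernel a b Y X T) \<le> M"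
proof -
  have "compact (cball (0::complex) r \<times> cball (0::complex) 1)" by (intro compact_Times) auto
  moreover have "continuous_on (cball 0 r \<times> cball 0 1) (\<lambda>(X, T). product_kernel a b Y X T)"
    by (rule continuous_on_subset[OF continuous_on_product_kernel[OF assms(1)]]) (use assms in auto)
  ultimately have "bounded ((\<lambda>(X, T). product_kernel a b Y X T) ` (cball 0 r \<times> cball 0 1))"
    by (intro compact_imp_bounded compact_continuous_image)
  then obtain M where M: "M > 0" "\<forall>x\<in>(\<lambda>(X, T). product_kernel a b Y X T) ` (cball 0 r \<times> cball 0 1). norm x \<le> M"
    by (auto simp: bounded_pos)
  show ?thesis
  proof (rule that[OF M(1)])
    fix X T :: complex assume "norm X \<le> r" "norm T \<le> 1"
    hence "(X, T) \<in> cball 0 r \<times> cball 0 1" by auto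
    hence "product_kernel a b Y X T \<in> (\<lambda>(X, T). product_kernel a b Y X T) ` (cball 0 r \<times> cball 0 1)"
      by force
    thus "norm (product_kernel a b Y X T) \<le> M" using M(2) by blast
  qed
qed

lemma norm_exp_minus_of_real: "t \<ge> 0 \<Longrightarrow> norm (exp (- complex_of_real t)) \<le> 1"
  by (simp add: norm_exp_eq_Re)

lemma product_kernel_holomorphic:
  assumes "norm Y < 1" "norm T \<le> 1"
  shows "(\<lambda>X. product_kernel a b Y X T) holomorphic_on ball 0 1"
proof -
  have "(\<lambda>X. hyp2F1_reg a b (b - a + 1) (X * Y * T^2)) holomorphic_on ball 0 1"
    using assms product_kernel_args(4)
    by (intro holomorphic_on_compose_gen[OF _ holomorphic_hyp2F1_reg, of "\<lambda>X. X * Y * T^2", unfolded comp_def])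
       (auto intro!: holomorphic_intros)
  thus ?thesis unfolding product_kernel_def
    by (intro holomorphic_intros) (use assms product_kernel_args one_minus_not_nonpos_Reals in auto)
qed

lemma locally_dominated_product_kernel:
  assumes "norm Y < 1" "Re s > 0" "Re r > 0"
  shows "locally_dominated half_line (ball 0 1)
           (\<lambda>X t. beta_weight s r t * product_kernel a b Y X (exp (- of_real t)))"
  unfolding locally_dominated_def
proof (intro conjI ballI)
  fix X :: complex assume X: "X \<in> ball 0 1"
  have "continuous_on {0<..} (\<lambda>t::real. (\<lambda>(X, T). product_kernel a b Y X T) (X, exp (- of_real t)))"
    by (rule continuous_on_compose2[OF continuous_on_product_kernel[OF assms(1)]])
       (use X norm_exp_minus_of_real in \<open>auto intro!: continuous_intros\<close>)
  thus "(\<lambda>t. beta_weight s r t * product_kernel a b Y X (exp (- of_real t))) \<in> borel_measurable half_line"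
    by (intro measurable_half_line continuous_on_mult continuous_on_beta_weight) auto
  define d where "d = (1 - norm X) / 2"
  have d: "d > 0" "norm X + d < 1" using X by (auto simp: d_def field_simps)
  have nX: "norm y \<le> norm X + d" if "y \<in> cball X d" for y
    using that norm_triangle_ineq2[of y X] by (auto simp: dist_norm norm_minus_commute)
  from product_kernel_bounded[OF assms(1) d(2)] obtain M where
    M: "M > 0" "\<And>x T. norm x \<le> norm X + d \<Longrightarrow> norm T \<le> 1 \<Longrightarrow> norm (product_kernel a b Y x T) \<le> M" by metis
  have "integrable half_line (\<lambda>t. norm (beta_weight s r t) * M)"
    by (intro integrable_mult_left integrable_norm locally_dominated_integrable[OF locally_dominated_beta_weight_right])
       (use assms in auto)
  moreover have "norm (beta_weight s r t * product_kernel a b Y y (exp (- of_real t))) \<le> norm (beta_weight s r t) * M"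
    if "y \<in> cball X d" "t \<in> space half_line" for y t
    unfolding norm_mult using that nX norm_exp_minus_of_real by (intro mult_left_mono M) auto
  moreover have "cball X d \<subseteq> ball 0 1"
    using nX d by force
  ultimately show "\<exists>d>0. \<exists>g. cball X d \<subseteq> ball 0 1 \<and> integrable half_line (g :: real \<Rightarrow> real) \<and>
      (\<forall>y\<in>cball X d. \<forall>t\<in>space half_line. norm (beta_weight s r t * product_kernel a b Y y (exp (- of_real t))) \<le> g t)"
    using d(1) by blast
next
  fix t :: real assume "t \<in> space half_line"
  thus "(\<lambda>X. beta_weight s r t * product_kernel a b Y X (exp (- of_real t))) holomorphic_on ball 0 1"
    using assms norm_exp_minus_of_real by (intro holomorphic_intros product_kernel_holomorphic) auto
qed

section \<open>The exact derivative in the integration variable\<close>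

lemma certificate_deriv:
  fixes X Y T a b p s :: complex
  assumes p: "p * (1 - X * T) = 1" and s: "s * (1 - X * Y * T) = 1"
  defines "l1 \<equiv> - (a - 1) * (T * p + Y * T * s)"
  defines "u \<equiv> X * Y * T^2"
  defines "R \<equiv> (1 - T) * (1 - Y * T) * (1 - X^2 * Y * T^2) * p * s"
  shows "X * (1 - X) * (2 * (1 - u) * l1 - 2 * Y * T^2) * (Y * T^2)
     - (1 - X) * Y * T^2 * (b - a + 1 - (a + b + 1) * u) + (b - a + 1 - (1 - a + (b - 2 * a + 1) + 1) * X) * (1 - u) * (Y * T^2)
     = (1 - a) * (- T * R * (2 * X * Y * T))"
  using p s unfolding l1_def u_def R_def by algebra

text \<open>Once the second derivative of the hypergeometric function is eliminated by its equation,
  exactness amounts to two rational identities: the preceding one for the coefficient of the first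
  derivative, this one for that of the value. Splitting \<open>N\<close> off from
  \<open>(1 - T) * (1 - Y * T)\<close> cancels in advance the inverses of \<open>1 - T\<close> and
  \<open>1 - Y * T\<close> that come from logarithmic derivatives.\<close>

lemma certificate_value:
  fixes X Y T a b p s :: complex
  assumes p: "p * (1 - X * T) = 1" and s: "s * (1 - X * Y * T) = 1"
  defines "l1 \<equiv> - (a - 1) * (T * p + Y * T * s)"
  defines "l2 \<equiv> (a - 1)^2 * (T * p + Y * T * s)^2 - (a - 1) * (T^2 * p^2 + Y^2 * T^2 * s^2)"
  defines "u \<equiv> X * Y * T^2"
  defines "N \<equiv> (1 - X^2 * Y * T^2) * p * s"
  shows "X * (1 - X) * ((1 - u) * l2 - 2 * Y * T^2 * l1) + (1 - X) * Y * T^2 * (a * b)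
     + (b - a + 1 - (1 - a + (b - 2 * a + 1) + 1) * X) * ((1 - u) * l1 - Y * T^2) - (1 - a) * (b - 2 * a + 1) * (1 - u)
     = (1 - a) * (- (b - 2 * a + 1) * ((1 - T) * (1 - Y * T) * N) + (a - 1) * T * (1 - Y * T) * N
         + T * (a - 1) * ((1 - T) * (1 - Y * T) * N * (X * p + X * Y * s) + Y * (1 - T) * N)
         + T * ((1 - Y * T) * N + Y * (1 - T) * N + 2 * X^2 * Y * T * (1 - T) * (1 - Y * T) * p * s)
         - T * ((1 - T) * (1 - Y * T) * N * (X * p + X * Y * s)))"
  using p s unfolding l1_def l2_def u_def N_def by algebra

text \<open>\<open>l1\<close> and \<open>l2\<close> are the first and second derivatives in
  \<open>X\<close> of the exponential factor, divided by that factor; hence \<open>l2\<close> is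
  \<open>l1^2\<close> plus the derivative of \<open>l1\<close>.\<close>

lemma product_kernel_derivs:
  fixes a b Y X T
  assumes "norm Y < 1" "norm X < 1" "norm T \<le> 1"
  defines "f \<equiv> hyp2F1_reg a b (b - a + 1)"
  defines "u \<equiv> X * Y * T^2"
  defines "L \<equiv> exp ((a - 1) * (Ln (1 - X * T) + Ln (1 - Y * T) + Ln (1 - X * Y * T)))"
  defines "p \<equiv> inverse (1 - X * T)" and "s \<equiv> inverse (1 - X * Y * T)"
  defines "l1 \<equiv> - (a - 1) * (T * p + Y * T * s)"
  defines "l2 \<equiv> (a - 1)^2 * (T * p + Y * T * s)^2 - (a - 1) * (T^2 * p^2 + Y^2 * T^2 * s^2)"
  shows "deriv (\<lambda>X. product_kernel a b Y X T) X = L * (((1 - u) * l1 - Y * T^2) * f u + (1 - u) * (Y * T^2) * deriv f u)"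
    "deriv (deriv (\<lambda>X. product_kernel a b Y X T)) X =
       L * (((1 - u) * l2 - 2 * Y * T^2 * l1) * f u + (2 * (1 - u) * l1 - 2 * Y * T^2) * (Y * T^2) * deriv f u
             + (1 - u) * (Y * T^2)^2 * deriv (deriv f) u)"
proof -
  define K where "K X = exp ((a - 1) * (Ln (1 - X * T) + Ln (1 - Y * T) + Ln (1 - X * Y * T)))" for X
  define P where "P X = inverse (1 - X * T)" for X
  define S where "S X = inverse (1 - X * Y * T)" for X
  define l where "l X = - (a - 1) * (T * P X + Y * T * S X)" for X
  define U where "U X = X * Y * T^2" for X
  define g1 where "g1 X = K X * (((1 - U X) * l X - Y * T^2) * f (U X) + (1 - U X) * (Y * T^2) * deriv f (U X))" for X
  have args: "norm (X * T) < 1" "norm (Y * T) < 1" "norm (X * Y * T) < 1" "norm (U X) < 1" if "norm X < 1" for X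
    using product_kernel_args[OF that assms(1,3)] by (simp_all add: U_def)
  note nn = args[THEN one_minus_not_nonpos_Reals] args[THEN one_minus_nonzero]
  have dP: "(P has_field_derivative T * (P X)^2) (at X)" if "norm X < 1" for X
    unfolding P_def using nn[OF that] by (auto intro!: derivative_eq_intros simp: power2_eq_square)
  have dS: "(S has_field_derivative Y * T * (S X)^2) (at X)" if "norm X < 1" for X
    unfolding S_def using nn[OF that] by (auto intro!: derivative_eq_intros simp: power2_eq_square)
  have dK: "(K has_field_derivative K X * l X) (at X)" if "norm X < 1" for X
    unfolding K_def l_def P_def S_def using nn[OF that]
    by (auto intro!: derivative_eq_intros simp: divide_inverse algebra_simps)
  have dU: "(U has_field_derivative Y * T^2) (at X)" for X
    unfolding U_def by (auto intro!: derivative_eq_intros)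
  have dl: "(l has_field_derivative - (a - 1) * (T^2 * (P X)^2 + Y^2 * T^2 * (S X)^2)) (at X)" if "norm X < 1" for X
    unfolding l_def using that
    by (auto intro!: derivative_eq_intros dP dS simp: algebra_simps power2_eq_square)
  have df: "((\<lambda>X. f (U X)) has_field_derivative deriv f (U X) * (Y * T^2)) (at X)"
    "((\<lambda>X. deriv f (U X)) has_field_derivative deriv (deriv f) (U X) * (Y * T^2)) (at X)" if "norm X < 1" for X
    using has_field_derivative_hyp2F1_reg[OF args(4)[OF that]] dU[of X] unfolding f_def by (metis DERIV_chain2)+
  have d1: "((\<lambda>X. product_kernel a b Y X T) has_field_derivative g1 X) (at X)" if "X \<in> ball 0 1" for X
  proof -
    have nX: "norm X < 1" using that by simp
    have "((\<lambda>X. (1 - U X) * K X * f (U X)) has_field_derivative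
       ((1 - U X) * K X * (deriv f (U X) * (Y * T^2)) + ((1 - U X) * (K X * l X) + (0 - Y * T^2) * K X) * f (U X))) (at X)"
      by (auto intro!: derivative_eq_intros dK[OF nX] df(1)[OF nX] dU simp: algebra_simps)
    also have "((1 - U X) * K X * (deriv f (U X) * (Y * T^2)) + ((1 - U X) * (K X * l X) + (0 - Y * T^2) * K X) * f (U X)) = g1 X"
      unfolding g1_def by (simp add: algebra_simps)
    finally show ?thesis by (simp add: product_kernel_def K_def U_def f_def)
  qed
  have d2: "(g1 has_field_derivative K X * (((1 - U X) * ((l X)^2 - (a - 1) * (T^2 * (P X)^2 + Y^2 * T^2 * (S X)^2)) - 2 * Y * T^2 * l X) * f (U X)
      + (2 * (1 - U X) * l X - 2 * Y * T^2) * (Y * T^2) * deriv f (U X) + (1 - U X) * (Y * T^2)^2 * deriv (deriv f) (U X))) (at X)"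
    unfolding g1_def using assms(2)
    by (auto intro!: derivative_eq_intros dK df dU dl simp: algebra_simps power2_eq_square)
  have conv: "K X = L" "U X = u" "P X = p" "S X = s" "l X = l1"
    by (simp_all add: K_def L_def U_def u_def P_def S_def p_def s_def l_def l1_def)
  have l2: "(l X)^2 - (a - 1) * (T^2 * (P X)^2 + Y^2 * T^2 * (S X)^2) = l2"
    unfolding conv l1_def l2_def by algebra
  note dd = deriv_deriv_eqI[where S = "ball 0 1", OF _ _ d1 d2]
  show "deriv (\<lambda>X. product_kernel a b Y X T) X = L * (((1 - u) * l1 - Y * T^2) * f u + (1 - u) * (Y * T^2) * deriv f u)"
    using dd(1) assms(2) unfolding g1_def conv by simp
  show "deriv (deriv (\<lambda>X. product_kernel a b Y X T)) X =
       L * (((1 - u) * l2 - 2 * Y * T^2 * l1) * f u + (2 * (1 - u) * l1 - 2 * Y * T^2) * (Y * T^2) * deriv f u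
             + (1 - u) * (Y * T^2)^2 * deriv (deriv f) u)"
    using dd(2) assms(2) unfolding conv l2[unfolded conv] by simp
qed

text \<open>The right side is a derivative in \<open>t\<close> along \<open>T = exp (- t)\<close>,
  with the weight divided out: \<open>- (b - 2 * a + 1) + (a - 1) * T * q\<close> is the logarithmic
  derivative of the weight, \<open>R'\<close> is the derivative of \<open>R\<close> in
  \<open>T\<close>, and \<open>- T\<close> is that of \<open>T\<close>. On the left,
  \<open>X * (1 - X) * (1 - u) * (Y * T^2)^2\<close> equals
  \<open>(1 - X) * (Y * T^2) * (u * (1 - u))\<close>, so \<open>f2\<close> enters only through the
  equation at \<open>u\<close>, and the coefficients of \<open>f0\<close> and \<open>f1\<close> can
  be compared separately.\<close>

lemma certificate:
  fixes X Y T a b c p s v q L f0 f1 f2 :: complex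
  assumes c: "c = b - a + 1"
  assumes p: "p * (1 - X * T) = 1" and s: "s * (1 - X * Y * T) = 1"
    and v: "v * (1 - Y * T) = 1" and q: "q * (1 - T) = 1"
  defines "l1 \<equiv> - (a - 1) * (T * p + Y * T * s)"
  defines "l2 \<equiv> (a - 1)^2 * (T * p + Y * T * s)^2 - (a - 1) * (T^2 * p^2 + Y^2 * T^2 * s^2)"
  defines "u \<equiv> X * Y * T^2"
  defines "R \<equiv> (1 - T) * (1 - Y * T) * (1 - X^2 * Y * T^2) * p * s"
  defines "R' \<equiv> - (1 - Y * T) * (1 - X^2 * Y * T^2) * p * s - Y * (1 - T) * (1 - X^2 * Y * T^2) * p * s
      - 2 * X^2 * Y * T * (1 - T) * (1 - Y * T) * p * s + R * (X * p + X * Y * s)"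
  assumes ode: "hyp_op a b c u f0 f1 f2 = 0"
  shows "hyp_op (1 - a) (b - 2 * a + 1) c X (L * ((1 - u) * f0))
      (L * (((1 - u) * l1 - Y * T^2) * f0 + (1 - u) * (Y * T^2) * f1))
      (L * (((1 - u) * l2 - 2 * Y * T^2 * l1) * f0 + (2 * (1 - u) * l1 - 2 * Y * T^2) * (Y * T^2) * f1
             + (1 - u) * (Y * T^2)^2 * f2)) =
      (1 - a) * L * ((- (b - 2 * a + 1) + (a - 1) * T * q) * R * f0
        - T * ((- (a - 1) * (X * p + Y * v + X * Y * s)) * R * f0 + R' * f0 + R * (2 * X * Y * T) * f1))"
proof -
  define N where "N = (1 - X^2 * Y * T^2) * p * s"
  define C0 where "C0 = X * (1 - X) * ((1 - u) * l2 - 2 * Y * T^2 * l1) + (1 - X) * Y * T^2 * (a * b)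
     + (b - a + 1 - (1 - a + (b - 2 * a + 1) + 1) * X) * ((1 - u) * l1 - Y * T^2) - (1 - a) * (b - 2 * a + 1) * (1 - u)"
  define C1 where "C1 = X * (1 - X) * (2 * (1 - u) * l1 - 2 * Y * T^2) * (Y * T^2)
     - (1 - X) * Y * T^2 * (b - a + 1 - (a + b + 1) * u) + (b - a + 1 - (1 - a + (b - 2 * a + 1) + 1) * X) * (1 - u) * (Y * T^2)"
  have C1: "C1 = (1 - a) * (- T * R * (2 * X * Y * T))"
    unfolding C1_def l1_def u_def R_def by (rule certificate_deriv[OF p s])
  have C0: "C0 = (1 - a) * (- (b - 2 * a + 1) * ((1 - T) * (1 - Y * T) * N) + (a - 1) * T * (1 - Y * T) * N
         + T * (a - 1) * ((1 - T) * (1 - Y * T) * N * (X * p + X * Y * s) + Y * (1 - T) * N)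
         + T * ((1 - Y * T) * N + Y * (1 - T) * N + 2 * X^2 * Y * T * (1 - T) * (1 - Y * T) * p * s)
         - T * ((1 - T) * (1 - Y * T) * N * (X * p + X * Y * s)))"
    unfolding C0_def l1_def l2_def u_def N_def by (rule certificate_value[OF p s])
  have R: "R = (1 - T) * (1 - Y * T) * N" "R * q = (1 - Y * T) * N" "R * v = (1 - T) * N"
  proof -
    show "R = (1 - T) * (1 - Y * T) * N" unfolding R_def N_def by algebra
    show "R * q = (1 - Y * T) * N" using q unfolding R_def N_def by algebra
    show "R * v = (1 - T) * N" using v unfolding R_def N_def by algebra
  qed
  have R': "R' = - (1 - Y * T) * N - Y * (1 - T) * N - 2 * X^2 * Y * T * (1 - T) * (1 - Y * T) * p * s
     + R * (X * p + X * Y * s)"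
    unfolding R'_def N_def by (simp add: mult_ac)
  have "hyp_op (1 - a) (b - 2 * a + 1) c X (L * ((1 - u) * f0))
      (L * (((1 - u) * l1 - Y * T^2) * f0 + (1 - u) * (Y * T^2) * f1))
      (L * (((1 - u) * l2 - 2 * Y * T^2 * l1) * f0 + (2 * (1 - u) * l1 - 2 * Y * T^2) * (Y * T^2) * f1
             + (1 - u) * (Y * T^2)^2 * f2)) =
      L * (C0 * f0 + C1 * f1 + (1 - X) * (Y * T^2) * hyp_op a b c u f0 f1 f2)"
    unfolding hyp_op_def C0_def C1_def c u_def by algebra
  also have "\<dots> = L * (C0 * f0 + C1 * f1)" by (simp add: ode)
  also have "C0 = (1 - a) * (- (b - 2 * a + 1) * R + (a - 1) * T * (R * q)
       - T * (- (a - 1) * (X * p * R + Y * (R * v) + X * Y * s * R) + R'))"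
    unfolding C0 R' R(2,3) unfolding R(1) by algebra
  finally show ?thesis unfolding C1 by (simp add: algebra_simps)
qed

text \<open>
  A primitive, in \<open>z\<close>, of the hypergeometric operator in \<open>X\<close> applied to the integrand of the product formula.
  It comes from \<open>\<integral> q (c) sinh\<^bsup>2a-1\<^esup> s ds\<close> with \<open>cosh c = cosh x cosh y + sinh x sinh y cosh s\<close>, where it is the radial
  part of the Laplacian in polar coordinates that produces total derivatives in \<open>s\<close>; after the change of variables
  to \<open>z = c - x - y\<close> the terms with the derivative of \<open>q\<close> cancel.
\<close>

definition kernel_primitive :: "complex \<Rightarrow> complex \<Rightarrow> complex \<Rightarrow> complex \<Rightarrow> complex \<Rightarrow> complex" where
  "kernel_primitive a b Y X z = (1 - a) * exp (- (b - 2 * a + 1) * z + (a - 1) * Ln (1 - exp (- z)))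
     * (1 - exp (- z)) *
     (exp ((a - 1) * (Ln (1 - X * exp (- z)) + Ln (1 - Y * exp (- z)) + Ln (1 - X * Y * exp (- z))))
     * (1 - Y * exp (- z)) * (1 - X^2 * Y * (exp (- z))^2)
     * inverse (1 - X * exp (- z)) * inverse (1 - X * Y * exp (- z)) * hyp2F1_reg a b (b - a + 1) (X * Y * (exp (- z))^2))"

lemma beta_weight_conv_Ln:
  assumes "t > 0"
  shows "beta_weight s r t = exp (- s * of_real t + (r - 1) * Ln (1 - exp (- of_real t)))"
proof -
  have "1 - exp (- complex_of_real t) = of_real (1 - exp (- t))"
    by (simp flip: exp_of_real)
  thus ?thesis using assms by (simp only: beta_weight_def Ln_of_real[OF one_minus_exp_pos])
qed

text \<open>The variable is complex so that the primitive is holomorphic on a half plane; this later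
  gives the continuity of its derivative on the half line without further work.\<close>

lemma kernel_primitive_deriv:
  fixes a b Y X z
  assumes "norm Y < 1" "norm X < 1" "Re z > 0"
  defines "T \<equiv> exp (- z)"
  shows "(kernel_primitive a b Y X has_field_derivative
      exp (- (b - 2 * a + 1) * z + (a - 1) * Ln (1 - exp (- z))) *
      hyp_op (1 - a) (b - 2 * a + 1) (b - a + 1) X (product_kernel a b Y X T)
        (deriv (\<lambda>X. product_kernel a b Y X T) X) (deriv (deriv (\<lambda>X. product_kernel a b Y X T)) X)) (at z)"
proof -
  define f where "f = hyp2F1_reg a b (b - a + 1)"
  define W where "W z = exp (- (b - 2 * a + 1) * z + (a - 1) * Ln (1 - exp (- z)))" for z
  define P where "P T = inverse (1 - X * T)" for T
  define S where "S T = inverse (1 - X * Y * T)" for T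
  define V where "V = inverse (1 - Y * T)"
  define Q where "Q = inverse (1 - T)"
  define K where "K T = exp ((a - 1) * (Ln (1 - X * T) + Ln (1 - Y * T) + Ln (1 - X * Y * T)))" for T
  define U where "U T = X * Y * T^2" for T
  define R where "R T = (1 - T) * (1 - Y * T) * (1 - X^2 * Y * T^2) * P T * S T" for T
  define R' where "R' = - (1 - Y * T) * (1 - X^2 * Y * T^2) * P T * S T - Y * (1 - T) * (1 - X^2 * Y * T^2) * P T * S T
      - 2 * X^2 * Y * T * (1 - T) * (1 - Y * T) * P T * S T + R T * (X * P T + X * Y * S T)"
  have T: "norm T < 1" using assms by (simp add: T_def norm_exp_eq_Re)
  have args: "norm (X * T) < 1" "norm (Y * T) < 1" "norm (X * Y * T) < 1" "norm (U T) < 1"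
    using product_kernel_args[of X Y T] assms T by (simp_all add: U_def)
  note nn = args[THEN one_minus_not_nonpos_Reals] args[THEN one_minus_nonzero]
     T[THEN one_minus_not_nonpos_Reals] T[THEN one_minus_nonzero]
  have dT: "((\<lambda>z. exp (- z)) has_field_derivative - T) (at z)"
    unfolding T_def by (auto intro!: derivative_eq_intros)
  have dW: "(W has_field_derivative W z * (- (b - 2 * a + 1) + (a - 1) * T * Q)) (at z)"
    unfolding W_def T_def Q_def using nn unfolding T_def
    by (auto intro!: derivative_eq_intros simp: divide_inverse)
  have dP: "(P has_field_derivative X * (P T)^2) (at T)"
    unfolding P_def using nn by (auto intro!: derivative_eq_intros simp: power2_eq_square)
  have dS: "(S has_field_derivative X * Y * (S T)^2) (at T)"
    unfolding S_def using nn by (auto intro!: derivative_eq_intros simp: power2_eq_square)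
  have dK: "(K has_field_derivative K T * (- (a - 1) * (X * P T + Y * V + X * Y * S T))) (at T)"
    unfolding K_def P_def S_def V_def using nn
    by (auto intro!: derivative_eq_intros simp: divide_inverse algebra_simps)
  have dU: "(U has_field_derivative 2 * X * Y * T) (at T)"
    unfolding U_def by (auto intro!: derivative_eq_intros)
  have df: "((\<lambda>T. f (U T)) has_field_derivative deriv f (U T) * (2 * X * Y * T)) (at T)"
    using has_field_derivative_hyp2F1_reg[OF args(4)] dU unfolding f_def by (metis DERIV_chain2)
  have dR: "(R has_field_derivative R') (at T)"
    unfolding R_def R'_def by (auto intro!: derivative_eq_intros dP dS simp: algebra_simps power2_eq_square)
  have "((\<lambda>T. K T * R T * f (U T)) has_field_derivative
     (K T * (- (a - 1) * (X * P T + Y * V + X * Y * S T)) * R T * f (U T) + K T * R' * f (U T)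
       + K T * R T * (deriv f (U T) * (2 * X * Y * T)))) (at T)"
    by (auto intro!: derivative_eq_intros dK dR df simp: algebra_simps)
  hence dE: "((\<lambda>z. K (exp (- z)) * R (exp (- z)) * f (U (exp (- z)))) has_field_derivative
     (K T * (- (a - 1) * (X * P T + Y * V + X * Y * S T)) * R T * f (U T) + K T * R' * f (U T)
       + K T * R T * (deriv f (U T) * (2 * X * Y * T))) * (- T)) (at z)"
    using DERIV_chain2[OF _ dT, of "\<lambda>T. K T * R T * f (U T)"] unfolding T_def by blast
  have "((\<lambda>z. (1 - a) * (W z * (K (exp (- z)) * R (exp (- z)) * f (U (exp (- z)))))) has_field_derivative
      (1 - a) * (W z * (- (b - 2 * a + 1) + (a - 1) * T * Q) * (K T * R T * f (U T)) +
        (K T * (- (a - 1) * (X * P T + Y * V + X * Y * S T)) * R T * f (U T) + K T * R' * f (U T)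
       + K T * R T * (deriv f (U T) * (2 * X * Y * T))) * (- T) * W z)) (at z)"
    using DERIV_cmult[OF DERIV_mult[OF dW dE], of "1 - a"] unfolding T_def by simp
  also have "(\<lambda>z. (1 - a) * (W z * (K (exp (- z)) * R (exp (- z)) * f (U (exp (- z)))))) = kernel_primitive a b Y X"
    by (rule ext) (simp add: kernel_primitive_def W_def K_def R_def P_def S_def f_def U_def)
  also have "(1 - a) * (W z * (- (b - 2 * a + 1) + (a - 1) * T * Q) * (K T * R T * f (U T)) +
        (K T * (- (a - 1) * (X * P T + Y * V + X * Y * S T)) * R T * f (U T) + K T * R' * f (U T)
       + K T * R T * (deriv f (U T) * (2 * X * Y * T))) * (- T) * W z) =
     W z * ((1 - a) * K T * ((- (b - 2 * a + 1) + (a - 1) * T * Q) * R T * f (U T)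
        - T * ((- (a - 1) * (X * P T + Y * V + X * Y * S T)) * R T * f (U T) + R' * f (U T) + R T * (2 * X * Y * T) * deriv f (U T))))"
    by algebra
  also have "((1 - a) * K T * ((- (b - 2 * a + 1) + (a - 1) * T * Q) * R T * f (U T)
        - T * ((- (a - 1) * (X * P T + Y * V + X * Y * S T)) * R T * f (U T) + R' * f (U T) + R T * (2 * X * Y * T) * deriv f (U T))))
     = hyp_op (1 - a) (b - 2 * a + 1) (b - a + 1) X (product_kernel a b Y X T)
        (deriv (\<lambda>X. product_kernel a b Y X T) X) (deriv (deriv (\<lambda>X. product_kernel a b Y X T)) X)"
  proof -
    have inv: "P T * (1 - X * T) = 1" "S T * (1 - X * Y * T) = 1" "V * (1 - Y * T) = 1" "Q * (1 - T) = 1"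
      using nn by (simp_all add: P_def S_def V_def Q_def)
    have ode: "hyp_op a b (b - a + 1) (X * Y * T^2) (f (U T)) (deriv f (U T)) (deriv (deriv f) (U T)) = 0"
      using hyp2F1_reg_ode[OF args(4), of a b "b - a + 1"] by (simp only: f_def U_def)
    have val: "product_kernel a b Y X T = K T * ((1 - U T) * f (U T))"
      by (simp add: product_kernel_def K_def U_def f_def)
    note d = product_kernel_derivs[OF assms(1,2) less_imp_le[OF T], of a b,
        folded f_def K_def P_def S_def U_def]
    show ?thesis
      unfolding val d U_def R'_def R_def
      by (rule certificate[OF refl inv ode, of "K T", unfolded U_def, symmetric])
  qed
  finally show ?thesis unfolding W_def .
qed

text \<open>The extra factor \<open>1 - exp (- z)\<close> of the primitive raises the exponent of
  the weight from \<open>Re a - 1\<close> to \<open>Re a\<close>, so for positive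
  \<open>Re a\<close> and \<open>Re (b - 2 * a + 1)\<close> the bound tends to 0 at both
  ends.\<close>

lemma kernel_primitive_bound:
  assumes "norm Y < 1" "norm X < 1"
  obtains M where "M > 0" "\<And>t. t > 0 \<Longrightarrow> norm (kernel_primitive a b Y X (of_real t))
     \<le> M * (exp (- Re (b - 2 * a + 1) * t) * (1 - exp (- t)) powr Re a)"
proof -
  define g where "g T = exp ((a - 1) * (Ln (1 - X * T) + Ln (1 - Y * T) + Ln (1 - X * Y * T)))
     * (1 - Y * T) * (1 - X^2 * Y * T^2)
     * inverse (1 - X * T) * inverse (1 - X * Y * T) * hyp2F1_reg a b (b - a + 1) (X * Y * T^2)" for T
  note args = product_kernel_args[OF assms(2,1)]
  have "continuous_on (ball 0 1) (hyp2F1_reg a b (b - a + 1))"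
    by (intro holomorphic_on_imp_continuous_on holomorphic_hyp2F1_reg)
  hence "continuous_on (cball 0 1) (\<lambda>T. hyp2F1_reg a b (b - a + 1) (X * Y * T^2))"
    by (rule continuous_on_compose2) (use args in \<open>auto intro!: continuous_intros\<close>)
  hence "continuous_on (cball 0 1) g"
    unfolding g_def
    by (intro continuous_intros) (use args one_minus_not_nonpos_Reals one_minus_nonzero in auto)
  hence "bounded (g ` cball 0 1)"
    by (intro compact_imp_bounded compact_continuous_image) auto
  then obtain M where M: "M > 0" "\<And>T. norm T \<le> 1 \<Longrightarrow> norm (g T) \<le> M"
    by (auto simp: bounded_pos)
  show ?thesis
  proof (rule that[of "(norm (1 - a) + 1) * M"])
    \<comment> \<open>The summand 1 keeps the constant positive when \<open>a = 1\<close>.\<close>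
    show "(norm (1 - a) + 1) * M > 0" using M by (intro mult_pos_pos add_nonneg_pos) auto
    fix t :: real assume t: "t > 0"
    define T where "T = exp (- complex_of_real t)"
    have T: "norm T \<le> 1" using t norm_exp_minus_of_real[of t] by (simp add: T_def)
    have "1 - T = of_real (1 - exp (- t))" by (simp add: T_def flip: exp_of_real)
    hence nT: "norm (1 - T) = 1 - exp (- t)" using one_minus_exp_pos[OF t] by (simp only: norm_of_real)
    have "kernel_primitive a b Y X (of_real t) = (1 - a) * beta_weight (b - 2 * a + 1) a t * (1 - T) * g T"
      unfolding kernel_primitive_def g_def T_def[symmetric] beta_weight_conv_Ln[OF t] by simp
    hence "norm (kernel_primitive a b Y X (of_real t)) =
       norm (1 - a) * (exp (- Re (b - 2 * a + 1) * t) * ((1 - exp (- t)) powr (Re a - 1) * (1 - exp (- t)))) * norm (g T)"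
      by (simp add: norm_mult norm_beta_weight[OF t] nT)
    also have "(1 - exp (- t)) powr (Re a - 1) * (1 - exp (- t)) = (1 - exp (- t)) powr Re a"
      using t by (simp add: powr_diff)
    also have "norm (1 - a) * (exp (- Re (b - 2 * a + 1) * t) * (1 - exp (- t)) powr Re a) * norm (g T)
      \<le> (norm (1 - a) + 1) * (exp (- Re (b - 2 * a + 1) * t) * (1 - exp (- t)) powr Re a) * M"
      using M(2)[OF T] by (intro mult_mono) auto
    finally show "norm (kernel_primitive a b Y X (of_real t))
     \<le> (norm (1 - a) + 1) * M * (exp (- Re (b - 2 * a + 1) * t) * (1 - exp (- t)) powr Re a)"
      by (simp add: mult_ac)
  qed
qed

section \<open>The integral as a solution of the transformed hypergeometric equation\<close>

definition kernel_integrand :: "complex \<Rightarrow> complex \<Rightarrow> complex \<Rightarrow> complex \<Rightarrow> real \<Rightarrow> complex" where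
  "kernel_integrand a b Y X t = beta_weight (b - 2 * a + 1) a t * product_kernel a b Y X (exp (- of_real t))"

context
  fixes a b c Y :: complex
  assumes a: "Re a > 0" and ab: "Re (b - 2 * a) > -1" and c: "c = b - a + 1"
    and Y: "norm Y < 1"
begin

lemma locally_dominated_kernel_integrand:
  "locally_dominated half_line (ball 0 1) (kernel_integrand a b Y)"
  unfolding kernel_integrand_def
  by (rule locally_dominated_product_kernel) (use a ab Y in auto)

lemma kernel_integral_ode:
  assumes X: "norm X < 1"
  defines "I \<equiv> \<lambda>X. integral\<^sup>L half_line (kernel_integrand a b Y X)"
  shows "hyp_op (1 - a) (b - 2 * a + 1) c X (I X) (deriv I X) (deriv (deriv I) X) = 0"
proof -
  note ld = locally_dominated_kernel_integrand
  note ld1 = locally_dominated_deriv[OF ld open_ball]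
  note ld2 = locally_dominated_deriv[OF ld1 open_ball]
  have XB: "X \<in> ball 0 1" using X by simp
  define h where "h t = hyp_op (1 - a) (b - 2 * a + 1) c X (kernel_integrand a b Y X t)
      (deriv (\<lambda>X. kernel_integrand a b Y X t) X) (deriv (deriv (\<lambda>X. kernel_integrand a b Y X t)) X)" for t
  have int: "integrable half_line (kernel_integrand a b Y X)" "integrable half_line (\<lambda>t. deriv (\<lambda>X. kernel_integrand a b Y X t) X)"
    "integrable half_line (\<lambda>t. deriv (deriv (\<lambda>X. kernel_integrand a b Y X t)) X)"
    using ld ld1 ld2 XB by (auto intro: locally_dominated_integrable)
  have "hyp_op (1 - a) (b - 2 * a + 1) c X (I X) (deriv I X) (deriv (deriv I) X) = integral\<^sup>L half_line h"
    unfolding I_def deriv_integral[OF ld open_ball XB] deriv_deriv_integral[OF ld open_ball XB] h_def hyp_op_def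
    using int by simp
  have inth: "integrable half_line h"
    unfolding h_def hyp_op_def using int by simp
  define P where "P z = kernel_primitive a b Y X z" for z
  have dP: "(P has_field_derivative h t) (at (of_real t))" if "t > 0" for t
  proof -
    define T where "T = exp (- complex_of_real t)"
    define w where "w = beta_weight (b - 2 * a + 1) a t"
    have T: "norm T \<le> 1" using norm_exp_minus_of_real[of t] that by (simp add: T_def)
    have hol: "(\<lambda>X. product_kernel a b Y X T) holomorphic_on ball 0 1"
      by (rule product_kernel_holomorphic[OF Y T])
    have e1: "deriv (\<lambda>X. w * product_kernel a b Y X T) x = w * deriv (\<lambda>X. product_kernel a b Y X T) x" if "x \<in> ball 0 1" for x
      using hol that by (intro deriv_cmult holomorphic_on_imp_differentiable_at[OF hol]) auto
    have "deriv (deriv (\<lambda>X. w * product_kernel a b Y X T)) X = deriv (\<lambda>x. w * deriv (\<lambda>X. product_kernel a b Y X T) x) X"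
      by (intro deriv_cong_ev eventually_mono[OF eventually_nhds_in_open[OF open_ball XB]] e1) auto
    also have "\<dots> = w * deriv (deriv (\<lambda>X. product_kernel a b Y X T)) X"
      using XB by (intro deriv_cmult holomorphic_on_imp_differentiable_at[OF holomorphic_deriv[OF hol]]) auto
    finally have e2: "deriv (deriv (\<lambda>X. w * product_kernel a b Y X T)) X = w * deriv (deriv (\<lambda>X. product_kernel a b Y X T)) X" .
    have "h t = w * hyp_op (1 - a) (b - 2 * a + 1) (b - a + 1) X (product_kernel a b Y X T)
        (deriv (\<lambda>X. product_kernel a b Y X T) X) (deriv (deriv (\<lambda>X. product_kernel a b Y X T)) X)"
      unfolding h_def kernel_integrand_def T_def[symmetric] w_def[symmetric] e2 e1[OF XB] c
      by (simp add: hyp_op_def algebra_simps)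
    thus ?thesis
      using kernel_primitive_deriv[OF Y X, of "of_real t" a b] that
      unfolding P_def w_def T_def beta_weight_conv_Ln[OF that] by simp
  qed
  have holP: "P holomorphic_on {z. Re z > 0}"
    using kernel_primitive_deriv[OF Y X, of _ a b] unfolding P_def
    by (subst holomorphic_on_open) (auto simp: open_halfspace_Re_gt)
  have "0 = integral\<^sup>L half_line h"
  proof -
    from kernel_primitive_bound[OF Y X, of a b] obtain M where
      M: "\<And>t. t > 0 \<Longrightarrow> norm (P (of_real t)) \<le> M * (exp (- Re (b - 2 * a + 1) * t) * (1 - exp (- t)) powr Re a)"
      unfolding P_def by metis
    have eins: "einterval 0 \<infinity> = {0<..}" by (auto simp: einterval_def zero_ereal_def)
    have "(LBINT t=0..\<infinity>. h t) = 0 - 0"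
    proof (rule interval_integral_FTC_integrable[where F = "\<lambda>t. P (of_real t)"])
      fix t :: real assume "0 < ereal t"
      hence t: "t > 0" by (simp add: zero_ereal_def)
      show "((\<lambda>t. P (of_real t)) has_vector_derivative h t) (at t)"
        by (rule has_vector_derivative_real_field[OF dP[OF t]])
      \<comment> \<open>The fundamental theorem asks for a continuous integrand; the continuity of
        \<open>h\<close> is that of the derivative of the holomorphic \<open>P\<close>.\<close>
      have "continuous_on {z. Re z > 0} (deriv P)"
        using holP open_halfspace_Re_gt holomorphic_deriv holomorphic_on_imp_continuous_on by blast
      hence "continuous_on {0<..} (\<lambda>t. deriv P (of_real t))"
        by (rule continuous_on_compose2) (auto intro!: continuous_intros)
      hence "continuous_on {0<..} h"
        by (rule continuous_on_eq) (auto intro!: DERIV_imp_deriv dP)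
      thus "isCont h t" using t by (simp add: continuous_on_eq_continuous_at)
    next
      show "set_integrable lborel (einterval 0 \<infinity>) h"
        using inth by (simp add: eins integrable_half_line_iff)
      define \<sigma> where "\<sigma> = Re (b - 2 * a + 1)"
      define \<rho> where "\<rho> = Re a"
      have \<sigma>: "\<sigma> > 0" and \<rho>: "\<rho> > 0" using a ab by (auto simp: \<sigma>_def \<rho>_def)
      have "((\<lambda>t. M * (exp (- \<sigma> * t) * (1 - exp (- t)) powr \<rho>)) \<longlongrightarrow> M * (exp (- \<sigma> * 0) * 0)) (at_right 0)"
        using \<rho> by (intro tendsto_intros tendsto_zero_powrI[where b = \<rho>])
           (auto intro!: tendsto_eq_intros eventually_at_right_less[of 0, THEN eventually_mono])
      hence "((\<lambda>t. P (of_real t)) \<longlongrightarrow> 0) (at_right 0)"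
        by (intro Lim_null_comparison[of "\<lambda>t. P (of_real t)" "\<lambda>t. M * (exp (- \<sigma> * t) * (1 - exp (- t)) powr \<rho>)"]
              eventually_mono[OF eventually_at_right_less[of 0]])
           (use M in \<open>auto simp: \<sigma>_def \<rho>_def\<close>)
      thus "(((\<lambda>t. P (of_real t)) \<circ> real_of_ereal) \<longlongrightarrow> 0) (at_right 0)"
        unfolding zero_ereal_def ereal_tendsto_simps .
      have "((\<lambda>t. exp (- \<sigma> * t)) \<longlongrightarrow> 0) at_top" using \<sigma> by real_asymp
      moreover have "((\<lambda>t. (1 - exp (- t)) powr \<rho>) \<longlongrightarrow> 1) at_top" using \<rho> by real_asymp
      ultimately have "((\<lambda>t. M * (exp (- \<sigma> * t) * (1 - exp (- t)) powr \<rho>)) \<longlongrightarrow> M * (0 * 1)) at_top"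
        by (intro tendsto_intros)
      hence "((\<lambda>t. P (of_real t)) \<longlongrightarrow> 0) at_top"
        by (intro Lim_null_comparison[of "\<lambda>t. P (of_real t)" "\<lambda>t. M * (exp (- \<sigma> * t) * (1 - exp (- t)) powr \<rho>)"]
              eventually_mono[OF eventually_gt_at_top[of 0]])
           (use M in \<open>auto simp: \<sigma>_def \<rho>_def\<close>)
      thus "(((\<lambda>t. P (of_real t)) \<circ> real_of_ereal) \<longlongrightarrow> 0) (at_left \<infinity>)"
        unfolding ereal_tendsto_simps .
    qed auto
    thus ?thesis by (simp add: integral_half_line interval_lebesgue_integral_def eins)
  qed
  thus ?thesis using \<open>hyp_op _ _ _ _ _ _ _ = integral\<^sup>L half_line h\<close> by simp
qed

end

text \<open>Uniqueness is applied twice: to \<open>(1 - x) powr (2 * a - 1)\<close> times the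
  series, which yields Euler's transformation as \<open>rGamma c\<close> is nonzero, and to
  \<open>I\<close>.\<close>

lemma euler_hyp_unique:
  assumes I: "I holomorphic_on ball 0 1" and c: "c = b - a + 1" "c \<notin> \<int>\<^sub>\<le>\<^sub>0"
    and ode: "\<And>x. norm x < 1 \<Longrightarrow> hyp_op (1 - a) (b - 2 * a + 1) c x (I x) (deriv I x) (deriv (deriv I) x) = 0"
    and x: "norm x < 1"
  shows "I x * rGamma c = I 0 * ((1 - x) powr (2 * a - 1) * hyp2F1_reg a b c x)"
proof -
  define g where "g = (\<lambda>x. (1 - x) powr (2 * a - 1) * hyp2F1_reg a b c x)"
  have hg: "g holomorphic_on ball 0 1"
    unfolding g_def by (intro holomorphic_intros holomorphic_hyp2F1_reg) (auto intro!: one_minus_not_nonpos_Reals)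
  have "g x * rGamma c = g 0 * hyp2F1_reg (1 - a) (b - 2 * a + 1) c x"
    by (rule hyp_ode_unique[OF hg]) (use x c hyp2F1_reg_euler_ode[of _ c b a] in \<open>auto simp: g_def\<close>)
  hence "hyp2F1_reg (1 - a) (b - 2 * a + 1) c x = g x"
    using c by (simp add: g_def rGamma_eq_zero_iff)
  moreover have "I x * rGamma c = I 0 * hyp2F1_reg (1 - a) (b - 2 * a + 1) c x"
    by (rule hyp_ode_unique[OF I]) (use x c ode in auto)
  ultimately show ?thesis by (simp add: g_def)
qed

theorem hyp2F1_reg_product:
  assumes a: "Re a > 0" and ab: "Re (b - 2 * a) > -1" and c: "c = b - a + 1"
    and X: "norm X < 1" and Y: "norm Y < 1"
  shows "integrable half_line (\<lambda>t. beta_weight (b - 2 * a + 1) a t * product_kernel a b Y X (exp (- of_real t)))"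
    and "integral\<^sup>L half_line (\<lambda>t. beta_weight (b - 2 * a + 1) a t * product_kernel a b Y X (exp (- of_real t))) =
     Gamma (b - 2 * a + 1) * Gamma a *
       ((1 - X) powr (2 * a - 1) * hyp2F1_reg a b c X) * ((1 - Y) powr (2 * a - 1) * hyp2F1_reg a b c Y)"
proof -
  define I where "I Y X = integral\<^sup>L half_line (kernel_integrand a b Y X)" for Y X
  define g where "g = (\<lambda>x. (1 - x) powr (2 * a - 1) * hyp2F1_reg a b c x)"
  have "Re c > 0" using a ab by (simp add: c)
  hence c0: "c \<notin> \<int>\<^sub>\<le>\<^sub>0" by (rule Re_pos_not_nonpos_Ints)
  have ki: "kernel_integrand a b Y X = (\<lambda>t. beta_weight (b - 2 * a + 1) a t * product_kernel a b Y X (exp (- of_real t)))" for X Y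
    by (rule ext) (simp add: kernel_integrand_def)
  show "integrable half_line (\<lambda>t. beta_weight (b - 2 * a + 1) a t * product_kernel a b Y X (exp (- of_real t)))"
    using locally_dominated_integrable[OF locally_dominated_kernel_integrand[OF a ab c Y], of X] X by (simp add: ki)
  have step: "I Y X * rGamma c = I Y 0 * g X" if "norm X < 1" "norm Y < 1" for X Y
    unfolding g_def
  proof (rule euler_hyp_unique)
    show "I Y holomorphic_on ball 0 1"
      unfolding I_def
      by (rule holomorphic_on_integral[OF locally_dominated_kernel_integrand[OF a ab c that(2)] open_ball])
  qed (use c c0 kernel_integral_ode[OF a ab c, of Y] that in \<open>auto simp: I_def\<close>)
  have sym: "I Y X = I X Y" for X Y
    unfolding I_def ki product_kernel_def by (simp add: mult_ac add_ac)
  have "I 0 0 = integral\<^sup>L half_line (\<lambda>t. beta_weight (b - 2 * a + 1) a t * rGamma c)"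
    unfolding I_def ki product_kernel_def by (simp add: c)
  also have "\<dots> = Gamma (b - 2 * a + 1) * Gamma a * rGamma (b - 2 * a + 1 + a) * rGamma c"
    by (subst integral_mult_left_zero, subst Beta_exp_integral) (use a ab in auto)
  also have "b - 2 * a + 1 + a = c" by (simp add: c)
  finally have I0: "I 0 0 = Gamma (b - 2 * a + 1) * Gamma a * rGamma c * rGamma c" .
  \<comment> \<open>Uniqueness in \<open>X\<close> reduces to \<open>I Y 0\<close>, which by
    symmetry is \<open>I 0 Y\<close> and falls to the same argument. Each use costs a factor
    \<open>rGamma c\<close>; they cancel against those of \<open>I 0 0\<close>, of which one stems
    from the beta integral and one from the value of the series at 0.\<close>
  have "I Y X * rGamma c * rGamma c = (I 0 Y * rGamma c) * g X"
    using step[OF X Y] sym[of Y 0] by (simp add: mult_ac)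
  also have "\<dots> = I 0 0 * g Y * g X" using step[OF Y, of 0] by simp
  also have "\<dots> = (Gamma (b - 2 * a + 1) * Gamma a * g X * g Y) * rGamma c * rGamma c"
    by (simp add: I0 mult_ac)
  finally have "I Y X = Gamma (b - 2 * a + 1) * Gamma a * g X * g Y"
    using c0 by (simp add: rGamma_eq_zero_iff)
  thus "integral\<^sup>L half_line (\<lambda>t. beta_weight (b - 2 * a + 1) a t * product_kernel a b Y X (exp (- of_real t))) =
     Gamma (b - 2 * a + 1) * Gamma a *
       ((1 - X) powr (2 * a - 1) * hyp2F1_reg a b c X) * ((1 - Y) powr (2 * a - 1) * hyp2F1_reg a b c Y)"
    unfolding I_def ki g_def .
qed

subsection \<open>The slit plane and the half strip\<close>

text \<open>
  The logarithm of \<open>2 sinh c\<close> on the half plane \<open>Re c > 0\<close> that is real for real \<open>c\<close>.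
\<close>

definition lsinh2 :: "complex \<Rightarrow> complex" where
  "lsinh2 c = c + Ln (1 - exp (- 2 * c))"

definition half_strip :: "complex set" where
  "half_strip = {c. Re c > 0 \<and> \<bar>Im c\<bar> < pi}"

lemma norm_exp_minus2_less_1: "Re c > 0 \<Longrightarrow> norm (exp (- 2 * c)) < 1"
  by (simp add: norm_exp_eq_Re)

lemma one_minus_exp_not_nonpos_Reals: "Re c > 0 \<Longrightarrow> 1 - exp (- 2 * c) \<notin> \<real>\<^sub>\<le>\<^sub>0"
  by (intro one_minus_not_nonpos_Reals norm_exp_minus2_less_1)

lemma Re_pos_nonzero: "Re z > 0 \<Longrightarrow> z \<noteq> 0"
  by auto

lemma exp_lsinh2:
  assumes "Re c > 0"
  shows "exp (lsinh2 c) = 2 * sinh c"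
proof -
  have "exp (Ln (1 - exp (- 2 * c))) = 1 - exp (- 2 * c)"
    using one_minus_exp_not_nonpos_Reals[OF assms] by (intro exp_Ln) auto
  hence "exp (lsinh2 c) = exp c * (1 - exp (- 2 * c))"
    by (simp only: lsinh2_def exp_add)
  also have "\<dots> = exp c - exp c * exp (- 2 * c)" by (simp add: right_diff_distrib)
  also have "exp c * exp (- 2 * c) = exp (- c)" by (simp add: mult_exp_exp)
  also have "exp c - exp (- c) = 2 * sinh c" by (simp add: sinh_field_def)
  finally show ?thesis .
qed

lemma holomorphic_lsinh2: "lsinh2 holomorphic_on {c. Re c > 0}"
  unfolding lsinh2_def using one_minus_exp_not_nonpos_Reals by (intro holomorphic_intros) auto

lemma Re_sinh_pos:
  assumes "Re h > 0" "\<bar>Im h\<bar> < pi / 2"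
  shows "Re (sinh h) > 0"
proof -
  have "Re (sinh h) = cos (Im h) * sinh (Re h)"
    by (simp add: sinh_field_def Re_exp field_simps)
  thus ?thesis using assms cos_gt_zero_pi[of "Im h"] by (simp add: abs_less_iff)
qed

lemma Re_cosh_pos:
  assumes "Re h > 0" "\<bar>Im h\<bar> < pi / 2"
  shows "Re (cosh h) > 0"
proof -
  have "Re (cosh h) = cos (Im h) * cosh (Re h)"
    by (simp add: cosh_field_def Re_exp field_simps)
  thus ?thesis using assms cos_gt_zero_pi[of "Im h"] by (simp add: abs_less_iff cosh_real_pos)
qed

lemma Im_Ln_bound: "Re z > 0 \<Longrightarrow> \<bar>Im (Ln z)\<bar> < pi / 2"
  using Re_Ln_pos_lt[of z] by fastforce

text \<open>In this narrower strip \<open>lsinh2\<close> is the principal logarithm: both summands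
  have imaginary part below \<open>pi / 2\<close> in absolute value.\<close>

lemma Ln_2_sinh:
  assumes "Re h > 0" "\<bar>Im h\<bar> < pi / 2"
  shows "Ln (2 * sinh h) = h + Ln (1 - exp (- 2 * h))"
proof (rule Ln_unique)
  show "exp (h + Ln (1 - exp (- 2 * h))) = 2 * sinh h"
    using exp_lsinh2[OF assms(1)] by (simp only: lsinh2_def)
  have "\<bar>Im (Ln (1 - exp (- 2 * h)))\<bar> < pi / 2"
    by (intro Im_Ln_bound Re_one_minus_pos norm_exp_minus2_less_1 assms)
  thus "- pi < Im (h + Ln (1 - exp (- 2 * h)))" "Im (h + Ln (1 - exp (- 2 * h))) \<le> pi"
    using assms(2) by (simp_all add: abs_less_iff)
qed

lemma Ln_2_cosh:
  assumes "Re h > 0" "\<bar>Im h\<bar> < pi / 2"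
  shows "Ln (2 * cosh h) = h + Ln (1 + exp (- 2 * h))"
proof (rule Ln_unique)
  have R: "Re (1 + exp (- 2 * h)) > 0"
    by (intro Re_one_plus_pos norm_exp_minus2_less_1 assms)
  hence "exp (Ln (1 + exp (- 2 * h))) = 1 + exp (- 2 * h)" by (intro exp_Ln Re_pos_nonzero)
  hence "exp (h + Ln (1 + exp (- 2 * h))) = exp h * (1 + exp (- 2 * h))" by (simp only: exp_add)
  also have "\<dots> = exp h + exp h * exp (- 2 * h)" by (simp add: distrib_left)
  also have "exp h * exp (- 2 * h) = exp (- h)" by (simp add: mult_exp_exp)
  finally show "exp (h + Ln (1 + exp (- 2 * h))) = 2 * cosh h" by (simp add: cosh_field_def)
  have "\<bar>Im (Ln (1 + exp (- 2 * h)))\<bar> < pi / 2"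
    by (intro Im_Ln_bound R)
  thus "- pi < Im (h + Ln (1 + exp (- 2 * h)))" "Im (h + Ln (1 + exp (- 2 * h))) \<le> pi"
    using assms(2) by (simp_all add: abs_less_iff)
qed

lemma Ln_square_half:
  assumes "Re w > 0"
  shows "Ln ((2 * w)^2 / 2) = 2 * Ln (2 * w) - of_real (ln 2)"
proof (rule Ln_unique)
  have "w \<noteq> 0" using assms by auto
  have "exp (2 * Ln (2 * w)) = (exp (Ln (2 * w)))^2" by (simp add: exp_double)
  thus "exp (2 * Ln (2 * w) - of_real (ln 2)) = (2 * w)^2 / 2"
    using \<open>w \<noteq> 0\<close> by (simp add: exp_diff exp_of_real)
  have "\<bar>Im (Ln (2 * w))\<bar> < pi / 2" by (rule Im_Ln_bound) (use assms in simp)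
  thus "- pi < Im (2 * Ln (2 * w) - of_real (ln 2))" "Im (2 * Ln (2 * w) - of_real (ln 2)) \<le> pi"
    by (simp_all add: abs_less_iff)
qed

lemma Ln_one_minus_square:
  assumes "norm x < 1"
  shows "Ln (1 - x^2) = Ln (1 - x) + Ln (1 + x)"
proof (rule Ln_unique)
  note R = Re_one_minus_pos[OF assms] Re_one_plus_pos[OF assms]
  have "1 - x \<noteq> 0" "1 + x \<noteq> 0" using R[THEN Re_pos_nonzero] by auto
  thus "exp (Ln (1 - x) + Ln (1 + x)) = 1 - x^2"
    by (simp add: exp_add algebra_simps power2_eq_square)
  show "- pi < Im (Ln (1 - x) + Ln (1 + x))" "Im (Ln (1 - x) + Ln (1 + x)) \<le> pi"
    using R[THEN Im_Ln_bound] by (simp_all add: abs_less_iff)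
qed

text \<open>Passing to \<open>h = c / 2\<close> turns \<open>cosh c - 1\<close> and
  \<open>cosh c + 1\<close> into \<open>2 * (sinh h)^2\<close> and \<open>2 * (cosh h)^2\<close>. As
  \<open>\<bar>Im h\<bar> < pi / 2\<close>, both \<open>sinh h\<close> and \<open>cosh h\<close>
  have positive real part, so the logarithms of these squares are twice those of the bases, up to a
  constant.\<close>

lemma sqm1_powr_cosh:
  assumes "c \<in> half_strip"
  shows "sqm1_powr (cosh c) \<alpha> = exp (2 * \<alpha> * (lsinh2 c - of_real (ln 2)))"
proof -
  define h where "h = c / 2"
  have h: "Re h > 0" "\<bar>Im h\<bar> < pi / 2" using assms by (auto simp: h_def half_strip_def)
  have c: "c = 2 * h" by (simp add: h_def)
  have e: "cosh c - 1 = (2 * sinh h)^2 / 2" "cosh c + 1 = (2 * cosh h)^2 / 2"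
    using cosh_square_eq[of h] unfolding c cosh_double by (simp_all add: power_mult_distrib)
  have L: "Ln (cosh c - 1) = 2 * Ln (2 * sinh h) - of_real (ln 2)" "Ln (cosh c + 1) = 2 * Ln (2 * cosh h) - of_real (ln 2)"
    unfolding e by (intro Ln_square_half Re_sinh_pos Re_cosh_pos h)+
  have nz: "cosh c - 1 \<noteq> 0" "cosh c + 1 \<noteq> 0"
    using Re_sinh_pos[OF h] Re_cosh_pos[OF h] unfolding e by (auto dest: Re_pos_nonzero)
  have n: "norm (exp (- 2 * h)) < 1" by (rule norm_exp_minus2_less_1[OF h(1)])
  have "(exp (- 2 * h))^2 = exp (- 2 * c)" by (simp add: c flip: exp_double)
  hence sum: "Ln (1 - exp (- 2 * h)) + Ln (1 + exp (- 2 * h)) = Ln (1 - exp (- 2 * c))"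
    using Ln_one_minus_square[OF n] by simp
  have "Ln (cosh c - 1) + Ln (cosh c + 1) =
      2 * (h + Ln (1 - exp (- 2 * h))) - of_real (ln 2) + (2 * (h + Ln (1 + exp (- 2 * h))) - of_real (ln 2))"
    by (simp only: L Ln_2_sinh[OF h] Ln_2_cosh[OF h])
  also have "\<dots> = 2 * (2 * h + (Ln (1 - exp (- 2 * h)) + Ln (1 + exp (- 2 * h))) - of_real (ln 2))"
    by (simp add: algebra_simps)
  also have "\<dots> = 2 * (lsinh2 c - of_real (ln 2))"
    by (simp only: sum lsinh2_def flip: c)
  finally have "Ln (cosh c - 1) + Ln (cosh c + 1) = 2 * (lsinh2 c - of_real (ln 2))" .
  moreover have "sqm1_powr (cosh c) \<alpha> = exp (\<alpha> * (Ln (cosh c - 1) + Ln (cosh c + 1)))"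
    using nz by (simp add: sqm1_powr_def powr_def distrib_left exp_add)
  ultimately show ?thesis by (simp add: mult_ac)
qed

section \<open>Conformal equivalence of the half strip and the slit plane\<close>

lemma slit_plane_iff: "z \<in> slit_plane \<longleftrightarrow> z - 1 \<notin> \<real>\<^sub>\<le>\<^sub>0"
proof -
  have "z \<in> of_real ` {..1} \<longleftrightarrow> z - 1 \<in> \<real>\<^sub>\<le>\<^sub>0"
    by (auto simp: complex_nonpos_Reals_iff complex_eq_iff intro!: image_eqI[of _ _ "Re z"])
  thus ?thesis by (auto simp: slit_plane_def)
qed

lemma slit_plane_not_nonpos_Reals:
  assumes "z \<in> slit_plane"
  shows "z - 1 \<notin> \<real>\<^sub>\<le>\<^sub>0" "z \<notin> \<real>\<^sub>\<le>\<^sub>0" "z + 1 \<notin> \<real>\<^sub>\<le>\<^sub>0"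
  using assms unfolding slit_plane_iff by (auto simp: complex_nonpos_Reals_iff)

lemma cosh_in_slit_plane:
  assumes "c \<in> half_strip"
  shows "cosh c \<in> slit_plane"
proof (rule ccontr)
  assume "cosh c \<notin> slit_plane"
  hence 1: "Im (cosh c) = 0" "Re (cosh c) \<le> 1" by (auto simp: slit_plane_iff complex_nonpos_Reals_iff)
  have R: "Re (cosh c) = cos (Im c) * cosh (Re c)"
    by (simp add: cosh_field_def Re_exp field_simps)
  have I: "Im (cosh c) = sin (Im c) * sinh (Re c)"
    by (simp add: cosh_field_def sinh_field_def Im_exp field_simps)
  have c: "Re c > 0" "\<bar>Im c\<bar> < pi" using assms by (auto simp: half_strip_def)
  hence "sin (Im c) = 0" using 1 I by auto
  hence "Im c = 0" using c(2) sin_eq_0_pi[of "Im c"] by (auto simp: abs_less_iff)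
  hence "cosh (Re c) \<le> 1" using 1 R by simp
  moreover have "cosh (Re c) > 1" using c(1) cosh_real_strict_mono[of 0 "Re c"] by simp
  ultimately show False by simp
qed

lemma arcosh_slit_cosh:
  assumes "c \<in> half_strip"
  shows "arcosh_slit (cosh c) = c"
proof -
  have c: "Re c > 0" "\<bar>Im c\<bar> < pi" using assms by (auto simp: half_strip_def)
  have "sqm1_powr (cosh c) (1 / 2) = exp (lsinh2 c) / 2"
    unfolding sqm1_powr_cosh[OF assms] by (simp add: exp_diff exp_of_real)
  also have "\<dots> = sinh c" by (simp add: exp_lsinh2[OF c(1)])
  finally have "arcosh_slit (cosh c) = Ln (exp c)" by (simp add: arcosh_slit_def cosh_plus_sinh)
  thus ?thesis using c by simp
qed

text \<open>The point \<open>z\<close> avoids the images under \<open>cosh\<close> of the lines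
  \<open>Re c = 0\<close> and \<open>Im c = pi\<close>, so \<open>arcosh_slit z\<close> or its
  negative lies in the strip. The sign needs no separate argument, since \<open>arcosh_slit\<close>
  inverts \<open>cosh\<close> on the strip.\<close>

lemma arcosh_slit_in_half_strip:
  assumes "z \<in> slit_plane"
  shows "arcosh_slit z \<in> half_strip"
proof -
  define c where "c = arcosh_slit z"
  have z: "cosh c = z" by (simp add: c_def cosh_arcosh_slit)
  have "c = Ln (exp c)" unfolding c_def exp_arcosh_slit by (simp add: arcosh_slit_def)
  hence Im: "Im c \<le> pi" "- pi < Im c" using Im_Ln_le_pi mpi_less_Im_Ln by (metis exp_not_eq_zero)+
  have R: "Re z = cos (Im c) * cosh (Re c)"
    unfolding z[symmetric] by (simp add: cosh_field_def Re_exp field_simps)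
  have I: "Im z = sin (Im c) * sinh (Re c)"
    unfolding z[symmetric] by (simp add: cosh_field_def sinh_field_def Im_exp field_simps)
  have nz: "Im z \<noteq> 0 \<or> Re z > 1" using assms by (auto simp: slit_plane_iff complex_nonpos_Reals_iff)
  have "Re c \<noteq> 0"
  proof
    assume "Re c = 0"
    hence "Im z = 0" "Re z = cos (Im c)" using R I by auto
    thus False using nz cos_le_one[of "Im c"] by simp
  qed
  have "Im c \<noteq> pi"
  proof
    assume "Im c = pi"
    hence "Im z = 0" "Re z = - cosh (Re c)" using R I by auto
    thus False using nz cosh_real_pos[of "Re c"] by simp
  qed
  have "\<exists>d\<in>half_strip. cosh d = z"
  proof (cases "Re c > 0")
    case True
    thus ?thesis using Im \<open>Im c \<noteq> pi\<close> z by (intro bexI[of _ c]) (auto simp: half_strip_def)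
  next
    case False
    thus ?thesis using Im \<open>Im c \<noteq> pi\<close> z \<open>Re c \<noteq> 0\<close> by (intro bexI[of _ "- c"]) (auto simp: half_strip_def)
  qed
  thus ?thesis using arcosh_slit_cosh by auto
qed

lemma slit_plane_eq_image: "slit_plane = cosh ` half_strip"
  using cosh_in_slit_plane arcosh_slit_in_half_strip cosh_arcosh_slit
  by (auto intro!: image_eqI[of _ cosh "arcosh_slit _"])

lemma half_strip_eq: "half_strip = {c. Re c > 0} \<inter> {c. Im c < pi} \<inter> {c. Im c > - pi}"
  by (auto simp: half_strip_def)

lemma open_half_strip: "open half_strip"
  unfolding half_strip_eq by (intro open_Int open_halfspace_Re_gt open_halfspace_Im_lt open_halfspace_Im_gt)

lemma connected_half_strip: "connected half_strip"
  unfolding half_strip_eq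
  by (intro convex_connected convex_Int convex_halfspace_Re_gt convex_halfspace_Im_lt convex_halfspace_Im_gt)

lemma open_slit_plane: "open slit_plane"
proof -
  have "open ((\<lambda>z. z - 1 :: complex) -` (- \<real>\<^sub>\<le>\<^sub>0))"
    by (intro open_vimage continuous_intros) auto
  also have "(\<lambda>z. z - 1 :: complex) -` (- \<real>\<^sub>\<le>\<^sub>0) = slit_plane"
    by (auto simp: slit_plane_iff)
  finally show ?thesis .
qed

lemma connected_slit_plane: "connected slit_plane"
  unfolding slit_plane_eq_image
  by (intro connected_continuous_image connected_half_strip continuous_intros)

lemma holomorphic_sqm1_powr: "(\<lambda>z. sqm1_powr z \<alpha>) holomorphic_on slit_plane"
  unfolding sqm1_powr_def using slit_plane_not_nonpos_Reals by (intro holomorphic_intros) auto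

lemma holomorphic_arcosh_slit: "arcosh_slit holomorphic_on slit_plane"
proof -
  have "z + sqm1_powr z (1 / 2) \<notin> \<real>\<^sub>\<le>\<^sub>0" if "z \<in> slit_plane" for z
  proof
    assume "z + sqm1_powr z (1 / 2) \<in> \<real>\<^sub>\<le>\<^sub>0"
    hence "exp (arcosh_slit z) \<in> \<real>\<^sub>\<le>\<^sub>0" by (simp add: exp_arcosh_slit)
    moreover have "exp (arcosh_slit z) \<noteq> 0" by simp
    ultimately have "Im (Ln (exp (arcosh_slit z))) = pi"
      unfolding Im_Ln_eq_pi[OF \<open>exp (arcosh_slit z) \<noteq> 0\<close>]
      by (auto simp: complex_nonpos_Reals_iff less_le complex_eq_iff)
    thus False using arcosh_slit_in_half_strip[OF that] by (auto simp: half_strip_def)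
  qed
  thus ?thesis unfolding arcosh_slit_def
    by (intro holomorphic_intros holomorphic_sqm1_powr) auto
qed

subsection \<open>The Legendre function and its continuation\<close>

text \<open>
  The form of the function in the variable \<open>c\<close>, \<open>z = cosh c\<close>, that the quadratic transformation yields
  from the series in \<open>1 / z\<^sup>2\<close>; it is visibly holomorphic on \<open>Re c > 0\<close>.
\<close>

definition legendre_Q_cosh :: "complex \<Rightarrow> complex \<Rightarrow> complex \<Rightarrow> complex" where
  "legendre_Q_cosh \<nu> \<mu> c = of_real (sqrt pi) * exp (\<i> * of_real pi * \<mu>) * Gamma (\<nu> + \<mu> + 1)
     * exp (\<mu> * lsinh2 c - (\<nu> + \<mu> + 1) * c)
     * hyp2F1_reg (\<mu> + 1 / 2) (\<nu> + \<mu> + 1) (\<nu> + 3 / 2) (exp (- 2 * c))"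

lemma holomorphic_legendre_Q_cosh: "legendre_Q_cosh \<nu> \<mu> holomorphic_on {c. Re c > 0}"
proof -
  have "(\<lambda>c. hyp2F1_reg (\<mu> + 1 / 2) (\<nu> + \<mu> + 1) (\<nu> + 3 / 2) (exp (- 2 * c))) holomorphic_on {c. Re c > 0}"
    by (intro holomorphic_on_compose_gen[OF _ holomorphic_hyp2F1_reg, of "\<lambda>c. exp (- 2 * c)", unfolded comp_def])
       (auto intro!: holomorphic_intros norm_exp_minus2_less_1[simplified])
  thus ?thesis
    unfolding legendre_Q_cosh_def by (intro holomorphic_intros holomorphic_lsinh2)
qed

text \<open>At real points all logarithms are real and no branch is in doubt. The condition
  \<open>x > 2\<close> puts \<open>exp (- 2 * x)\<close> within the radius of the quadratic
  transformation, whose argument \<open>4 * X / (1 + X)^2\<close> is exactly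
  \<open>1 / (cosh c)^2\<close>.\<close>

lemma legendre_Q_series_cosh_real:
  assumes \<nu>: "Re (\<nu> + 3 / 2) > 0" and x: "x > 2"
  shows "legendre_Q_series \<nu> \<mu> (cosh (complex_of_real x)) = legendre_Q_cosh \<nu> \<mu> (of_real x)"
proof -
  define c where "c = complex_of_real x"
  define X where "X = exp (- 2 * c)"
  define \<beta> where "\<beta> = \<nu> + \<mu> + 1"
  define l2 where "l2 = complex_of_real (ln 2)"
  define F where "F = hyp2F1_reg (\<beta> / 2) ((\<beta> + 1) / 2) (\<nu> + 3 / 2) (4 * X / (1 + X)^2)"
  \<comment> \<open>With \<open>2 * x > 4\<close> the quadratic Taylor bound gives more than 1 + 4 +
    8, which exceeds 10.\<close>
  have "x * x > 2 * 2" using x by (intro mult_strict_mono) auto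
  hence "exp (2 * x) > 10"
    using exp_lower_Taylor_quadratic[of "2 * x"] x by (simp add: power2_eq_square)
  moreover have "norm X = inverse (exp (2 * x))"
    by (simp add: X_def c_def norm_exp_eq_Re flip: exp_minus)
  ultimately have X: "norm X < 1 / 10" using less_imp_inverse_less[of 10 "exp (2 * x)"] by simp
  have c: "c \<in> half_strip" using x by (simp add: c_def half_strip_def)
  have Xr: "1 + X = of_real (1 + exp (- 2 * x))" by (simp add: X_def c_def flip: exp_of_real)
  have nz: "1 + X \<noteq> 0" unfolding Xr of_real_eq_0_iff by (smt (verit) exp_gt_zero)
  have cosh: "cosh c = exp c * (1 + X) / 2"
    by (simp add: cosh_field_def X_def distrib_left mult_exp_exp)
  have Ln: "Ln (cosh c) = c + Ln (1 + X) - l2"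
  proof (rule Ln_unique)
    show "exp (c + Ln (1 + X) - l2) = cosh c"
      using nz by (simp add: exp_diff exp_add l2_def exp_of_real cosh)
    have "Im (Ln (1 + X)) = 0" unfolding Xr by (subst Ln_of_real) (auto intro: add_pos_pos)
    thus "- pi < Im (c + Ln (1 + X) - l2)" "Im (c + Ln (1 + X) - l2) \<le> pi" by (simp_all add: c_def l2_def)
  qed
  have "cosh c \<noteq> 0" unfolding cosh using nz by simp
  hence z: "cosh c powr (\<nu> + \<mu> + 1) = exp (\<beta> * (c + Ln (1 + X) - l2))"
    by (simp add: powr_def Ln \<beta>_def)
  have two: "2 powr (\<nu> + 1) = exp ((\<nu> + 1) * l2)"
    using Ln_of_real[of 2] by (simp add: powr_def l2_def)
  have "1 / (cosh c)^2 = 4 * X / (1 + X)^2"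
  proof -
    have "(exp c)^2 * X = 1" by (simp add: X_def power2_eq_square mult_exp_exp)
    hence "4 * (1 + X)\<^sup>2 = 4 * X * ((exp c)\<^sup>2 * (1 + X)\<^sup>2)" by algebra
    hence "4 / ((exp c)\<^sup>2 * (1 + X)\<^sup>2) = 4 * X / (1 + X)\<^sup>2"
      using nz by (subst frac_eq_eq) auto
    thus ?thesis unfolding cosh by (simp add: power_mult_distrib power_divide)
  qed
  hence F: "hyp2F1_reg ((\<nu> + \<mu> + 1) / 2) ((\<nu> + \<mu> + 2) / 2) (\<nu> + 3 / 2) (1 / (cosh c)\<^sup>2) = F"
    by (simp add: F_def \<beta>_def add_ac)
  have "(1 + X) powr (- \<beta>) * F = hyp2F1_reg (\<mu> + 1 / 2) \<beta> (\<nu> + 3 / 2) X"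
    unfolding F_def by (rule hyp2F1_reg_quadratic[OF X]) (use \<nu> in \<open>auto simp: \<beta>_def intro!: Re_pos_not_nonpos_Ints\<close>)
  hence H: "exp (- \<beta> * Ln (1 + X)) * F = hyp2F1_reg (\<mu> + 1 / 2) \<beta> (\<nu> + 3 / 2) X"
    using nz by (simp add: powr_def)
  have sq: "sqm1_powr (cosh c) (\<mu> / 2) = exp (\<mu> * (lsinh2 c - l2))"
    unfolding sqm1_powr_cosh[OF c] l2_def by simp
  have "exp (\<mu> * (lsinh2 c - l2)) / (exp ((\<nu> + 1) * l2) * exp (\<beta> * (c + Ln (1 + X) - l2)))
         = exp (\<mu> * (lsinh2 c - l2) - ((\<nu> + 1) * l2 + \<beta> * (c + Ln (1 + X) - l2)))"
    by (simp only: exp_diff exp_add)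
  also have "\<mu> * (lsinh2 c - l2) - ((\<nu> + 1) * l2 + \<beta> * (c + Ln (1 + X) - l2)) =
      (\<mu> * lsinh2 c - \<beta> * c) + (- \<beta> * Ln (1 + X))"
    by (simp add: \<beta>_def algebra_simps)
  finally have E: "exp (\<mu> * (lsinh2 c - l2)) / (exp ((\<nu> + 1) * l2) * exp (\<beta> * (c + Ln (1 + X) - l2))) =
     exp (\<mu> * lsinh2 c - \<beta> * c) * exp (- \<beta> * Ln (1 + X))"
    by (simp only: exp_add)
  have "legendre_Q_series \<nu> \<mu> (cosh c) = of_real (sqrt pi) * exp (\<i> * of_real pi * \<mu>) * Gamma \<beta>
     * (exp (\<mu> * (lsinh2 c - l2)) / (exp ((\<nu> + 1) * l2) * exp (\<beta> * (c + Ln (1 + X) - l2)))) * F"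
    unfolding legendre_Q_series_def F sq two z by (simp add: \<beta>_def)
  also have "\<dots> = of_real (sqrt pi) * exp (\<i> * of_real pi * \<mu>) * Gamma \<beta> * exp (\<mu> * lsinh2 c - \<beta> * c)
     * (exp (- \<beta> * Ln (1 + X)) * F)"
    unfolding E by (simp only: mult.assoc)
  also have "\<dots> = legendre_Q_cosh \<nu> \<mu> c"
    unfolding H by (simp only: legendre_Q_cosh_def \<beta>_def X_def)
  finally show ?thesis unfolding c_def .
qed

lemma holomorphic_legendre_Q_series:
  "legendre_Q_series \<nu> \<mu> holomorphic_on slit_plane \<inter> {z. norm z > 1}"
proof -
  have "norm (1 / z\<^sup>2) < 1" if "norm z > 1" for z :: complex
    using that one_less_power[of "norm z" 2] by (simp add: norm_divide norm_power divide_less_eq)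
  hence "(\<lambda>z. hyp2F1_reg a b c (1 / z\<^sup>2)) holomorphic_on slit_plane \<inter> {z. norm z > 1}" for a b c
    by (intro holomorphic_on_compose_gen[OF _ holomorphic_hyp2F1_reg, of "\<lambda>z. 1 / z\<^sup>2", unfolded comp_def])
       (auto intro!: holomorphic_intros)
  moreover have "(\<lambda>z. sqm1_powr z (\<mu> / 2)) holomorphic_on slit_plane \<inter> {z. norm z > 1}"
    by (rule holomorphic_on_subset[OF holomorphic_sqm1_powr]) auto
  ultimately show ?thesis
    unfolding legendre_Q_series_def using slit_plane_not_nonpos_Reals
    by (intro holomorphic_intros) auto
qed

text \<open>The identity theorem is applied after pulling back by \<open>exp\<close>: the part of
  the slit plane outside the closed unit disc becomes the half strip, which is convex, so its
  connectedness is immediate.\<close>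

lemma legendre_Q_series_eq:
  assumes \<nu>: "Re (\<nu> + 3 / 2) > 0" and z: "z \<in> slit_plane" "norm z > 1"
  shows "legendre_Q_series \<nu> \<mu> z = legendre_Q_cosh \<nu> \<mu> (arcosh_slit z)"
proof -
  let ?D = "slit_plane \<inter> {z. norm z > 1}"
  let ?g = "\<lambda>z. legendre_Q_series \<nu> \<mu> z - legendre_Q_cosh \<nu> \<mu> (arcosh_slit z)"
  have "(\<lambda>z. legendre_Q_cosh \<nu> \<mu> (arcosh_slit z)) holomorphic_on slit_plane"
    using holomorphic_on_compose_gen[OF holomorphic_arcosh_slit holomorphic_legendre_Q_cosh, of \<nu> \<mu>]
      arcosh_slit_in_half_strip by (force simp: comp_def half_strip_def)
  hence g: "?g holomorphic_on ?D"
    using holomorphic_legendre_Q_series[of \<nu> \<mu>] by (intro holomorphic_on_diff) (auto intro: holomorphic_on_subset)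
  have D: "exp w \<in> ?D" if "w \<in> half_strip" for w
  proof -
    have "exp w \<notin> of_real ` {..1}"
    proof
      assume "exp w \<in> of_real ` {..1}"
      then obtain r where r: "exp w = of_real r" "r \<le> 1" by auto
      have "norm (exp w) > 1" using that by (simp add: half_strip_def norm_exp_eq_Re)
      hence "r < 0" using r by (simp add: norm_of_real)
      have "w = Ln (exp w)" using that by (simp add: half_strip_def abs_less_iff)
      hence "Im w = pi" using \<open>r < 0\<close> unfolding r by (simp add: Ln_of_real' Im_Ln_eq_pi)
      thus False using that by (simp add: half_strip_def)
    qed
    thus ?thesis using that by (simp add: slit_plane_def half_strip_def norm_exp_eq_Re)
  qed
  \<comment> \<open>For real \<open>w > W\<close> one has \<open>exp w > cosh 2\<close>, which is
    the range of the real case.\<close>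
  define W where "W = ln (cosh (2::real))"
  have "?g (exp (Ln z)) = 0"
  proof (rule analytic_continuation[of "\<lambda>w. ?g (exp w)" half_strip "of_real ` {W<..}" "of_real (W + 1)"])
    show "(\<lambda>w. ?g (exp w)) holomorphic_on half_strip"
      using D by (intro holomorphic_on_compose_gen[OF _ g, unfolded comp_def] holomorphic_on_exp) auto
    have W: "W > 0" using cosh_real_strict_mono[of 0 2] by (simp add: W_def)
    show "of_real ` {W<..} \<subseteq> half_strip" "complex_of_real (W + 1) \<in> half_strip"
      using W by (auto simp: half_strip_def)
    show "complex_of_real (W + 1) islimpt of_real ` {W<..}"
      unfolding islimpt_approachable
    proof (intro allI impI)
      fix e :: real assume "e > 0"
      thus "\<exists>x'\<in>of_real ` {W<..}. x' \<noteq> complex_of_real (W + 1) \<and> dist x' (of_real (W + 1)) < e"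
        by (intro bexI[OF _ imageI[of "W + 1 + e / 2"]]) (auto simp: dist_norm norm_divide)
    qed
    show "Ln z \<in> half_strip"
    proof -
      have "z \<notin> \<real>\<^sub>\<le>\<^sub>0" "z \<noteq> 0" using slit_plane_not_nonpos_Reals(2)[OF z(1)] z(2) by auto
      hence "\<bar>Im (Ln z)\<bar> < pi"
        using Im_Ln_less_pi[of z] mpi_less_Im_Ln[of z] by (simp add: abs_less_iff)
      moreover have "Re (Ln z) > 0" using z(2) \<open>z \<noteq> 0\<close> by simp
      ultimately show ?thesis by (simp add: half_strip_def)
    qed
    fix w assume "w \<in> complex_of_real ` {W<..}"
    then obtain r where r: "w = of_real r" "r > W" by auto
    \<comment> \<open>The absolute value secures \<open>x >= 0\<close> and is harmless because
      \<open>cosh\<close> is even.\<close>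
    define x where "x = \<bar>arcosh (exp r)\<bar>"
    have "cosh 2 = exp W" unfolding W_def by (rule exp_ln [symmetric]) (rule cosh_real_pos)
    hence er: "exp r > cosh 2" using r(2) by simp
    have "cosh (arcosh (exp r)) = exp r"
      using er cosh_real_ge_1[of 2] by (intro cosh_arcosh_real) linarith
    hence cx: "cosh x = exp r" by (simp add: x_def)
    have "x \<ge> 0" by (simp add: x_def)
    have x: "x > 2"
    proof (rule ccontr)
      assume "\<not> x > 2"
      hence "cosh x \<le> cosh 2" using \<open>x \<ge> 0\<close> by (intro cosh_real_nonneg_le_iff[THEN iffD2]) auto
      thus False using cx er by simp
    qed
    have "exp w = cosh (complex_of_real x)"
    proof -
      have "cosh (complex_of_real x) = of_real (cosh x)"
        by (simp add: cosh_field_def flip: exp_of_real)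
      thus ?thesis unfolding r using cx by (simp add: exp_of_real)
    qed
    moreover have "arcosh_slit (cosh (complex_of_real x)) = of_real x"
      using x by (intro arcosh_slit_cosh) (simp add: half_strip_def)
    ultimately show "?g (exp w) = 0"
      using legendre_Q_series_cosh_real[OF \<nu> x, of \<mu>] by simp
  qed (rule open_half_strip connected_half_strip)+
  moreover have "exp (Ln z) = z" using z by (intro exp_Ln) auto
  ultimately show ?thesis by simp
qed

text \<open>The right side is a witness that a continuation exists, and only then does the choice
  have its defining property; the identity theorem on the connected slit plane does the rest. The
  other two functions defined by choice are identified by the same scheme.\<close>

theorem legendre_Q_eq:
  assumes \<nu>: "Re (\<nu> + 3 / 2) > 0" and z: "z \<in> slit_plane"
  shows "legendre_Q \<nu> \<mu> z = legendre_Q_cosh \<nu> \<mu> (arcosh_slit z)"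
proof -
  let ?P = "\<lambda>f. f holomorphic_on slit_plane \<and> (\<forall>z\<in>slit_plane. norm z > 1 \<longrightarrow> f z = legendre_Q_series \<nu> \<mu> z)"
  let ?g = "\<lambda>z. legendre_Q_cosh \<nu> \<mu> (arcosh_slit z)"
  have g: "?g holomorphic_on slit_plane"
    using holomorphic_on_compose_gen[OF holomorphic_arcosh_slit holomorphic_legendre_Q_cosh, of \<nu> \<mu>]
      arcosh_slit_in_half_strip by (force simp: comp_def half_strip_def)
  hence "?P ?g" using legendre_Q_series_eq[OF \<nu>] by auto
  hence P: "?P (legendre_Q \<nu> \<mu>)" unfolding legendre_Q_def by (rule someI[of ?P])
  show ?thesis
  proof (rule analytic_continuation_open[of "slit_plane \<inter> {z. norm z > 1}" slit_plane "legendre_Q \<nu> \<mu>" ?g])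
    show "open (slit_plane \<inter> {z. norm z > 1})"
      by (intro open_Int open_slit_plane open_Collect_less continuous_intros)
    have "2 \<in> slit_plane \<inter> {z. norm z > 1}" by (auto simp: slit_plane_iff complex_nonpos_Reals_iff)
    thus "slit_plane \<inter> {z. norm z > 1} \<noteq> {}" by blast
    show "legendre_Q \<nu> \<mu> z = ?g z" if "z \<in> slit_plane \<inter> {z. norm z > 1}" for z
      using P that legendre_Q_series_eq[OF \<nu>, of z \<mu>] by auto
  qed (use P g z open_slit_plane connected_slit_plane in auto)
qed

section \<open>Continuation across the cut\<close>

lemma cosh_continuation_eq:
  assumes g: "g holomorphic_on {c. Re c > 0}" and eq: "\<And>c. c \<in> half_strip \<Longrightarrow> f (cosh c) = g c"
    and c: "Re c > 0"
  shows "cosh_continuation f c = g c"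
proof -
  let ?P = "\<lambda>g. g holomorphic_on {c. Re c > 0} \<and> (\<forall>c. Re c > 0 \<and> \<bar>Im c\<bar> < pi \<longrightarrow> g c = f (cosh c))"
  have "?P g" using g eq by (auto simp: half_strip_def)
  hence P: "?P (cosh_continuation f)" unfolding cosh_continuation_def by (rule someI[of ?P])
  show ?thesis
  proof (rule analytic_continuation_open[of half_strip "{c. Re c > 0}" "cosh_continuation f" g])
    have "1 \<in> half_strip" using pi_gt_zero by (simp add: half_strip_def)
    thus "half_strip \<noteq> {}" by blast
    show "half_strip \<subseteq> {c. Re c > 0}" by (auto simp: half_strip_def)
    show "cosh_continuation f c = g c" if "c \<in> half_strip" for c
      using P that eq[OF that] by (auto simp: half_strip_def)
  qed (use P g c open_half_strip in \<open>auto intro: open_halfspace_Re_gt convex_connected convex_halfspace_Re_gt\<close>)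
qed

lemma cosh_continuation_legendre_Q:
  assumes "Re (\<nu> + 3 / 2) > 0" "Re c > 0"
  shows "cosh_continuation (legendre_Q \<nu> \<mu>) c = legendre_Q_cosh \<nu> \<mu> c"
  by (rule cosh_continuation_eq[OF holomorphic_legendre_Q_cosh _ assms(2)])
     (simp add: legendre_Q_eq[OF assms(1)] cosh_in_slit_plane arcosh_slit_cosh)

lemma cosh_continuation_sqm1_powr:
  assumes "Re c > 0"
  shows "cosh_continuation (\<lambda>z. sqm1_powr z \<alpha>) c = exp (2 * \<alpha> * (lsinh2 c - of_real (ln 2)))"
  by (rule cosh_continuation_eq[OF _ _ assms]) (auto intro!: holomorphic_intros holomorphic_lsinh2 simp: sqm1_powr_cosh)

subsection \<open>The logarithm of the kernel\<close>

lemma cosh_minus_cosh: "cosh c - cosh d = 2 * sinh ((c + d) / 2) * sinh ((c - d) / 2)" for c d :: complex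
proof -
  define p q where "p = (c + d) / 2" and "q = (c - d) / 2"
  have "c = p + q" "d = p - q" by (simp_all add: p_def q_def field_simps)
  hence "cosh c - cosh d = 2 * sinh p * sinh q" by (simp add: cosh_add cosh_diff)
  thus ?thesis by (simp add: p_def q_def)
qed

text \<open>As a polynomial in \<open>cosh c\<close> the base is quadratic; completing the square
  gives \<open>(cosh c - cosh a * cosh b)^2 - (sinh a)^2 * (sinh b)^2\<close>, which factors by the
  addition theorem.\<close>

lemma kernel_base_cosh:
  assumes "cosh a \<noteq> 0" "cosh b \<noteq> 0"
  shows "kernel_base (cosh a) (cosh b) (cosh c) =
     (cosh c - cosh (a + b)) * (cosh c - cosh (a - b)) / (2 * cosh a * cosh b)"
proof -
  have "(cosh c - cosh (a + b)) * (cosh c - cosh (a - b)) =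
     (cosh c - cosh a * cosh b)\<^sup>2 - (sinh a)\<^sup>2 * (sinh b)\<^sup>2"
    by (simp add: cosh_add cosh_diff algebra_simps power2_eq_square)
  also have "\<dots> = (cosh a)\<^sup>2 + (cosh b)\<^sup>2 + (cosh c)\<^sup>2 - 1 - 2 * cosh a * cosh b * cosh c"
    unfolding sinh_square_eq by (simp add: algebra_simps power2_eq_square)
  finally show ?thesis using assms
    by (simp add: kernel_base_def diff_divide_distrib)
qed

text \<open>Each difference of hyperbolic cosines is half the product of two factors
  \<open>2 * sinh\<close>. Two such differences give 1/4, and the 2 in the denominator of the base
  turns this into 1/8, hence \<open>ln 8\<close>. The factor \<open>z1 * z2\<close> is kept
  apart.\<close>

definition kernel_log_sum :: "complex \<Rightarrow> complex \<Rightarrow> complex \<Rightarrow> complex" where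
  "kernel_log_sum a b c = lsinh2 ((c + (a + b)) / 2) + lsinh2 ((c - (a + b)) / 2)
     + lsinh2 ((c + (a - b)) / 2) + lsinh2 ((c - (a - b)) / 2) - of_real (ln 8)"

lemma kernel_args:
  assumes "Re a > 0" "Re b > 0" "Re c > Re (a + b)"
  shows "Re ((c + (a + b)) / 2) > 0" "Re ((c - (a + b)) / 2) > 0"
    "Re ((c + (a - b)) / 2) > 0" "Re ((c - (a - b)) / 2) > 0"
  using assms by auto

lemma exp_kernel_log_sum:
  assumes "Re a > 0" "Re b > 0" "Re c > Re (a + b)"
  shows "exp (kernel_log_sum a b c) = (cosh c - cosh (a + b)) * (cosh c - cosh (a - b)) / 2"
proof -
  have "exp (kernel_log_sum a b c) = exp (lsinh2 ((c + (a + b)) / 2)) * exp (lsinh2 ((c - (a + b)) / 2))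
     * exp (lsinh2 ((c + (a - b)) / 2)) * exp (lsinh2 ((c - (a - b)) / 2)) / 8"
    by (simp add: kernel_log_sum_def exp_add exp_diff exp_of_real)
  thus ?thesis
    unfolding cosh_minus_cosh[of c "a + b"] cosh_minus_cosh[of c "a - b"] kernel_args[OF assms, THEN exp_lsinh2]
    by simp
qed

lemma holomorphic_kernel_log_sum:
  assumes "Re a > 0" "Re b > 0"
  shows "kernel_log_sum a b holomorphic_on {c. Re c > Re (a + b)}"
proof -
  have *: "(\<lambda>c. lsinh2 (f c)) holomorphic_on {c. Re c > Re (a + b)}"
    if "f holomorphic_on {c. Re c > Re (a + b)}" "\<And>c. Re c > Re (a + b) \<Longrightarrow> Re (f c) > 0" for f
    using holomorphic_on_compose_gen[OF that(1) holomorphic_lsinh2] that(2) by (auto simp: comp_def)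
  show ?thesis unfolding kernel_log_sum_def
    by (intro holomorphic_on_add holomorphic_on_diff holomorphic_on_const *)
       (use assms in \<open>auto intro!: holomorphic_intros\<close>)
qed

lemma lsinh2_asymp: "((\<lambda>x. lsinh2 ((of_real x + d) / 2) - (of_real x + d) / 2) \<longlongrightarrow> 0) at_top"
proof -
  have "((\<lambda>x::real. exp (- (of_real x + d))) \<longlongrightarrow> 0) at_top"
  proof (rule tendsto_norm_zero_cancel)
    have "((\<lambda>x. exp (- (x + Re d))) \<longlongrightarrow> 0) at_top" by real_asymp
    thus "((\<lambda>x::real. norm (exp (- (of_real x + d)))) \<longlongrightarrow> 0) at_top"
      by (simp add: norm_exp_eq_Re)
  qed
  hence "((\<lambda>x::real. Ln (1 - exp (- (of_real x + d)))) \<longlongrightarrow> Ln (1 - 0)) at_top"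
    by (intro tendsto_intros) auto
  moreover have "- 2 * ((complex_of_real x + d) / 2) = - (of_real x + d)" for x by simp
  ultimately show ?thesis by (simp only: lsinh2_def add_diff_cancel_left' Ln_1 diff_zero)
qed

text \<open>The shifts by \<open>a + b\<close> and \<open>a - b\<close> cancel and the four halves
  add up to \<open>2 * x\<close>, while \<open>2 * ln (cosh x) - ln 2\<close> differs from
  \<open>2 * x - ln 8\<close> by a term that tends to 0.\<close>

lemma kernel_log_sum_asymp:
  "((\<lambda>x. kernel_log_sum a b (of_real x) - of_real (2 * ln (cosh x) - ln 2)) \<longlongrightarrow> 0) at_top"
proof -
  let ?d = "\<lambda>d x. lsinh2 ((complex_of_real x + d) / 2) - (of_real x + d) / 2"
  have "((\<lambda>x::real. 2 * x - ln 8 - (2 * ln (cosh x) - ln 2)) \<longlongrightarrow> 0) at_top"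
  proof -
    have "ln (8::real) = 3 * ln 2" using ln_realpow[of 2 3] by simp
    moreover have "ln (cosh x) = ln (exp x + exp (- x)) - ln 2" for x :: real
      unfolding cosh_field_def by (subst ln_divide_pos) (auto intro: add_pos_pos)
    ultimately have "2 * x - ln 8 - (2 * ln (cosh x) - ln 2) = 2 * x - 2 * ln (exp x + exp (- x))" for x :: real
      by simp
    moreover have "((\<lambda>x::real. 2 * x - 2 * ln (exp x + exp (- x))) \<longlongrightarrow> 0) at_top"
      by real_asymp
    ultimately show ?thesis by (simp only:)
  qed
  hence "((\<lambda>x. complex_of_real (2 * x - ln 8 - (2 * ln (cosh x) - ln 2))) \<longlongrightarrow> of_real 0) at_top"
    by (rule tendsto_of_real)
  hence "((\<lambda>x. ?d (a + b) x + ?d (- (a + b)) x + ?d (a - b) x + ?d (- (a - b)) x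
      + of_real (2 * x - ln 8 - (2 * ln (cosh x) - ln 2))) \<longlongrightarrow> 0 + 0 + 0 + 0 + of_real 0) at_top"
    by (intro tendsto_add lsinh2_asymp)
  moreover have "?d (a + b) x + ?d (- (a + b)) x + ?d (a - b) x + ?d (- (a - b)) x
      + of_real (2 * x - ln 8 - (2 * ln (cosh x) - ln 2)) =
      kernel_log_sum a b (of_real x) - of_real (2 * ln (cosh x) - ln 2)" for x
    by (simp add: kernel_log_sum_def field_simps)
  ultimately show ?thesis by (simp only: of_real_0 add_0_right)
qed

text \<open>Differentiating \<open>exp D = 1\<close> for the difference \<open>D\<close> of two
  logarithms shows that \<open>D\<close> is constant on the convex set; the limit along the real
  axis forces the constant to be 0.\<close>

lemma holomorphic_log_unique:
  assumes S: "open S" "convex S" and L: "L1 holomorphic_on S" "L2 holomorphic_on S"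
    and eq: "\<And>c. c \<in> S \<Longrightarrow> exp (L1 c) = exp (L2 c)"
    and lim: "((\<lambda>x. L1 (of_real x) - L2 (of_real x)) \<longlongrightarrow> 0) at_top"
    and ev: "\<forall>\<^sub>F x in at_top. complex_of_real x \<in> S" and c: "c \<in> S"
  shows "L1 c = L2 c"
proof -
  define D where "D c = L1 c - L2 c" for c
  have D: "D holomorphic_on S" unfolding D_def by (intro holomorphic_intros L)
  have e: "exp (D c) = 1" if "c \<in> S" for c using eq[OF that] by (simp add: D_def exp_diff)
  have "(D has_field_derivative 0) (at c within S)" if "c \<in> S" for c
  proof -
    have d: "(D has_field_derivative deriv D c) (at c)"
      using D S(1) that by (rule holomorphic_derivI)
    have "((\<lambda>c. exp (D c)) has_field_derivative exp (D c) * deriv D c) (at c)"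
      by (rule DERIV_chain2[OF DERIV_exp d])
    moreover have "((\<lambda>c. exp (D c)) has_field_derivative 0) (at c)"
      by (rule has_field_derivative_transform_within_open[of "\<lambda>_. 1", OF _ S(1) that]) (auto simp: e)
    ultimately have "exp (D c) * deriv D c = 0" by (rule DERIV_unique)
    thus ?thesis using d by (simp add: has_field_derivative_at_within)
  qed
  then obtain k where k: "\<And>c. c \<in> S \<Longrightarrow> D c = k"
    using has_field_derivative_zero_constant[OF S(2)] by blast
  have "((\<lambda>x::real. k) \<longlongrightarrow> 0) at_top"
    by (rule Lim_transform_eventually[OF lim]) (use ev in \<open>eventually_elim, use k in \<open>auto simp: D_def\<close>\<close>)
  hence "k = 0" by (simp add: tendsto_const_iff)
  thus ?thesis using k[OF c] by (simp add: D_def)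
qed

lemma slit_plane_nonzero: "z \<in> slit_plane \<Longrightarrow> z \<noteq> 0"
  using slit_plane_not_nonpos_Reals(2) by force

theorem kernel_log_eq:
  assumes z: "z1 \<in> slit_plane" "z2 \<in> slit_plane" and c: "Re c > Re (lower_limit z1 z2)"
  shows "kernel_log z1 z2 c = kernel_log_sum (arcosh_slit z1) (arcosh_slit z2) c - Ln (z1 * z2)"
proof -
  define a b where "a = arcosh_slit z1" and "b = arcosh_slit z2"
  have ab: "Re a > 0" "Re b > 0"
    using z[THEN arcosh_slit_in_half_strip] by (auto simp: a_def b_def half_strip_def)
  have zc: "cosh a = z1" "cosh b = z2" by (simp_all add: a_def b_def cosh_arcosh_slit)
  have ll: "lower_limit z1 z2 = a + b" by (simp add: lower_limit_def a_def b_def)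
  have nz: "z1 \<noteq> 0" "z2 \<noteq> 0" using z slit_plane_nonzero by auto
  let ?H = "{c. Re c > Re (a + b)}"
  let ?P = "\<lambda>L. L holomorphic_on {c. Re c > Re (lower_limit z1 z2)} \<and>
        (\<forall>c. Re c > Re (lower_limit z1 z2) \<longrightarrow> exp (L c) = kernel_base z1 z2 (cosh c)) \<and>
        ((\<lambda>x. L (of_real x) - (of_real (2 * ln (cosh x) - ln 2) - Ln (z1 * z2))) \<longlongrightarrow> 0) at_top"
  let ?M = "\<lambda>c. kernel_log_sum a b c - Ln (z1 * z2)"
  have M: "?M holomorphic_on ?H"
    by (intro holomorphic_intros holomorphic_kernel_log_sum ab)
  have eM: "exp (?M c) = kernel_base z1 z2 (cosh c)" if "Re c > Re (a + b)" for c
    using kernel_base_cosh[of a b c] nz unfolding zc exp_diff exp_kernel_log_sum[OF ab that]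
    by simp
  have lM: "((\<lambda>x. ?M (of_real x) - (of_real (2 * ln (cosh x) - ln 2) - Ln (z1 * z2))) \<longlongrightarrow> 0) at_top"
    using kernel_log_sum_asymp[of a b] by (simp add: algebra_simps)
  have "?P ?M" unfolding ll using M eM lM by blast
  hence P: "?P (kernel_log z1 z2)" unfolding kernel_log_def by (rule someI[of ?P])
  have "kernel_log z1 z2 c = ?M c"
  proof (rule holomorphic_log_unique[of ?H "kernel_log z1 z2" ?M])
    show "open ?H" "convex ?H" by (rule open_halfspace_Re_gt convex_halfspace_Re_gt)+
    show "exp (kernel_log z1 z2 c) = exp (?M c)" if "c \<in> ?H" for c
      using P eM[of c] that unfolding ll by simp
    show "((\<lambda>x. kernel_log z1 z2 (of_real x) - ?M (of_real x)) \<longlongrightarrow> 0) at_top"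
      using tendsto_diff[OF conjunct2[OF conjunct2[OF P]] lM] by (simp add: algebra_simps)
    show "\<forall>\<^sub>F x in at_top. complex_of_real x \<in> ?H"
      using eventually_gt_at_top[of "Re (a + b)"] by simp
  qed (use P M c in \<open>auto simp: ll\<close>)
  thus ?thesis by (simp add: a_def b_def)
qed

subsection \<open>The product formula for the Legendre function\<close>

lemma exp_minus2_add: "exp (- 2 * (a + of_real t / 2)) = exp (- 2 * a) * exp (- complex_of_real t)"
proof -
  have "- 2 * (a + of_real t / 2) = - 2 * a + - complex_of_real t" by simp
  thus ?thesis by (simp only: exp_add)
qed

lemma product_integrand_eq:
  fixes z1 z2 \<nu> \<mu> :: complex
  assumes z: "z1 \<in> slit_plane" "z2 \<in> slit_plane" and \<nu>: "Re (\<nu> + 3 / 2) > 0" and t: "t > 0"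
  defines "a \<equiv> arcosh_slit z1" and "b \<equiv> arcosh_slit z2"
  defines "c \<equiv> lower_limit z1 z2 + of_real t"
  shows "product_integrand \<nu> \<mu> z1 z2 c * sinh c =
     of_real (sqrt pi) * exp (\<i> * of_real pi * \<mu>) * Gamma (\<nu> + \<mu> + 1) / 2
     * exp (\<mu> * of_real (ln 2) - (\<mu> - 1 / 2) * (3 * of_real (ln 2) + Ln (z1 * z2)) - (\<nu> - \<mu> + 1) * (a + b))
     * (beta_weight (\<nu> - \<mu> + 1) (\<mu> + 1 / 2) t
         * product_kernel (\<mu> + 1 / 2) (\<nu> + \<mu> + 1) (exp (- 2 * b)) (exp (- 2 * a)) (exp (- of_real t)))"
proof -
  define K where "K = of_real (sqrt pi) * exp (\<i> * of_real pi * \<mu>) * Gamma (\<nu> + \<mu> + 1)"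
  define l2 where "l2 = complex_of_real (ln 2)"
  define T where "T = exp (- complex_of_real t)"
  define X Y where "X = exp (- 2 * a)" and "Y = exp (- 2 * b)"
  define f where "f = hyp2F1_reg (\<mu> + 1 / 2) (\<nu> + \<mu> + 1) (\<nu> + 3 / 2) (X * Y * T\<^sup>2)"
  define A where "A = Ln (1 - X * T) + Ln (1 - Y * T) + Ln (1 - X * Y * T)"
  have ab: "Re a > 0" "Re b > 0"
    using z[THEN arcosh_slit_in_half_strip] by (auto simp: a_def b_def half_strip_def)
  have c: "c = a + b + of_real t" by (simp add: c_def lower_limit_def a_def b_def)
  have Rc: "Re c > 0" "Re c > Re (lower_limit z1 z2)" using ab t by (simp_all add: c c_def[symmetric] lower_limit_def a_def[symmetric] b_def[symmetric])
  \<comment> \<open>Under \<open>exp (- 2 * _)\<close> the four half arguments of the kernel become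
    \<open>X * Y * T\<close>, \<open>T\<close>, \<open>X * T\<close> and \<open>Y * T\<close>; the
    factor with \<open>T\<close> alone joins the beta weight.\<close>
  have u: "exp (- 2 * c) = X * Y * T\<^sup>2"
    by (simp add: c X_def Y_def T_def power2_eq_square mult_exp_exp algebra_simps)
  have args: "(c + (a + b)) / 2 = (a + b) + of_real t / 2" "(c - (a + b)) / 2 = 0 + of_real t / 2"
    "(c + (a - b)) / 2 = a + of_real t / 2" "(c - (a - b)) / 2 = b + of_real t / 2"
    by (simp_all add: c field_simps)
  have XY: "exp (- 2 * (a + b)) = X * Y" by (simp add: X_def Y_def mult_exp_exp algebra_simps)
  have l8: "complex_of_real (ln 8) = 3 * l2"
    using ln_realpow[of 2 3] by (simp add: l2_def)
  have ls: "lsinh2 (d + of_real t / 2) = (d + of_real t / 2) + Ln (1 - exp (- 2 * d) * T)" for d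
    unfolding lsinh2_def exp_minus2_add T_def ..
  have ls': "lsinh2 (a + of_real t / 2) = (a + of_real t / 2) + Ln (1 - X * T)"
    "lsinh2 (b + of_real t / 2) = (b + of_real t / 2) + Ln (1 - Y * T)"
    "lsinh2 (a + b + of_real t / 2) = (a + b + of_real t / 2) + Ln (1 - X * Y * T)"
    "lsinh2 (0 + of_real t / 2) = (0 + of_real t / 2) + Ln (1 - T)"
    unfolding ls XY by (simp_all add: X_def Y_def)
  have "kernel_log_sum a b c = 2 * c + Ln (1 - T) + A - 3 * l2"
    unfolding kernel_log_sum_def args ls' l8 A_def
    by (simp add: c field_simps)
  hence kl: "kernel_log z1 z2 c = 2 * c + Ln (1 - T) + A - 3 * l2 - Ln (z1 * z2)"
    using kernel_log_eq[OF z Rc(2)] by (simp add: a_def b_def)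
  have Q: "cosh_continuation (legendre_Q \<nu> \<mu>) c = K * exp (\<mu> * lsinh2 c - (\<nu> + \<mu> + 1) * c) * f"
    unfolding cosh_continuation_legendre_Q[OF \<nu> Rc(1)] legendre_Q_cosh_def u K_def f_def ..
  have S: "cosh_continuation (\<lambda>z. sqm1_powr z (\<mu> / 2)) c = exp (\<mu> * (lsinh2 c - l2))"
    unfolding cosh_continuation_sqm1_powr[OF Rc(1)] l2_def by simp
  have "sinh c = (exp c - exp (- c)) / 2" by (rule sinh_field_def)
  also have "exp (- c) = exp c * (X * Y * T\<^sup>2)" unfolding u[symmetric] by (simp add: mult_exp_exp)
  finally have sh: "sinh c = exp c * (1 - X * Y * T\<^sup>2) / 2" by (simp add: algebra_simps)
  \<comment> \<open>The power of \<open>sinh c\<close> contained in the Legendre function cancels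
    against the denominator of the integrand, leaving only a power of 2.\<close>
  have E: "exp (\<mu> * lsinh2 c - (\<nu> + \<mu> + 1) * c) * exp ((\<mu> - 1 / 2) * kernel_log z1 z2 c) / exp (\<mu> * (lsinh2 c - l2)) * exp c
     = exp (\<mu> * l2 - (\<mu> - 1 / 2) * (3 * l2 + Ln (z1 * z2)) - (\<nu> - \<mu> + 1) * (a + b))
       * (exp (- (\<nu> - \<mu> + 1) * of_real t + (\<mu> + 1 / 2 - 1) * Ln (1 - T)) * exp ((\<mu> + 1 / 2 - 1) * A))"
  proof -
    have "\<mu> * lsinh2 c - (\<nu> + \<mu> + 1) * c + (\<mu> - 1 / 2) * kernel_log z1 z2 c - \<mu> * (lsinh2 c - l2) + c =
      (\<mu> * l2 - (\<mu> - 1 / 2) * (3 * l2 + Ln (z1 * z2)) - (\<nu> - \<mu> + 1) * (a + b))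
       + ((- (\<nu> - \<mu> + 1) * of_real t + (\<mu> + 1 / 2 - 1) * Ln (1 - T)) + (\<mu> + 1 / 2 - 1) * A)"
      unfolding kl by (simp add: c field_simps)
    thus ?thesis unfolding exp_add[symmetric] exp_diff[symmetric] by (rule arg_cong)
  qed
  have bw: "beta_weight (\<nu> - \<mu> + 1) (\<mu> + 1 / 2) t = exp (- (\<nu> - \<mu> + 1) * of_real t + (\<mu> + 1 / 2 - 1) * Ln (1 - T))"
    unfolding beta_weight_conv_Ln[OF t] T_def ..
  have c3: "\<nu> + \<mu> + 1 - (\<mu> + 1 / 2) + 1 = \<nu> + 3 / 2" by (simp add: field_simps)
  have pk: "product_kernel (\<mu> + 1 / 2) (\<nu> + \<mu> + 1) Y X T = (1 - X * Y * T\<^sup>2) * exp ((\<mu> + 1 / 2 - 1) * A) * f"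
    unfolding product_kernel_def c3 f_def A_def ..
  have "product_integrand \<nu> \<mu> z1 z2 c * sinh c = K / 2 * (1 - X * Y * T\<^sup>2) * f *
     (exp (\<mu> * lsinh2 c - (\<nu> + \<mu> + 1) * c) * exp ((\<mu> - 1 / 2) * kernel_log z1 z2 c) / exp (\<mu> * (lsinh2 c - l2)) * exp c)"
    unfolding product_integrand_def kernel_powr_def Q S sh by (simp add: mult_ac)
  also have "\<dots> = K / 2 * exp (\<mu> * l2 - (\<mu> - 1 / 2) * (3 * l2 + Ln (z1 * z2)) - (\<nu> - \<mu> + 1) * (a + b))
     * (beta_weight (\<nu> - \<mu> + 1) (\<mu> + 1 / 2) t * product_kernel (\<mu> + 1 / 2) (\<nu> + \<mu> + 1) Y X T)"
    unfolding E bw pk by (simp only: mult_ac)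
  finally show ?thesis unfolding K_def l2_def X_def Y_def T_def .
qed

text \<open>The bound on \<open>Re \<mu>\<close> is the convergence condition at the lower limit,
  where the integrand is at most of order \<open>t\<close> to the power
  \<open>Re \<mu> - 1 / 2\<close>; the bound on \<open>Re (\<nu> - \<mu>)\<close> gives exponential
  decay at infinity.\<close>

theorem corollary36:
  fixes z1 z2 \<nu> \<mu> :: complex
  assumes "z1 \<in> slit_plane" and "z2 \<in> slit_plane"
    and "\<nu> \<noteq> 0" and "\<mu> \<noteq> 0"
    and "Re (\<nu> - \<mu>) > -1"
    and "Re \<mu> > -1 / 2"
  shows "cosh_contour_integrable (lower_limit z1 z2) (product_integrand \<nu> \<mu> z1 z2) \<and>
    legendre_Q \<nu> \<mu> z1 * legendre_Q \<nu> \<mu> z2 =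
      exp (\<i> * of_real pi * \<mu>) * of_real (sqrt (pi / 2)) * Gamma (\<nu> + \<mu> + 1)
        / (Gamma (\<mu> + 1 / 2) * Gamma (\<nu> - \<mu> + 1))
      * ((z1 * z2) powr (\<mu> - 1 / 2) / (sqm1_powr z1 (\<mu> / 2) * sqm1_powr z2 (\<mu> / 2)))
      * cosh_contour_integral (lower_limit z1 z2) (product_integrand \<nu> \<mu> z1 z2)"
proof -
  define a b where "a = arcosh_slit z1" and "b = arcosh_slit z2"
  define l2 where "l2 = complex_of_real (ln 2)"
  define \<beta> where "\<beta> = \<nu> + \<mu> + 1"
  define P where "P = exp (\<i> * of_real pi * \<mu>) * Gamma \<beta>"
  define F where "F d = hyp2F1_reg (\<mu> + 1 / 2) \<beta> (\<nu> + 3 / 2) (exp (- 2 * d))" for d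
  define G where "G = Gamma (\<mu> + 1 / 2) * Gamma (\<nu> - \<mu> + 1)"
  define C where "C = of_real (sqrt pi) * P / 2
     * exp (\<mu> * l2 - (\<mu> - 1 / 2) * (3 * l2 + Ln (z1 * z2)) - (\<nu> - \<mu> + 1) * (a + b))"
  let ?g = "\<lambda>t. product_integrand \<nu> \<mu> z1 z2 (lower_limit z1 z2 + of_real t) * sinh (lower_limit z1 z2 + of_real t)"
  let ?h = "\<lambda>t. beta_weight (\<nu> - \<mu> + 1) (\<mu> + 1 / 2) t
         * product_kernel (\<mu> + 1 / 2) \<beta> (exp (- 2 * b)) (exp (- 2 * a)) (exp (- of_real t))"
  \<comment> \<open>The sum of the two bounds on real parts; it keeps the third hypergeometric
    parameter away from the poles of \<open>Gamma\<close>.\<close>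
  have \<nu>: "Re (\<nu> + 3 / 2) > 0" using assms(5,6) by (simp; linarith)
  have strip: "a \<in> half_strip" "b \<in> half_strip"
    using assms(1,2)[THEN arcosh_slit_in_half_strip] by (auto simp: a_def b_def)
  hence ab: "Re a > 0" "Re b > 0" by (auto simp: half_strip_def)
  note nab = norm_exp_minus2_less_1[OF ab(1)] norm_exp_minus2_less_1[OF ab(2)]
  have gh: "?g t = C * ?h t" if "t > 0" for t
    using product_integrand_eq[OF assms(1,2) \<nu> that, of \<mu>]
    by (simp only: C_def P_def l2_def a_def b_def \<beta>_def mult.assoc)
  have \<delta>: "\<beta> - 2 * (\<mu> + 1 / 2) + 1 = \<nu> - \<mu> + 1" and \<gamma>: "\<nu> + 3 / 2 = \<beta> - (\<mu> + 1 / 2) + 1"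
    by (simp_all add: \<beta>_def field_simps)
  have "Re (\<mu> + 1 / 2) > 0" "Re (\<beta> - 2 * (\<mu> + 1 / 2)) > - 1" using assms(5,6) by (simp_all add: \<beta>_def)
  note prod = hyp2F1_reg_product[OF this \<gamma> nab, unfolded \<delta>]
  have ih: "integrable half_line ?h" by (rule prod(1))
  have "integrable half_line ?g \<longleftrightarrow> integrable half_line (\<lambda>t. C * ?h t)"
    by (rule Bochner_Integration.integrable_cong) (use gh in auto)
  hence ig: "integrable half_line ?g" using ih by simp
  have "integral\<^sup>L half_line ?g = integral\<^sup>L half_line (\<lambda>t. C * ?h t)"
    by (rule Bochner_Integration.integral_cong) (use gh in auto)
  also have "\<dots> = C * integral\<^sup>L half_line ?h" by simp
  also have "integral\<^sup>L half_line ?h = G * (((1 - exp (- 2 * a)) powr (2 * \<mu>)) * F a) * (((1 - exp (- 2 * b)) powr (2 * \<mu>)) * F b)"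
    unfolding prod(2) G_def F_def by simp
  also have "(1 - exp (- 2 * a)) powr (2 * \<mu>) = exp (2 * \<mu> * (lsinh2 a - a))"
    using one_minus_nonzero[OF nab(1)] by (simp add: powr_def lsinh2_def)
  also have "(1 - exp (- 2 * b)) powr (2 * \<mu>) = exp (2 * \<mu> * (lsinh2 b - b))"
    using one_minus_nonzero[OF nab(2)] by (simp add: powr_def lsinh2_def)
  finally have int: "cosh_contour_integral (lower_limit z1 z2) (product_integrand \<nu> \<mu> z1 z2) =
      C * (G * (exp (2 * \<mu> * (lsinh2 a - a)) * F a) * (exp (2 * \<mu> * (lsinh2 b - b)) * F b))"
    unfolding cosh_contour_integral_def integral_half_line .
  have Q: "legendre_Q \<nu> \<mu> z1 = of_real (sqrt pi) * P * exp (\<mu> * lsinh2 a - \<beta> * a) * F a"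
    "legendre_Q \<nu> \<mu> z2 = of_real (sqrt pi) * P * exp (\<mu> * lsinh2 b - \<beta> * b) * F b"
    unfolding legendre_Q_eq[OF \<nu> assms(1)] legendre_Q_eq[OF \<nu> assms(2)] legendre_Q_cosh_def
      a_def b_def P_def F_def \<beta>_def by (simp_all only: mult.assoc)
  have sq: "sqm1_powr z1 (\<mu> / 2) = exp (\<mu> * (lsinh2 a - l2))" "sqm1_powr z2 (\<mu> / 2) = exp (\<mu> * (lsinh2 b - l2))"
    using sqm1_powr_cosh[OF strip(1), of "\<mu> / 2"] sqm1_powr_cosh[OF strip(2), of "\<mu> / 2"]
    by (simp_all add: a_def b_def l2_def cosh_arcosh_slit)
  have pw: "(z1 * z2) powr (\<mu> - 1 / 2) = exp ((\<mu> - 1 / 2) * Ln (z1 * z2))"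
    using assms(1,2)[THEN slit_plane_nonzero] by (simp add: powr_def)
  have G: "G \<noteq> 0"
    using assms(5,6) Re_pos_not_nonpos_Ints[of "\<mu> + 1 / 2"] Re_pos_not_nonpos_Ints[of "\<nu> - \<mu> + 1"]
    by (simp add: G_def Gamma_eq_zero_iff)
  \<comment> \<open>The exponents of 2 add up to
    \<open>3 * \<mu> - 3 * (\<mu> - 1 / 2) = 3 / 2\<close>, and this remainder turns
    \<open>sqrt (pi / 2)\<close> into \<open>sqrt pi\<close>.\<close>
  have const: "of_real (sqrt (pi / 2)) * exp (3 / 2 * l2) / 2 = complex_of_real (sqrt pi)"
  proof -
    have "exp (3 / 2 * ln 2) = exp (ln 2 + ln (sqrt 2))" by (simp add: ln_sqrt)
    also have "\<dots> = 2 * sqrt 2" by (simp only: exp_add) simp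
    finally have "sqrt (pi / 2) * exp (3 / 2 * ln 2) / 2 = sqrt pi"
      by (simp add: real_sqrt_divide)
    moreover have "exp (3 / 2 * l2) = of_real (exp (3 / 2 * ln 2))"
      by (simp add: l2_def flip: exp_of_real)
    hence "of_real (sqrt (pi / 2)) * exp (3 / 2 * l2) / 2 = complex_of_real (sqrt (pi / 2) * exp (3 / 2 * ln 2) / 2)"
      by simp
    ultimately show ?thesis by (simp only:)
  qed
  \<comment> \<open>The powers of \<open>z1 * z2\<close> cancel. For \<open>a\<close>, and likewise
    for \<open>b\<close>, the coefficients combine as \<open>- \<mu> + 2 * \<mu> = \<mu>\<close> at
    \<open>lsinh2 a\<close> and \<open>- (\<nu> - \<mu> + 1) - 2 * \<mu> = - \<beta>\<close> at
    \<open>a\<close>, which are those of the Legendre function.\<close>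
  have E: "exp ((\<mu> - 1 / 2) * Ln (z1 * z2)) / (exp (\<mu> * (lsinh2 a - l2)) * exp (\<mu> * (lsinh2 b - l2)))
      * exp (\<mu> * l2 - (\<mu> - 1 / 2) * (3 * l2 + Ln (z1 * z2)) - (\<nu> - \<mu> + 1) * (a + b))
      * exp (2 * \<mu> * (lsinh2 a - a)) * exp (2 * \<mu> * (lsinh2 b - b))
     = exp (3 / 2 * l2) * (exp (\<mu> * lsinh2 a - \<beta> * a) * exp (\<mu> * lsinh2 b - \<beta> * b))"
  proof -
    have "(\<mu> - 1 / 2) * Ln (z1 * z2) - (\<mu> * (lsinh2 a - l2) + \<mu> * (lsinh2 b - l2))
      + (\<mu> * l2 - (\<mu> - 1 / 2) * (3 * l2 + Ln (z1 * z2)) - (\<nu> - \<mu> + 1) * (a + b))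
      + 2 * \<mu> * (lsinh2 a - a) + 2 * \<mu> * (lsinh2 b - b)
     = 3 / 2 * l2 + ((\<mu> * lsinh2 a - \<beta> * a) + (\<mu> * lsinh2 b - \<beta> * b))"
      by (simp add: \<beta>_def field_simps)
    thus ?thesis unfolding exp_add[symmetric] exp_diff[symmetric] by (rule arg_cong)
  qed
  have "exp (\<i> * of_real pi * \<mu>) * of_real (sqrt (pi / 2)) * Gamma (\<nu> + \<mu> + 1)
        / (Gamma (\<mu> + 1 / 2) * Gamma (\<nu> - \<mu> + 1))
      * ((z1 * z2) powr (\<mu> - 1 / 2) / (sqm1_powr z1 (\<mu> / 2) * sqm1_powr z2 (\<mu> / 2)))
      * cosh_contour_integral (lower_limit z1 z2) (product_integrand \<nu> \<mu> z1 z2)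
    = (P * of_real (sqrt (pi / 2)) / G)
      * (exp ((\<mu> - 1 / 2) * Ln (z1 * z2)) / (exp (\<mu> * (lsinh2 a - l2)) * exp (\<mu> * (lsinh2 b - l2))))
      * (C * (G * (exp (2 * \<mu> * (lsinh2 a - a)) * F a) * (exp (2 * \<mu> * (lsinh2 b - b)) * F b)))"
    unfolding int sq pw G_def P_def \<beta>_def by (simp only: mult_ac)
  also have "\<dots> = of_real (sqrt pi) * P * P * F a * F b * (of_real (sqrt (pi / 2)) / 2) *
      (exp ((\<mu> - 1 / 2) * Ln (z1 * z2)) / (exp (\<mu> * (lsinh2 a - l2)) * exp (\<mu> * (lsinh2 b - l2)))
      * exp (\<mu> * l2 - (\<mu> - 1 / 2) * (3 * l2 + Ln (z1 * z2)) - (\<nu> - \<mu> + 1) * (a + b))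
      * exp (2 * \<mu> * (lsinh2 a - a)) * exp (2 * \<mu> * (lsinh2 b - b)))"
    unfolding C_def using G by (simp add: mult_ac)
  also have "\<dots> = of_real (sqrt pi) * P * P * F a * F b * (of_real (sqrt (pi / 2)) * exp (3 / 2 * l2) / 2)
      * (exp (\<mu> * lsinh2 a - \<beta> * a) * exp (\<mu> * lsinh2 b - \<beta> * b))"
    unfolding E by simp
  also have "\<dots> = legendre_Q \<nu> \<mu> z1 * legendre_Q \<nu> \<mu> z2"
    unfolding const Q by (simp only: mult_ac)
  finally show ?thesis
    using ig by (simp add: cosh_contour_integrable_def integrable_half_line_iff)
qed



end
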